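(* Let $f$ be a strictly positive measurable function on $(0,\infty)$ satisfying $\sup_{x\ge \varepsilon} f(x)<\infty$ for every $\varepsilon>0$. Then for any $x>0$ the following four statements are equivalent: (i) $\mathbb{P}_x(A_\zeta(f)<\infty \mid \zeta<\infty)>0$; (ii) $\mathbb{P}_x(A_\zeta(f)<\infty \mid \zeta<\infty)=1$; (iii) $\mathbb{E}_x\Big[\int_0^{\zeta} f(Z_t)e^{-\lambda Z_t}\,dt \,\Big|\, \zeta<\infty\Big]<\infty$ for some (equivalently, for all) $\lambda>0$; (iv) $\displaystyle\int^{\infty}\frac{f(1/\lambda)}{\lambda\,\psi(\lambda)}\,d\lambda<\infty$, where $\int^\infty$ means that the integral converges near $\infty$, i.e. over $(K,\infty)$ for some $K>\Phi(0)$.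
   Context: Let $b\in\mathbb{R}$, $c\ge 0$ be constants and $\pi$ a $\sigma$-finite measure on $(0,\infty)$ with $\int_{(0,\infty)}(1\wedge z^2)\,\pi(dz)<\infty$. $Z=(Z_t)_{t\ge 0}$ is a spectrally positive Lévy process (a one-dimensional Lévy process with no negative jumps), represented when started at $x$ as $$Z_t=x-bt+\sqrt{2c}\,B_t+\int_0^t\int_{(0,1]}z\,\tilde N(ds,dz)+\int_0^t\int_{(1,\infty)}z\,N(ds,dz),$$ with $B$ a Brownian motion, $N(ds,dz)$ an independent Poisson random measure on $(0,\infty)\times(0,\infty)$ with intensity $ds\,\pi(dz)$, and $\tilde N(ds,dz)=N(ds,dz)-ds\,\pi(dz)$. Standing assumption: $Z$ is not a subordinator. $\mathbb{P}_x$ is the law of $Z$ with $Z_0=x$ and $\mathbb{E}_x$ the corresponding expectation. The Laplace exponent $\psi$ is given by $\mathbb{E}_x[e^{-\lambda Z_t}]=e^{-\lambda x+\psi(\lambda)t}$, i.e. $$\psi(\lambda)=b\lambda+c\lambda^2+\int_{(0,\infty)}\big(e^{-\lambda u}-1+\lambda u1_{(0,1]}(u)\big)\pi(du),\quad \lambda\ge 0,$$ and $\Phi(0):=\inf\{\lambda>0:\psi(\lambda)>0\}<\infty$. $\zeta:=\inf\{t>0: Z_t=0\}$ with $\inf\emptyset=\infty$ is the exit time of $(0,\infty)$; one has $\mathbb{P}_x(\zeta<\infty)=e^{-\Phi(0)x}>0$. The integral functional is $A_t(f):=\int_0^t f(Z_s)\,ds$, so $A_\zeta(f)=\int_0^\zeta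 f(Z_s)\,ds$. *)

theory Defs
  imports "HOL-Probability.Probability"
begin

text \<open>Only the time parameters \<open>t \<ge> 0\<close> of \<open>Z\<close> are meaningful. Path properties are required
  almost surely.\<close>

locale levy_process = prob_space M
  for M :: "'a measure" and Z :: "real \<Rightarrow> 'a \<Rightarrow> real" and x :: real +
  assumes random_variable_Z: "\<And>t. 0 \<le> t \<Longrightarrow> random_variable borel (Z t)"
    and start: "AE \<omega> in M. Z 0 \<omega> = x"
    and independent_increments:
      "\<And>(t :: nat \<Rightarrow> real) n. 0 \<le> t 0 \<Longrightarrow> mono t \<Longrightarrow>
         indep_vars (\<lambda>_. borel) (\<lambda>i \<omega>. Z (t (Suc i)) \<omega> - Z (t i) \<omega>) {..<n}"
    and stationary_increments:
      "\<And>s h. 0 \<le> s \<Longrightarrow> 0 \<le> h \<Longrightarrow>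
         distr M borel (\<lambda>\<omega>. Z (s + h) \<omega> - Z s \<omega>) = distr M borel (\<lambda>\<omega>. Z h \<omega> - Z 0 \<omega>)"
    and cadlag:
      "AE \<omega> in M. (\<forall>t\<ge>0. ((\<lambda>s. Z s \<omega>) \<longlongrightarrow> Z t \<omega>) (at_right t)) \<and>
                  (\<forall>t>0. \<exists>l. ((\<lambda>s. Z s \<omega>) \<longlongrightarrow> l) (at_left t))"

definition no_negative_jumps :: "'a measure \<Rightarrow> (real \<Rightarrow> 'a \<Rightarrow> real) \<Rightarrow> bool" where
  "no_negative_jumps M Z \<longleftrightarrow>
     (AE \<omega> in M. \<forall>t>0. \<forall>l. ((\<lambda>s. Z s \<omega>) \<longlongrightarrow> l) (at_left t) \<longrightarrow> l \<le> Z t \<omega>)"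

text \<open>A Levy process that is not started at \<open>0\<close> is called a subordinator if its paths are almost
  surely nondecreasing.\<close>

definition nondecreasing_paths :: "'a measure \<Rightarrow> (real \<Rightarrow> 'a \<Rightarrow> real) \<Rightarrow> bool" where
  "nondecreasing_paths M Z \<longleftrightarrow> (AE \<omega> in M. mono_on {0..} (\<lambda>t. Z t \<omega>))"

definition levy_measure :: "real measure \<Rightarrow> bool" where
  "levy_measure \<pi> \<longleftrightarrow> sets \<pi> = sets (restrict_space borel {0<..}) \<and> sigma_finite_measure \<pi> \<and>
     (\<integral>\<^sup>+z. ennreal (min 1 (z\<^sup>2)) \<partial>\<pi>) < \<infinity>"

definition laplace_exponent :: "real \<Rightarrow> real \<Rightarrow> real measure \<Rightarrow> real \<Rightarrow> real" where
  "laplace_exponent b c \<pi> l =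
     b * l + c * l\<^sup>2 + (\<integral>u. (exp (- l * u) - 1 + l * u * indicator {0<..1} u) \<partial>\<pi>)"

text \<open>A spectrally positive Levy process started at \<open>x\<close> with characteristics \<open>(b, c, \<pi>)\<close>. The
  characteristics, which are the coefficients of the Levy--Ito representation of \<open>Z\<close> (drift \<open>- b\<close>,
  Gaussian part \<open>sqrt (2 * c) * B\<close>, jump intensity \<open>\<pi>\<close>), are attached to \<open>Z\<close> through the
  Levy--Khintchine formula for its Laplace transform.\<close>

locale spectrally_positive_levy_process = levy_process M Z x
  for M :: "'a measure" and Z :: "real \<Rightarrow> 'a \<Rightarrow> real" and x :: real
    and b c :: real and \<pi> :: "real measure" +
  assumes c_nonneg: "0 \<le> c"
    and levy_measure: "levy_measure \<pi>"
    and no_negative_jumps: "no_negative_jumps M Z"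
    and laplace_transform:
      "\<And>l t. 0 \<le> l \<Longrightarrow> 0 \<le> t \<Longrightarrow>
         has_bochner_integral M (\<lambda>\<omega>. exp (- l * Z t \<omega>))
           (exp (- l * x + laplace_exponent b c \<pi> l * t))"

definition Phi0 :: "real \<Rightarrow> real \<Rightarrow> real measure \<Rightarrow> real" where
  "Phi0 b c \<pi> = Inf {l. 0 < l \<and> 0 < laplace_exponent b c \<pi> l}"

definition exit_time :: "(real \<Rightarrow> real) \<Rightarrow> ereal" where
  "exit_time z = Inf (ereal ` {t. 0 < t \<and> z t = 0})"

definition integral_functional :: "(real \<Rightarrow> real) \<Rightarrow> (real \<Rightarrow> real) \<Rightarrow> ereal \<Rightarrow> ennreal" where
  "integral_functional f z T = (\<integral>\<^sup>+s\<in>{s. 0 \<le> s \<and> ereal s < T}. ennreal (f (z s)) \<partial>lborel)"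

text \<open>The event \<open>\<zeta> < \<infinity>\<close> is an analytic event, measurable in general only with respect to the
  completed probability measure; hence probabilities involving \<open>\<zeta>\<close> are taken under the
  completion.\<close>

definition conditioned_on_exit :: "'a measure \<Rightarrow> (real \<Rightarrow> 'a \<Rightarrow> real) \<Rightarrow> 'a measure" where
  "conditioned_on_exit M Z =
     uniform_measure (completion M) {\<omega> \<in> space M. exit_time (\<lambda>t. Z t \<omega>) < \<infinity>}"

end

theory Submission
  imports Defs
begin

text \<open>Let \<open>p = \<Phi>(0)\<close> and let \<open>U(y)\<close> be the potential measure of the process started at \<open>y\<close> and killed
  on leaving \<open>(0,\<infinity>)\<close>. Optional stopping along dyadic grids shows that the Laplace transform of
  \<open>U(y)\<close> is \<open>(exp (- p y) - exp (- l y)) / \<psi> l\<close> for \<open>l > p\<close>. By uniqueness of Laplace transforms,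
  \<open>U(x + h)\<close> is the sum of \<open>exp (- p h) U(x)\<close> and of \<open>U(h)\<close> translated by \<open>x\<close>; hence \<open>U(x)\<close> is
  monotone under translations below \<open>x\<close>, and averaging over translations shows that it is
  comparable to \<open>dy / (y \<psi>(1/y))\<close> near \<open>0\<close>. This is the equivalence of (iii) and (iv).
  For (i) implies (iii), the Markov property at fixed times gives the Feynman--Kac equation
  \<open>exp (- p y) = F(y) + \<integral> k F dU(y)\<close> for \<open>F(y) = E\<^sub>y[exp (- A(k)); \<zeta> < \<infinity>]\<close>. As \<open>exp (p y) U(y)\<close>
  increases with \<open>y\<close>, the function \<open>exp (p y) F(y)\<close> decreases, so \<open>F\<close> is bounded below near \<open>0\<close> and
  \<open>\<integral> k F dU(x) \<le> 1\<close> bounds \<open>\<integral> k dU(x)\<close>, uniformly along truncations \<open>k\<close> of \<open>f\<close>. Neither scale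
  functions nor the strong Markov property are needed.\<close>

text \<open>Without negative jumps a path that becomes negative passes through 0. At the stopping
  time exp (- l Z) is therefore 1 for every l, and this makes the Laplace transform of U(y)
  explicit. The additivity in the starting point is read twice, as x + h and as h + x. Below x the
  first reading gives a multiple of U(x), the second a lower bound by U(x) translated by h;
  comparing the two gives the monotonicity under translations. For the lower bound near 0 a Laplace
  transform must be turned into the mass of [0, a]. Regular variation cannot be assumed; the
  doubling property of \<open>\<psi>\<close>, which comes from the Levy-Khintchine formula and at
  least linear growth, takes its place. In (i) implies (iii), \<open>f\<close> may explode at 0 and
  A(f) may be infinite with positive probability. Cutting \<open>f\<close> off near 0 gives bounded
  weights, and the expectation of exp (- A(f)) over the paths that die with A(f) finite is a
  positive lower bound for F, common to all truncations and all starting points up to x.\<close>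

section \<open>Uniform integrability, uniqueness of Laplace transforms, exponential
  integrals\<close>

text \<open>Boundedness in L2 gives uniform integrability. It suits the exponentials stopped along
  grids: their second moments are first moments with \<open>2 * l\<close> in place of
  \<open>l\<close>, whereas an integrable majorant common to all n is not at hand.\<close>

lemma (in finite_measure) tendsto_integral_L2_bounded:
  fixes Y :: "nat \<Rightarrow> 'a \<Rightarrow> real"
  assumes meas [measurable]: "\<And>n. Y n \<in> borel_measurable M" "W \<in> borel_measurable M"
    and lim: "AE \<omega> in M. (\<lambda>n. Y n \<omega>) \<longlonglongrightarrow> W \<omega>"
    and bd: "\<And>n. (\<integral>\<^sup>+\<omega>. ennreal ((Y n \<omega>)\<^sup>2) \<partial>M) \<le> ennreal C"
  shows "(\<lambda>n. \<integral>\<omega>. Y n \<omega> \<partial>M) \<longlonglongrightarrow> (\<integral>\<omega>. W \<omega> \<partial>M)" "integrable M W"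
proof -
  have bdW: "(\<integral>\<^sup>+\<omega>. ennreal ((W \<omega>)\<^sup>2) \<partial>M) \<le> ennreal C"
  proof -
    have "(\<integral>\<^sup>+\<omega>. ennreal ((W \<omega>)\<^sup>2) \<partial>M) = (\<integral>\<^sup>+\<omega>. liminf (\<lambda>n. ennreal ((Y n \<omega>)\<^sup>2)) \<partial>M)"
    proof (rule nn_integral_cong_AE, use lim in eventually_elim)
      fix \<omega> assume "(\<lambda>n. Y n \<omega>) \<longlonglongrightarrow> W \<omega>"
      then have "(\<lambda>n. ennreal ((Y n \<omega>)\<^sup>2)) \<longlonglongrightarrow> ennreal ((W \<omega>)\<^sup>2)"
        by (intro tendsto_intros)
      then show "ennreal ((W \<omega>)\<^sup>2) = liminf (\<lambda>n. ennreal ((Y n \<omega>)\<^sup>2))"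
        by (rule lim_imp_Liminf[OF trivial_limit_sequentially, symmetric])
    qed
    also have "\<dots> \<le> liminf (\<lambda>n. \<integral>\<^sup>+\<omega>. ennreal ((Y n \<omega>)\<^sup>2) \<partial>M)"
      by (rule nn_integral_liminf) auto
    also have "\<dots> \<le> ennreal C"
      using bd by (intro Liminf_le) (auto intro: always_eventually)
    finally show ?thesis .
  qed
  define D where "D = max C 0"
  have D: "D \<ge> 0" "ennreal C \<le> ennreal D" by (auto simp: D_def ennreal_leI)
  have sq: "integrable M (\<lambda>\<omega>. (V \<omega>)\<^sup>2) \<and> (\<integral>\<omega>. (V \<omega>)\<^sup>2 \<partial>M) \<le> D"
    if [measurable]: "V \<in> borel_measurable M" and "(\<integral>\<^sup>+\<omega>. ennreal ((V \<omega>)\<^sup>2) \<partial>M) \<le> ennreal C" for V :: "'a \<Rightarrow> real"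
  proof -
    have le: "(\<integral>\<^sup>+\<omega>. ennreal ((V \<omega>)\<^sup>2) \<partial>M) \<le> ennreal D" by (rule order_trans[OF that(2) D(2)])
    then have i: "integrable M (\<lambda>\<omega>. (V \<omega>)\<^sup>2)"
      by (intro integrableI_bounded) (simp_all add: le_less_trans[OF le ennreal_less_top])
    then show ?thesis using le D(1) by (simp add: nn_integral_eq_integral)
  qed
  have int: "integrable M V"
    if [measurable]: "V \<in> borel_measurable M" and "(\<integral>\<^sup>+\<omega>. ennreal ((V \<omega>)\<^sup>2) \<partial>M) \<le> ennreal C" for V :: "'a \<Rightarrow> real"
  proof (rule Bochner_Integration.integrable_bound)
    show "integrable M (\<lambda>\<omega>. 1 + (V \<omega>)\<^sup>2)" using sq[OF that] by simp
    have "\<bar>v\<bar> \<le> 1 + v\<^sup>2" for v :: real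
    proof -
      have "0 \<le> (\<bar>v\<bar> - 1)\<^sup>2" by simp
      then have "2 * \<bar>v\<bar> \<le> 1 + v\<^sup>2" by (simp only: power2_diff) simp
      then show ?thesis by linarith
    qed
    then show "AE \<omega> in M. norm (V \<omega>) \<le> norm (1 + (V \<omega>)\<^sup>2)" by auto
  qed simp
  show iW: "integrable M W" by (rule int[OF meas(2) bdW])
  have iY: "integrable M (Y n)" for n by (rule int[OF meas(1) bd])
  show "(\<lambda>n. \<integral>\<omega>. Y n \<omega> \<partial>M) \<longlonglongrightarrow> (\<integral>\<omega>. W \<omega> \<partial>M)"
  proof (rule LIMSEQ_I)
    fix e :: real assume e: "e > 0"
    \<comment> \<open>Values above the level \<open>K\<close> cost at most \<open>4 * D / K\<close>,
      which is below \<open>e / 2\<close>; the summand 1 keeps \<open>K\<close> positive when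
      \<open>D\<close> is 0.\<close>
    define K where "K = (8 * D + 1) / e"
    have K: "K > 0" "4 * D / K < e / 2" proof -
      show K0: "K > 0" unfolding K_def using e D(1) by (intro divide_pos_pos) auto
      have "K * e = 8 * D + 1" using e by (simp add: K_def)
      then show "4 * D / K < e / 2" using K0 by (simp add: pos_divide_less_eq algebra_simps)
    qed
    have lim0: "(\<lambda>n. \<integral>\<omega>. min \<bar>Y n \<omega> - W \<omega>\<bar> K \<partial>M) \<longlonglongrightarrow> (\<integral>\<omega>. 0 \<partial>M)"
    proof (rule integral_dominated_convergence[where w="\<lambda>_. K"])
      show "AE \<omega> in M. (\<lambda>n. min \<bar>Y n \<omega> - W \<omega>\<bar> K) \<longlonglongrightarrow> 0"
        using lim
      proof eventually_elim
        case (elim \<omega>)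
        then have "(\<lambda>n. min \<bar>Y n \<omega> - W \<omega>\<bar> K) \<longlonglongrightarrow> min \<bar>W \<omega> - W \<omega>\<bar> K"
          by (intro tendsto_intros)
        then show ?case using K by simp
      qed
    qed (use K in auto)
    have "\<exists>N. \<forall>n\<ge>N. \<bar>\<integral>\<omega>. min \<bar>Y n \<omega> - W \<omega>\<bar> K \<partial>M\<bar> < e / 2"
      using LIMSEQ_D[OF lim0, of "e/2"] e by simp
    then obtain N where N: "\<And>n. n \<ge> N \<Longrightarrow> \<bar>\<integral>\<omega>. min \<bar>Y n \<omega> - W \<omega>\<bar> K \<partial>M\<bar> < e / 2"
      by blast
    show "\<exists>N. \<forall>n\<ge>N. norm ((\<integral>\<omega>. Y n \<omega> \<partial>M) - (\<integral>\<omega>. W \<omega> \<partial>M)) < e"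
    proof (intro exI allI impI)
      fix n assume n: "n \<ge> N"
      have imin: "integrable M (\<lambda>\<omega>. min \<bar>Y n \<omega> - W \<omega>\<bar> K)"
        by (rule Bochner_Integration.integrable_bound[where f="\<lambda>_. K"]) (use K in auto)
      have isq: "integrable M (\<lambda>\<omega>. (2 * (Y n \<omega>)\<^sup>2 + 2 * (W \<omega>)\<^sup>2) / K)"
        using sq[OF meas(1) bd] sq[OF meas(2) bdW] by simp
      have "norm ((\<integral>\<omega>. Y n \<omega> \<partial>M) - (\<integral>\<omega>. W \<omega> \<partial>M)) = norm (\<integral>\<omega>. Y n \<omega> - W \<omega> \<partial>M)"
        using iY iW by simp
      also have "\<dots> \<le> (\<integral>\<omega>. \<bar>Y n \<omega> - W \<omega>\<bar> \<partial>M)"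
        using integral_norm_bound[of M "\<lambda>\<omega>. Y n \<omega> - W \<omega>"] by simp
      \<comment> \<open>Where the difference exceeds \<open>K\<close> it is at most its square
        divided by \<open>K\<close>; the truncated part is left to dominated convergence.\<close>
      also have "\<dots> \<le> (\<integral>\<omega>. min \<bar>Y n \<omega> - W \<omega>\<bar> K + (2 * (Y n \<omega>)\<^sup>2 + 2 * (W \<omega>)\<^sup>2) / K \<partial>M)"
      proof (rule integral_mono)
        fix \<omega>
        let ?u = "\<bar>Y n \<omega> - W \<omega>\<bar>"
        have "0 \<le> (Y n \<omega> + W \<omega>)\<^sup>2" by simp
        then have sqle: "?u\<^sup>2 \<le> 2 * (Y n \<omega>)\<^sup>2 + 2 * (W \<omega>)\<^sup>2"
          by (simp add: power2_sum power2_diff)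
        show "?u \<le> min ?u K + (2 * (Y n \<omega>)\<^sup>2 + 2 * (W \<omega>)\<^sup>2) / K"
        proof (cases "?u \<le> K")
          case True then show ?thesis using K by simp
        next
          case False
          then have "?u * K \<le> ?u * ?u" by (intro mult_left_mono) auto
          then have "?u * K \<le> ?u\<^sup>2" by (simp only: power2_eq_square)
          then have "?u \<le> (2 * (Y n \<omega>)\<^sup>2 + 2 * (W \<omega>)\<^sup>2) / K"
            using sqle K by (simp add: pos_le_divide_eq)
          then show ?thesis using K by simp
        qed
      qed (use iY iW imin isq in auto)
      also have "\<dots> = (\<integral>\<omega>. min \<bar>Y n \<omega> - W \<omega>\<bar> K \<partial>M) +
          (2 * (\<integral>\<omega>. (Y n \<omega>)\<^sup>2 \<partial>M) + 2 * (\<integral>\<omega>. (W \<omega>)\<^sup>2 \<partial>M)) / K"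
        using imin isq sq[OF meas(1) bd] sq[OF meas(2) bdW] by simp
      also have "\<dots> \<le> (\<integral>\<omega>. min \<bar>Y n \<omega> - W \<omega>\<bar> K \<partial>M) + 4 * D / K"
        using sq[OF meas(1)[of n] bd[of n]] sq[OF meas(2) bdW] K by (auto simp: divide_right_mono)
      also have "\<dots> < e" using N[OF n] K by linarith
      finally show "norm ((\<integral>\<omega>. Y n \<omega> \<partial>M) - (\<integral>\<omega>. W \<omega> \<partial>M)) < e" .
    qed
  qed
qed

text \<open>Under s = exp (- y) the transforms at the integers become the moments of a measure on
  the unit interval, and by Weierstrass approximation these determine the integrals of all
  continuous functions of s. Finite total mass controls the approximation error.\<close>

lemma finite_borel_measure_eqI_laplace:
  assumes \<mu>: "finite_borel_measure \<mu>" and \<nu>: "finite_borel_measure \<nu>"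
    and pos: "AE y in \<mu>. 0 \<le> y" "AE y in \<nu>. 0 \<le> y"
    and eq: "\<And>n::nat. (\<integral>y. exp (- (real n * y)) \<partial>\<mu>) = (\<integral>y. exp (- (real n * y)) \<partial>\<nu>)"
  shows "\<mu> = \<nu>"
proof -
  interpret m: finite_borel_measure \<mu> by fact
  interpret n: finite_borel_measure \<nu> by fact
  have sp: "space \<mu> = UNIV" "space \<nu> = UNIV"
    using sets_eq_imp_space_eq[OF m.M_is_borel] sets_eq_imp_space_eq[OF n.M_is_borel] by simp_all
  have int: "integrable \<rho> (\<lambda>y. g (exp (- y)))"
    if r: "finite_borel_measure \<rho>" "AE y in \<rho>. 0 \<le> y" and g: "continuous_on UNIV g" for \<rho> and g :: "real \<Rightarrow> real"
  proof -
    interpret r: finite_borel_measure \<rho> by fact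
    have [measurable_cong]: "sets \<rho> = sets borel" by (rule r.M_is_borel)
    have [measurable]: "g \<in> borel_measurable borel" using g by (rule borel_measurable_continuous_onI)
    have "compact (g ` {0..1})" using g by (intro compact_continuous_image continuous_on_subset[OF g]) auto
    then obtain B where B: "\<And>s. s \<in> {0..1} \<Longrightarrow> norm (g s) \<le> B"
      using compact_imp_bounded by (fastforce simp: bounded_iff)
    show ?thesis
    proof (rule r.integrable_const_bound[where B=B])
      show "AE y in \<rho>. norm (g (exp (- y))) \<le> B"
        using r(2) by eventually_elim (rule B, simp)
    qed simp
  qed
  note im = int[OF \<mu> pos(1)] and inn = int[OF \<nu> pos(2)]
  have poly: "(\<integral>y. (\<Sum>i\<le>k. a i * exp (- y) ^ i) \<partial>\<mu>) = (\<integral>y. (\<Sum>i\<le>k. a i * exp (- y) ^ i) \<partial>\<nu>)"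
    for k :: nat and a :: "nat \<Rightarrow> real"
  proof -
    have e: "exp (- y) ^ i = exp (- (real i * y))" for y :: real and i by (simp flip: exp_of_nat_mult)
    have "integrable \<mu> (\<lambda>y. exp (- y) ^ i)" "integrable \<nu> (\<lambda>y. exp (- y) ^ i)" for i
      by (rule im inn, intro continuous_intros)+
    then show ?thesis by (simp add: e eq)
  qed
  have cont: "(\<integral>y. g (exp (- y)) \<partial>\<mu>) = (\<integral>y. g (exp (- y)) \<partial>\<nu>)"
    if g: "continuous_on UNIV g" for g :: "real \<Rightarrow> real"
  proof -
    let ?c = "measure \<mu> (space \<mu>) + measure \<nu> (space \<nu>)"
    have le: "\<bar>(\<integral>y. g (exp (- y)) \<partial>\<mu>) - (\<integral>y. g (exp (- y)) \<partial>\<nu>)\<bar> \<le> e * ?c" if "e > 0" for e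
    proof -
      have g1: "continuous_on {0..1} g" using g by (rule continuous_on_subset) simp
      obtain q where q: "real_polynomial_function q" "\<And>s. s \<in> {0..1} \<Longrightarrow> \<bar>g s - q s\<bar> < e"
        by (rule Stone_Weierstrass_real_polynomial_function[OF compact_Icc g1 \<open>e > 0\<close>]) auto
      then obtain a k where qa: "q = (\<lambda>s. \<Sum>i\<le>k. a i * s ^ i)"
        using real_polynomial_function_iff_sum by blast
      have qc: "continuous_on UNIV q" unfolding qa by (intro continuous_intros)
      have bnd: "\<bar>(\<integral>y. g (exp (- y)) \<partial>\<rho>) - (\<integral>y. q (exp (- y)) \<partial>\<rho>)\<bar> \<le> e * measure \<rho> (space \<rho>)"
        if r: "finite_borel_measure \<rho>" "AE y in \<rho>. 0 \<le> y" for \<rho>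
      proof -
        interpret r: finite_borel_measure \<rho> by fact
        have "\<bar>(\<integral>y. g (exp (- y)) \<partial>\<rho>) - (\<integral>y. q (exp (- y)) \<partial>\<rho>)\<bar> = \<bar>\<integral>y. g (exp (- y)) - q (exp (- y)) \<partial>\<rho>\<bar>"
          using int[OF r g] int[OF r qc] by simp
        also have "\<dots> \<le> (\<integral>y. \<bar>g (exp (- y)) - q (exp (- y))\<bar> \<partial>\<rho>)"
          using integral_norm_bound[of \<rho> "\<lambda>y. g (exp (- y)) - q (exp (- y))"] by simp
        also have "\<dots> \<le> (\<integral>y. e \<partial>\<rho>)"
          using r(2) int[OF r g] int[OF r qc]
          by (intro integral_mono_AE) (auto elim!: eventually_mono intro!: less_imp_le q(2))
        finally show ?thesis by (simp add: mult.commute)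
      qed
      have "(\<integral>y. q (exp (- y)) \<partial>\<mu>) = (\<integral>y. q (exp (- y)) \<partial>\<nu>)" unfolding qa by (rule poly)
      with bnd[OF \<mu> pos(1)] bnd[OF \<nu> pos(2)] show ?thesis by (simp add: algebra_simps abs_le_iff)
    qed
    show ?thesis
    proof (rule ccontr)
      define c where "c = ?c"
      define d where "d = \<bar>(\<integral>y. g (exp (- y)) \<partial>\<mu>) - (\<integral>y. g (exp (- y)) \<partial>\<nu>)\<bar>"
      assume "\<not> ?thesis"
      then have d: "d > 0" by (simp add: d_def)
      have c: "c \<ge> 0" unfolding c_def by (intro add_nonneg_nonneg measure_nonneg)
      have e: "d / (c + 1) > 0" using c d by (intro divide_pos_pos) auto
      have "d \<le> d / (c + 1) * c" unfolding d_def c_def by (rule le) (use e in \<open>simp only: d_def c_def\<close>)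
      also have "\<dots> < d / (c + 1) * (c + 1)" using e by (intro mult_strict_left_mono) auto
      also have "\<dots> = d" using c by auto
      finally show False by simp
    qed
  qed
  have Ioi: "measure \<mu> {a<..} = measure \<nu> {a<..}" for a
  proof -
    \<comment> \<open>Continuous ramps in s that tend to the indicator of s < exp (- a), that is, of
      y > a.\<close>
    define g where "g k s = min 1 (max 0 (real k * (exp (- a) - s)))" for k and s :: real
    have gc: "continuous_on UNIV (g k)" for k unfolding g_def by (intro continuous_intros)
    have g01: "0 \<le> g k s" "g k s \<le> 1" for k s by (auto simp: g_def)
    have glim: "(\<lambda>k. g k (exp (- y))) \<longlonglongrightarrow> indicator {a<..} y" for y
    proof (cases "a < y")
      case True
      then have d: "exp (- a) - exp (- y) > 0" by simp
      obtain m :: nat where m: "1 / (exp (- a) - exp (- y)) < m" using reals_Archimedean2 by blast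
      have "eventually (\<lambda>k. g k (exp (- y)) = 1) sequentially"
        using eventually_ge_at_top[of m]
      proof eventually_elim
        case (elim k)
        have "1 \<le> real m * (exp (- a) - exp (- y))" using m d by (simp add: divide_simps)
        also have "\<dots> \<le> real k * (exp (- a) - exp (- y))" using elim d by simp
        finally show ?case by (simp add: g_def)
      qed
      then show ?thesis using True by (simp add: tendsto_eventually)
    next
      case False
      then have "g k (exp (- y)) = 0" for k by (simp add: g_def mult_nonneg_nonpos)
      then show ?thesis using False by simp
    qed
    have "(\<lambda>k. \<integral>y. g k (exp (- y)) \<partial>\<rho>) \<longlonglongrightarrow> (\<integral>y. indicator {a<..} y \<partial>\<rho>)" if r: "finite_borel_measure \<rho>" for \<rho>
    proof -
      interpret r: finite_borel_measure \<rho> by fact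
      have [measurable_cong]: "sets \<rho> = sets borel" by (rule r.M_is_borel)
      have [measurable]: "g k \<in> borel_measurable borel" for k using gc by (rule borel_measurable_continuous_onI)
      show ?thesis
        by (rule integral_dominated_convergence[where w="\<lambda>_. 1"]) (use g01 glim in auto)
    qed
    from this[OF \<mu>] this[OF \<nu>] have "(\<integral>y. indicator {a<..} y \<partial>\<mu>) = (\<integral>y. indicator {a<..} y \<partial>\<nu> :: real)"
      using cont[OF gc] by (simp add: LIMSEQ_unique)
    then show ?thesis by (simp add: sp)
  qed
  have tot: "measure \<mu> UNIV = measure \<nu> UNIV" using eq[of 0] by (simp add: sp)
  have "cdf \<mu> = cdf \<nu>"
  proof
    fix a
    have *: "measure \<rho> {..a} = measure \<rho> UNIV - measure \<rho> {a<..}" if "finite_borel_measure \<rho>" for \<rho>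
    proof -
      interpret r: finite_borel_measure \<rho> by fact
      have "UNIV - {a<..} = {..a}" by auto
      then show ?thesis using r.finite_measure_Diff[of UNIV "{a<..}"] by (simp add: r.M_is_borel)
    qed
    show "cdf \<mu> a = cdf \<nu> a" using *[OF \<mu>] *[OF \<nu>] Ioi tot by (simp add: cdf_def)
  qed
  then show ?thesis using cdf_unique' \<mu> \<nu> by blast
qed

text \<open>Replaces the differentiation of an indefinite integral whose integrand is merely
  measurable: the quadratic bound makes the derivative exist and vanish everywhere.\<close>

lemma const_of_quadratic_increments:
  fixes H :: "real \<Rightarrow> real"
  assumes "\<And>s t. s \<le> t \<Longrightarrow> \<bar>H t - H s\<bar> \<le> K * (t - s)\<^sup>2"
  shows "H s = H t"
proof -
  have K: "\<bar>H t - H s\<bar> \<le> \<bar>K\<bar> * (t - s)\<^sup>2" for s t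
  proof -
    have "K * (t - s)\<^sup>2 \<le> \<bar>K\<bar> * (t - s)\<^sup>2" by (intro mult_right_mono) auto
    moreover have "\<bar>H t - H s\<bar> \<le> K * (t - s)\<^sup>2"
    proof (cases "s \<le> t")
      case False
      then have "\<bar>H s - H t\<bar> \<le> K * (s - t)\<^sup>2" using assms by simp
      then show ?thesis by (simp only: abs_minus_commute[of "H s"] power2_commute[of s])
    qed (rule assms)
    ultimately show ?thesis by linarith
  qed
  have "(H has_real_derivative 0) (at t)" for t
    unfolding has_field_derivative_iff
  proof (rule Lim_null_comparison)
    show "\<forall>\<^sub>F y in at t. norm ((H y - H t) / (y - t)) \<le> \<bar>K\<bar> * \<bar>y - t\<bar>"
    proof (rule always_eventually, rule allI)
      fix y
      show "norm ((H y - H t) / (y - t)) \<le> \<bar>K\<bar> * \<bar>y - t\<bar>"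
        using K[of y t] by (cases "y = t") (auto simp: divide_simps power2_eq_square abs_mult ac_simps)
    qed
    have "((\<lambda>y. \<bar>K\<bar> * \<bar>y - t\<bar>) \<longlongrightarrow> \<bar>K\<bar> * \<bar>t - t\<bar>) (at t)" by (intro tendsto_intros)
    then show "((\<lambda>y. \<bar>K\<bar> * \<bar>y - t\<bar>) \<longlongrightarrow> 0) (at t)" by simp
  qed
  then show ?thesis by (intro DERIV_isconst_all) auto
qed

text \<open>Formally the integral of the derivative of exp (- R), since R has derivative - g. For
  measurable \<open>g\<close> this derivative need not exist at every point, so increments are
  compared instead, which is possible because \<open>g\<close> is bounded.\<close>

lemma integral_exp_neg_tail:
  fixes g :: "real \<Rightarrow> real"
  assumes int: "integrable lborel g" and nn: "\<And>s. 0 \<le> g s" and bd: "\<And>s. g s \<le> C"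
  defines "R \<equiv> \<lambda>t. \<integral>s. indicator {t<..} s * g s \<partial>lborel"
  shows "integrable lborel (\<lambda>t. g t * exp (- R t))"
    "(\<integral>t. g t * exp (- R t) \<partial>lborel) = 1 - exp (- (\<integral>s. g s \<partial>lborel))"
proof -
  have [measurable]: "g \<in> borel_measurable borel" using int by auto
  have iA: "integrable lborel (\<lambda>s. indicator B s * g s)" if "B \<in> sets borel" for B
    using integrable_mult_indicator[OF _ int, of B] that by simp
  have C: "C \<ge> 0" using nn[of 0] bd[of 0] by linarith
  have Rdiff: "R s - R t = (\<integral>u. indicator {s<..t} u * g u \<partial>lborel)" if "s \<le> t" for s t
  proof -
    have "R s - R t = (\<integral>u. indicator {s<..} u * g u - indicator {t<..} u * g u \<partial>lborel)"
      unfolding R_def by (rule Bochner_Integration.integral_diff[symmetric]) (auto intro: iA)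
    also have "\<dots> = (\<integral>u. indicator {s<..t} u * g u \<partial>lborel)"
      using that by (intro Bochner_Integration.integral_cong) (auto simp: indicator_def)
    finally show ?thesis .
  qed
  have Rnn: "R t \<ge> 0" for t unfolding R_def by (rule Bochner_Integration.integral_nonneg) (simp add: nn)
  have Ranti: "R t \<le> R s" if "s \<le> t" for s t
  proof -
    have "0 \<le> R s - R t" unfolding Rdiff[OF that]
      by (rule Bochner_Integration.integral_nonneg) (simp add: nn)
    then show ?thesis by simp
  qed
  then have "antimono R" by (auto intro: antimonoI)
  then have [measurable]: "R \<in> borel_measurable borel"
    using borel_measurable_mono[of "\<lambda>t. - R t"] by (auto simp: antimono_def mono_def) 
  show iQ: "integrable lborel (\<lambda>t. g t * exp (- R t))"
    by (rule Bochner_Integration.integrable_bound[OF int])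
       (auto simp: abs_mult nn Rnn intro!: mult_left_le)
  have iQB: "integrable lborel (\<lambda>t. indicator B t * (g t * exp (- R t)))" if "B \<in> sets borel" for B
    using integrable_mult_indicator[OF _ iQ, of B] that by simp
  define Q where "Q t = (\<integral>s. indicator {..t} s * (g s * exp (- R s)) \<partial>lborel)" for t
  \<comment> \<open>From s to t both terms grow by an amount between \<open>exp (- R s) * r\<close>
    and \<open>exp (- R t) * r\<close>, where \<open>r\<close> is the mass of \<open>g\<close> in
    between, so \<open>H\<close> changes by at most the square of \<open>r\<close>. Being constant,
    \<open>H\<close> has equal limits at both ends of the line, and these are the two sides of the
    formula.\<close>
  define H where "H t = exp (- R t) - Q t" for t
  have Hc: "\<bar>H t - H s\<bar> \<le> C\<^sup>2 * (t - s)\<^sup>2" if st: "s \<le> t" for s t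
  proof -
    define r where "r = R s - R t"
    have r0: "r \<ge> 0" using Ranti[OF st] by (simp add: r_def)
    have "r \<le> (\<integral>u. C * indicator {s<..t} u \<partial>lborel)"
      unfolding r_def Rdiff[OF st]
    proof (rule integral_mono)
      show "integrable lborel (\<lambda>u. C * indicator {s<..t} u :: real)"
        using st by (intro integrable_mult_right integrable_real_indicator) auto
    qed (auto intro!: iA simp: bd split: split_indicator)
    also have "\<dots> = C * (t - s)" using st by simp
    finally have rC: "r \<le> C * (t - s)" .
    have Qd: "Q t - Q s = (\<integral>u. indicator {s<..t} u * (g u * exp (- R u)) \<partial>lborel)"
    proof -
      have "Q t - Q s = (\<integral>u. indicator {..t} u * (g u * exp (- R u)) - indicator {..s} u * (g u * exp (- R u)) \<partial>lborel)"
        unfolding Q_def by (rule Bochner_Integration.integral_diff[symmetric]) (auto intro: iQB)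
      also have "\<dots> = (\<integral>u. indicator {s<..t} u * (g u * exp (- R u)) \<partial>lborel)"
        using that by (intro Bochner_Integration.integral_cong) (auto simp: indicator_def)
      finally show ?thesis .
    qed
    have Qu: "Q t - Q s \<le> exp (- R t) * r"
    proof -
      have "Q t - Q s \<le> (\<integral>u. exp (- R t) * (indicator {s<..t} u * g u) \<partial>lborel)"
        unfolding Qd
      proof (rule integral_mono)
        fix u show "indicator {s<..t} u * (g u * exp (- R u)) \<le> exp (- R t) * (indicator {s<..t} u * g u)"
          using mult_left_mono[OF _ nn[of u], of "exp (- R u)" "exp (- R t)"] Ranti[of u t]
            by (auto simp: indicator_def mult.commute)
      qed (auto intro!: iA iQB)
      then show ?thesis unfolding r_def Rdiff[OF st] by simp
    qed
    have Ql: "exp (- R s) * r \<le> Q t - Q s"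
    proof -
      have "(\<integral>u. exp (- R s) * (indicator {s<..t} u * g u) \<partial>lborel) \<le> Q t - Q s"
        unfolding Qd
      proof (rule integral_mono)
        fix u show "exp (- R s) * (indicator {s<..t} u * g u) \<le> indicator {s<..t} u * (g u * exp (- R u))"
          using mult_left_mono[OF _ nn[of u], of "exp (- R s)" "exp (- R u)"] Ranti[of s u]
            by (auto simp: indicator_def mult.commute)
      qed (auto intro!: iA iQB)
      then show ?thesis unfolding r_def Rdiff[OF st] by simp
    qed
    have e1: "exp (- R t) - exp (- R s) = exp (- R t) * (1 - exp (- r))"
      by (simp add: r_def algebra_simps flip: exp_add)
    have e2: "exp (- R t) - exp (- R s) = exp (- R s) * (exp r - 1)"
      by (simp add: r_def algebra_simps flip: exp_add)
    have "1 - exp (- r) \<le> r" using exp_ge_add_one_self[of "- r"] by linarith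
    then have Eu: "exp (- R t) - exp (- R s) \<le> exp (- R t) * r" unfolding e1 by simp
    have "r \<le> exp r - 1" using exp_ge_add_one_self[of r] by linarith
    then have El: "exp (- R s) * r \<le> exp (- R t) - exp (- R s)" unfolding e2 by simp
    have "exp (- R t) * r \<le> 1 * r" using Rnn[of t] r0 by (intro mult_right_mono) auto
    then have Er: "exp (- R t) - exp (- R s) \<le> r" using Eu by linarith
    have "\<bar>H t - H s\<bar> \<le> exp (- R t) * r - exp (- R s) * r"
      using Qu Ql Eu El by (auto simp: H_def abs_le_iff)
    also have "\<dots> = (exp (- R t) - exp (- R s)) * r" by (simp add: algebra_simps)
    also have "\<dots> \<le> r * r" using Er r0 by (rule mult_right_mono)
    also have "\<dots> \<le> (C * (t - s)) * (C * (t - s))" using rC r0 by (intro mult_mono) auto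
    finally show ?thesis by (simp add: power2_eq_square algebra_simps)
  qed
  have const: "H s = H t" for s t using const_of_quadratic_increments[OF Hc] .
  have l1: "(\<lambda>n. R (real n)) \<longlonglongrightarrow> integral\<^sup>L lborel (\<lambda>s::real. 0)"
    unfolding R_def
  proof (rule integral_dominated_convergence[where w=g])
    show "AE s in lborel. (\<lambda>n. indicator {real n<..} s * g s) \<longlonglongrightarrow> 0"
    proof (rule AE_I2)
      fix s :: real
      obtain m :: nat where "s \<le> real m" using real_arch_simple by blast
      then have "eventually (\<lambda>n. indicator {real n<..} s * g s = 0) sequentially"
        by (intro eventually_sequentiallyI[of m]) auto
      then show "(\<lambda>n. indicator {real n<..} s * g s) \<longlonglongrightarrow> 0" by (rule tendsto_eventually)
    qed
  qed (use int in \<open>auto simp: nn indicator_def\<close>)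
  have l2: "(\<lambda>n. R (- real n)) \<longlonglongrightarrow> (\<integral>s. g s \<partial>lborel)"
    unfolding R_def
  proof (rule integral_dominated_convergence[where w=g])
    show "AE s in lborel. (\<lambda>n. indicator {- real n<..} s * g s) \<longlonglongrightarrow> g s"
    proof (rule AE_I2)
      fix s :: real
      obtain m :: nat where "- s < real m" using reals_Archimedean2 by blast
      then have "eventually (\<lambda>n. indicator {- real n<..} s * g s = g s) sequentially"
        by (intro eventually_sequentiallyI[of m]) auto
      then show "(\<lambda>n. indicator {- real n<..} s * g s) \<longlonglongrightarrow> g s" by (rule tendsto_eventually)
    qed
  qed (use int in \<open>auto simp: nn indicator_def\<close>)
  have l3: "(\<lambda>n. Q (real n)) \<longlonglongrightarrow> (\<integral>t. g t * exp (- R t) \<partial>lborel)"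
    unfolding Q_def
  proof (rule integral_dominated_convergence[where w="\<lambda>t. g t * exp (- R t)"])
    show "AE s in lborel. (\<lambda>n. indicator {..real n} s * (g s * exp (- R s))) \<longlonglongrightarrow> g s * exp (- R s)"
    proof (rule AE_I2)
      fix s :: real
      obtain m :: nat where "s \<le> real m" using real_arch_simple by blast
      then have "eventually (\<lambda>n. indicator {..real n} s * (g s * exp (- R s)) = g s * exp (- R s)) sequentially"
        by (intro eventually_sequentiallyI[of m]) auto
      then show "(\<lambda>n. indicator {..real n} s * (g s * exp (- R s))) \<longlonglongrightarrow> g s * exp (- R s)" by (rule tendsto_eventually)
    qed
  qed (use iQ in \<open>auto simp: nn indicator_def\<close>)
  have l4: "(\<lambda>n. Q (- real n)) \<longlonglongrightarrow> integral\<^sup>L lborel (\<lambda>s::real. 0)"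
    unfolding Q_def
  proof (rule integral_dominated_convergence[where w="\<lambda>t. g t * exp (- R t)"])
    show "AE s in lborel. (\<lambda>n. indicator {..- real n} s * (g s * exp (- R s))) \<longlonglongrightarrow> 0"
    proof (rule AE_I2)
      fix s :: real
      obtain m :: nat where "- s < real m" using reals_Archimedean2 by blast
      then have "eventually (\<lambda>n. indicator {..- real n} s * (g s * exp (- R s)) = 0) sequentially"
        by (intro eventually_sequentiallyI[of m]) auto
      then show "(\<lambda>n. indicator {..- real n} s * (g s * exp (- R s))) \<longlonglongrightarrow> 0" by (rule tendsto_eventually)
    qed
  qed (use iQ in \<open>auto simp: nn indicator_def\<close>)
  have "(\<lambda>n. H (real n)) \<longlonglongrightarrow> exp (- 0) - (\<integral>t. g t * exp (- R t) \<partial>lborel)"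
    unfolding H_def using l1 l3 by (intro tendsto_intros) auto
  then have "(\<lambda>n::nat. H 0) \<longlonglongrightarrow> exp (- 0) - (\<integral>t. g t * exp (- R t) \<partial>lborel)"
    by (subst (asm) const[of _ 0])
  then have e1: "H 0 = exp (- 0) - (\<integral>t. g t * exp (- R t) \<partial>lborel)"
    by (simp only: LIMSEQ_const_iff)
  have "(\<lambda>n. H (- real n)) \<longlonglongrightarrow> exp (- (\<integral>s. g s \<partial>lborel)) - 0"
    unfolding H_def using l2 l4 by (intro tendsto_intros) auto
  then have "(\<lambda>n::nat. H 0) \<longlonglongrightarrow> exp (- (\<integral>s. g s \<partial>lborel)) - 0"
    by (subst (asm) const[of _ 0])
  then have "H 0 = exp (- (\<integral>s. g s \<partial>lborel)) - 0"
    by (simp only: LIMSEQ_const_iff)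
  with e1 have "exp (- 0) - (\<integral>t. g t * exp (- R t) \<partial>lborel) = exp (- (\<integral>s. g s \<partial>lborel)) - 0"
    by (simp only:)
  then show "(\<integral>t. g t * exp (- R t) \<partial>lborel) = 1 - exp (- (\<integral>s. g s \<partial>lborel))" by simp
qed

text \<open>Carries the integral in (iv) over to one near 0. The substitution is made on compact
  intervals, which are then exhausted by monotone convergence; the endpoints are null sets.\<close>

lemma nn_integral_inverse_substitution:
  fixes \<phi> :: "real \<Rightarrow> real"
  assumes [measurable]: "\<phi> \<in> borel_measurable borel" and K: "0 < K"
  shows "(\<integral>\<^sup>+l\<in>{K<..}. ennreal (\<phi> (1 / l) / l\<^sup>2) \<partial>lborel) = (\<integral>\<^sup>+y\<in>{0<..<1/K}. ennreal (\<phi> y) \<partial>lborel)"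
proof -
  have fin: "(\<integral>\<^sup>+l\<in>{K..K + real n}. ennreal (\<phi> (1 / l) / l\<^sup>2) \<partial>lborel)
      = (\<integral>\<^sup>+y\<in>{1/(K + real n)..1/K}. ennreal (\<phi> y) \<partial>lborel)" for n
  proof -
    \<comment> \<open>The substitution rule asks for a nonnegative derivative, so it is applied to -
      1/x; a reflection removes the sign afterwards.\<close>
    have d: "((\<lambda>x. - (1 / x)) has_real_derivative 1 / x\<^sup>2) (at x)" if "x \<in> {K..K + real n}" for x
      using that K by (auto intro!: derivative_eq_intros simp: power2_eq_square)
    have "(\<integral>\<^sup>+x. ennreal (\<phi> (- x) * indicator {- (1 / K)..- (1 / (K + real n))} x) \<partial>lborel)
        = (\<integral>\<^sup>+x. ennreal (\<phi> (- (- (1 / x))) * (1 / x\<^sup>2) * indicator {K..K + real n} x) \<partial>lborel)"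
    proof (rule nn_integral_substitution[where g="\<lambda>x. - (1 / x)" and g'="\<lambda>x. 1 / x\<^sup>2"])
      show "continuous_on {K..K + real n} (\<lambda>x. 1 / x\<^sup>2)" using K by (auto intro!: continuous_intros)
      show "set_borel_measurable borel {- (1 / K)..- (1 / (K + real n))} (\<lambda>x. \<phi> (- x))"
        by (simp add: set_borel_measurable_def)
    qed (use d in auto)
    also have "\<dots> = (\<integral>\<^sup>+l\<in>{K..K + real n}. ennreal (\<phi> (1 / l) / l\<^sup>2) \<partial>lborel)"
      by (intro nn_integral_cong) (auto split: split_indicator)
    also have "(\<integral>\<^sup>+x. ennreal (\<phi> (- x) * indicator {- (1 / K)..- (1 / (K + real n))} x) \<partial>lborel)
       = (\<integral>\<^sup>+y. ennreal (\<phi> y * indicator {- (1 / K)..- (1 / (K + real n))} (- y)) \<partial>lborel)"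
      by (subst nn_integral_real_affine[where c="-1" and t=0]) auto
    also have "\<dots> = (\<integral>\<^sup>+y\<in>{1/(K + real n)..1/K}. ennreal (\<phi> y) \<partial>lborel)"
      by (intro nn_integral_cong) (auto split: split_indicator)
    finally show ?thesis by simp
  qed
  have "(\<integral>\<^sup>+l\<in>{K<..}. ennreal (\<phi> (1 / l) / l\<^sup>2) \<partial>lborel) = (\<integral>\<^sup>+l\<in>{K..}. ennreal (\<phi> (1 / l) / l\<^sup>2) \<partial>lborel)"
    using AE_lborel_singleton[of K] by (intro nn_integral_cong_AE) (auto elim!: eventually_mono split: split_indicator)
  also have "\<dots> = (\<integral>\<^sup>+l. (SUP n. ennreal (\<phi> (1 / l) / l\<^sup>2) * indicator {K..K + real n} l) \<partial>lborel)"
  proof (intro nn_integral_cong)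
    fix l :: real
    obtain m :: nat where m: "l - K \<le> real m" using real_arch_simple by blast
    show "ennreal (\<phi> (1 / l) / l\<^sup>2) * indicator {K..} l = (SUP n. ennreal (\<phi> (1 / l) / l\<^sup>2) * indicator {K..K + real n} l)"
    proof (rule antisym)
      have "ennreal (\<phi> (1 / l) / l\<^sup>2) * indicator {K..} l \<le> ennreal (\<phi> (1 / l) / l\<^sup>2) * indicator {K..K + real m} l"
        using m by (auto split: split_indicator)
      then show "ennreal (\<phi> (1 / l) / l\<^sup>2) * indicator {K..} l \<le> (SUP n. ennreal (\<phi> (1 / l) / l\<^sup>2) * indicator {K..K + real n} l)"
        by (rule SUP_upper2[OF UNIV_I])
    qed (auto intro!: SUP_least split: split_indicator)
  qed
  also have "\<dots> = (SUP n. (\<integral>\<^sup>+l\<in>{K..K + real n}. ennreal (\<phi> (1 / l) / l\<^sup>2) \<partial>lborel))"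
    by (rule nn_integral_monotone_convergence_SUP) (auto simp: incseq_def le_fun_def split: split_indicator)
  also have "\<dots> = (SUP n. (\<integral>\<^sup>+y\<in>{1/(K + real n)..1/K}. ennreal (\<phi> y) \<partial>lborel))" by (simp only: fin)
  also have "\<dots> = (\<integral>\<^sup>+y. (SUP n. ennreal (\<phi> y) * indicator {1/(K + real n)..1/K} y) \<partial>lborel)"
  proof (rule nn_integral_monotone_convergence_SUP[symmetric])
    have "1 / (K + real n) \<le> 1 / (K + real m)" if "m \<le> n" for m n :: nat
      using K that by (intro divide_left_mono) (auto intro!: mult_pos_pos add_pos_nonneg)
    then show "incseq (\<lambda>n y. ennreal (\<phi> y) * indicator {1/(K + real n)..1/K} y)"
      by (fastforce simp: incseq_def le_fun_def split: split_indicator)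
  qed auto
  also have "\<dots> = (\<integral>\<^sup>+y\<in>{0<..1/K}. ennreal (\<phi> y) \<partial>lborel)"
  proof (intro nn_integral_cong antisym)
    fix y :: real
    show "(SUP n. ennreal (\<phi> y) * indicator {1/(K + real n)..1/K} y) \<le> ennreal (\<phi> y) * indicator {0<..1/K} y"
    proof (intro SUP_least)
      fix n :: nat
      have "0 < 1 / (K + real n)" using K by (intro divide_pos_pos) auto
      then have "0 < y" if "1 / (K + real n) \<le> y" using that by (rule less_le_trans)
      then show "ennreal (\<phi> y) * indicator {1/(K + real n)..1/K} y \<le> ennreal (\<phi> y) * indicator {0<..1/K} y"
        by (cases "0 < y") (auto split: split_indicator)
    qed
    show "ennreal (\<phi> y) * indicator {0<..1/K} y \<le> (SUP n. ennreal (\<phi> y) * indicator {1/(K + real n)..1/K} y)"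
    proof (cases "0 < y \<and> y \<le> 1 / K")
      case True
      obtain m :: nat where m: "1 / y - K \<le> real m" using real_arch_simple by blast
      have "1 / y \<le> K + real m" using m by simp
      then have "1 / (K + real m) \<le> 1 / (1 / y)" using True by (intro divide_left_mono mult_pos_pos) (auto intro: add_pos_nonneg K)
      then have "ennreal (\<phi> y) * indicator {0<..1/K} y \<le> ennreal (\<phi> y) * indicator {1/(K + real m)..1/K} y"
        using True by auto
      then show ?thesis by (rule SUP_upper2[OF UNIV_I])
    qed auto
  qed
  also have "\<dots> = (\<integral>\<^sup>+y\<in>{0<..<1/K}. ennreal (\<phi> y) \<partial>lborel)"
    using AE_lborel_singleton[of "1/K"] by (intro nn_integral_cong_AE) (auto elim!: eventually_mono split: split_indicator)
  finally show ?thesis .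
qed

section \<open>Right-continuous paths, killing and dyadic sampling\<close>

definition rc_path :: "(real \<Rightarrow> real) \<Rightarrow> bool" where
  "rc_path z \<longleftrightarrow> (\<forall>t\<ge>0. (z \<longlongrightarrow> z t) (at_right t))"

definition sp_path :: "(real \<Rightarrow> real) \<Rightarrow> bool" where
  "sp_path z \<longleftrightarrow> rc_path z \<and> (\<forall>t>0. \<exists>l\<le>z t. (z \<longlongrightarrow> l) (at_left t))"

text \<open>The process is killed when it becomes negative rather than when it hits \<open>0\<close>: this event depends
  only on the values of the path along a dense set of times. The two notions agree almost surely
  (lemma \<open>exit_time_AE\<close>), since they lie between those for the starting points \<open>x - \<epsilon>\<close> and \<open>x\<close>.\<close>

definition alive :: "(real \<Rightarrow> real) \<Rightarrow> real \<Rightarrow> bool" where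
  "alive z t \<longleftrightarrow> (\<forall>s. 0 \<le> s \<and> s < t \<longrightarrow> 0 \<le> z s)"

definition dies :: "(real \<Rightarrow> real) \<Rightarrow> bool" where
  "dies z \<longleftrightarrow> (\<exists>n::nat. \<not> alive z (real n))"

lemma sp_path_imp_rc: "sp_path z \<Longrightarrow> rc_path z" by (simp add: sp_path_def)

lemma rc_path_add: "rc_path z \<Longrightarrow> rc_path (\<lambda>t. y + z t)"
  by (auto simp: rc_path_def intro!: tendsto_intros)

lemma sp_path_add: assumes "sp_path z" shows "sp_path (\<lambda>t. y + z t)"
  unfolding sp_path_def
proof (intro conjI allI impI)
  show "rc_path (\<lambda>t. y + z t)" using assms by (intro rc_path_add sp_path_imp_rc)
  fix t :: real assume "0 < t"
  then obtain l where "l \<le> z t" "(z \<longlongrightarrow> l) (at_left t)" using assms by (auto simp: sp_path_def)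
  then show "\<exists>l\<le>y + z t. ((\<lambda>t. y + z t) \<longlongrightarrow> l) (at_left t)"
    by (intro exI[of _ "y + l"]) (auto intro!: tendsto_intros)
qed

lemma rc_path_shift: assumes "rc_path z" "0 \<le> a" shows "rc_path (\<lambda>s. z (a + s))"
  unfolding rc_path_def
proof (intro allI impI)
  fix t :: real assume "0 \<le> t"
  then have "(z \<longlongrightarrow> z (a + t)) (at_right (a + t))" using assms by (auto simp: rc_path_def)
  moreover have "filterlim (\<lambda>s. a + s) (at_right (a + t)) (at_right t)"
    unfolding filterlim_at
  proof
    have "\<forall>\<^sub>F s in at_right t. t < s" by (rule eventually_at_right_less)
    then show "\<forall>\<^sub>F s in at_right t. a + s \<in> {a + t<..} \<and> a + s \<noteq> a + t"
      by eventually_elim simp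
    show "((\<lambda>s. a + s) \<longlongrightarrow> a + t) (at_right t)" by (intro tendsto_intros)
  qed
  ultimately show "((\<lambda>s. z (a + s)) \<longlongrightarrow> z (a + t)) (at_right t)"
    by (rule filterlim_compose)
qed

lemma rc_path_seq:
  assumes "rc_path z" "0 \<le> t" "u \<longlonglongrightarrow> t" "\<And>n. t < u n"
  shows "(\<lambda>n. z (u n)) \<longlonglongrightarrow> z t"
proof -
  have "filterlim u (at_right t) sequentially"
    unfolding filterlim_at using assms by (auto intro!: always_eventually)
  then show ?thesis using assms by (auto simp: rc_path_def intro: filterlim_compose)
qed

text \<open>The left limit at t inherits the bound, and an upward jump can only improve it. All
  consequences of the path condition on jumps are drawn through this lemma.\<close>

lemma sp_path_ge_at:
  assumes "sp_path z" "0 < t" "\<And>s. 0 \<le> s \<Longrightarrow> s < t \<Longrightarrow> c \<le> z s"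
  shows "c \<le> z t"
proof -
  obtain l where l: "l \<le> z t" "(z \<longlongrightarrow> l) (at_left t)" using assms by (auto simp: sp_path_def)
  have "eventually (\<lambda>s. c \<le> z s) (at_left t)"
    using eventually_at_left_real[OF \<open>0 < t\<close>] by eventually_elim (use assms in auto)
  then have "c \<le> l" using l(2) by (intro tendsto_lowerbound) auto
  with l show ?thesis by simp
qed

lemma alive_mono: "alive z t \<Longrightarrow> s \<le> t \<Longrightarrow> alive z s" by (auto simp: alive_def)

lemma alive_nonneg: "sp_path z \<Longrightarrow> alive z t \<Longrightarrow> 0 < t \<Longrightarrow> 0 \<le> z t"
  by (rule sp_path_ge_at) (auto simp: alive_def)

lemma alive_add: "0 \<le> s \<Longrightarrow> 0 \<le> t \<Longrightarrow> alive z (t + s) \<longleftrightarrow> alive z t \<and> alive (\<lambda>r. z (t + r)) s"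
proof (intro iffI conjI)
  assume a: "0 \<le> s" "0 \<le> t" "alive z t \<and> alive (\<lambda>r. z (t + r)) s"
  show "alive z (t + s)"
    unfolding alive_def
  proof (intro allI impI)
    fix r assume r: "0 \<le> r \<and> r < t + s"
    show "0 \<le> z r"
    proof (cases "r < t")
      case False
      then have "0 \<le> r - t" "r - t < s" using r by auto
      then have "0 \<le> z (t + (r - t))" using a unfolding alive_def by blast
      then show ?thesis by simp
    qed (use a r in \<open>auto simp: alive_def\<close>)
  qed
qed (auto simp: alive_def)

lemma dies_iff: "dies z \<longleftrightarrow> (\<exists>s\<ge>0. z s < 0)"
proof
  assume "\<exists>s\<ge>0. z s < 0"
  then obtain s where s: "s \<ge> 0" "z s < 0" by auto
  obtain n :: nat where "s < real n" using reals_Archimedean2 by blast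
  then have "\<not> alive z (real n)" using s by (auto simp: alive_def not_le)
  then show "dies z" by (auto simp: dies_def)
qed (auto simp: dies_def alive_def not_le)

lemma dies_shift: "0 \<le> t \<Longrightarrow> alive z t \<Longrightarrow> dies (\<lambda>s. z (t + s)) \<longleftrightarrow> dies z"
proof
  assume a: "0 \<le> t" "alive z t" "dies z"
  then obtain s where s: "s \<ge> 0" "z s < 0" by (auto simp: dies_iff)
  then have "t \<le> s" using a(2) unfolding alive_def by (meson not_le)
  then show "dies (\<lambda>s. z (t + s))" using s unfolding dies_iff by (intro exI[of _ "s - t"]) auto
qed (auto simp: dies_iff intro: add_nonneg_nonneg)

text \<open>Downward passage through 0: at the infimum r of the times with value at most 0, right
  continuity gives z r \<le> 0 and the absence of negative jumps gives z r \<ge> 0. The positive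
  starting value makes r positive, which matters because \<open>exit_time\<close> ignores time
  0.\<close>

lemma less_exit_time_imp_alive:
  assumes z: "sp_path z" and z0: "0 < z 0" and t: "ereal t < exit_time z"
  shows "alive z t"
  unfolding alive_def
proof (intro allI impI, rule ccontr)
  fix s assume s: "0 \<le> s \<and> s < t" and neg: "\<not> 0 \<le> z s"
  let ?N = "{r. 0 \<le> r \<and> r \<le> s \<and> z r \<le> 0}"
  define r where "r = Inf ?N"
  have sN: "s \<in> ?N" using s neg by auto
  have bdd: "bdd_below ?N" by (auto intro: bdd_belowI[of _ 0])
  have r0: "0 \<le> r" and rs: "r \<le> s"
    unfolding r_def using sN bdd by (auto intro!: cInf_greatest cInf_lower)
  have before: "0 < z q" if "0 \<le> q" "q < r" for q
  proof (rule ccontr)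
    assume "\<not> 0 < z q"
    then have "q \<in> ?N" using that rs by auto
    then show False using bdd that(2) cInf_lower[of q ?N] by (auto simp: r_def)
  qed
  have le: "z r \<le> 0"
  proof (rule ccontr)
    assume "\<not> z r \<le> 0"
    then have "eventually (\<lambda>q. 0 < z q) (at_right r)"
      using z r0 by (auto simp: sp_path_def rc_path_def intro: order_tendstoD)
    then obtain b where b: "b > r" "\<And>q. r < q \<Longrightarrow> q < b \<Longrightarrow> 0 < z q"
      by (auto simp: eventually_at_right_field)
    have "b \<le> r" unfolding r_def
    proof (rule cInf_greatest)
      fix q assume q: "q \<in> ?N"
      then have "r \<le> q" using bdd by (auto simp: r_def intro: cInf_lower)
      moreover have "q \<noteq> r" using q \<open>\<not> z r \<le> 0\<close> by auto
      ultimately have "r < q" by simp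
      then show "b \<le> q" using b(2)[of q] q by (cases "q < b") auto
    qed (use sN in auto)
    then show False using b by simp
  qed
  have r_pos: "0 < r" 
  proof (rule ccontr)
    assume "\<not> 0 < r"
    then have "r = 0" using r0 by linarith
    then show False using le z0 by simp
  qed
  then have "0 \<le> z r" by (rule sp_path_ge_at[OF z _ less_imp_le[OF before]])
  then have "z r = 0" using le by simp
  then have "exit_time z \<le> ereal r" using r_pos unfolding exit_time_def by (intro Inf_lower) auto
  also have "\<dots> \<le> ereal t" using rs s by simp
  finally show False using t by simp
qed

text \<open>The margin e rules out touching 0, which \<open>alive\<close> permits. With it the value
  at t is positive too, and right continuity pushes the exit time strictly beyond t.\<close>

lemma bounded_below_imp_less_exit_time:
  assumes z: "sp_path z" and z0: "0 < z 0" and t: "0 \<le> t" and e: "0 < e"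
    and ge: "\<And>s. 0 \<le> s \<Longrightarrow> s < t \<Longrightarrow> e \<le> z s"
  shows "ereal t < exit_time z"
proof -
  have zt: "0 < z t"
  proof (cases "t = 0")
    case False
    then have "e \<le> z t" using t by (intro sp_path_ge_at[OF z _ ge]) auto
    then show ?thesis using e by simp
  qed (use z0 in simp)
  then have "eventually (\<lambda>q. 0 < z q) (at_right t)"
    using z t by (auto simp: sp_path_def rc_path_def intro: order_tendstoD)
  then obtain b where b: "b > t" "\<And>q. t < q \<Longrightarrow> q < b \<Longrightarrow> 0 < z q"
    by (auto simp: eventually_at_right_field)
  have pos: "0 < z q" if "0 \<le> q" "q < b" for q
  proof (cases q t rule: linorder_cases)
    case less
    then show ?thesis using ge[OF that(1)] e by linarith
  next
    case equal
    then show ?thesis using zt by simp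
  next
    case greater
    then show ?thesis using b(2) that(2) by blast
  qed
  have "ereal b \<le> exit_time z"
    unfolding exit_time_def
  proof (rule Inf_greatest, safe)
    fix q assume "0 < q" "z q = 0"
    then show "ereal b \<le> ereal q" using pos[of q] by (cases "q < b") auto
  qed
  moreover have "ereal t < ereal b" using b by simp
  ultimately show ?thesis by (rule less_le_trans[rotated])
qed

definition grid_time :: "real \<Rightarrow> nat \<Rightarrow> nat \<Rightarrow> real" where "grid_time h n j = real j * (h / 2 ^ n)"

text \<open>Rounds strictly upwards, also when s lies on the grid: the approximating times must
  approach s from the right, the side on which the paths are continuous.\<close>

definition next_index :: "real \<Rightarrow> nat \<Rightarrow> real \<Rightarrow> nat" where "next_index h n s = Suc (nat \<lfloor>s / (h / 2 ^ n)\<rfloor>)"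

lemma grid_time_nonneg: "0 < h \<Longrightarrow> 0 \<le> grid_time h n j" by (simp add: grid_time_def)

lemma grid_time_next: assumes "0 < h" "0 \<le> s" shows "s < grid_time h n (next_index h n s)" "grid_time h n (next_index h n s) \<le> s + h / 2 ^ n"
proof -
  define d where "d = h / 2 ^ n"
  have d: "d > 0" using assms by (simp add: d_def)
  have f: "real_of_int \<lfloor>s / d\<rfloor> \<ge> 0" using assms d by simp
  have e: "grid_time h n (next_index h n s) = (real_of_int \<lfloor>s / d\<rfloor> + 1) * d"
    using f by (simp add: grid_time_def next_index_def d_def[symmetric])
  have "s / d < real_of_int \<lfloor>s / d\<rfloor> + 1" by linarith
  then show "s < grid_time h n (next_index h n s)" unfolding e using d by (simp only: pos_divide_less_eq)
  have "real_of_int \<lfloor>s / d\<rfloor> \<le> s / d" by linarith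
  then have "real_of_int \<lfloor>s / d\<rfloor> * d \<le> s" using d by (simp only: pos_le_divide_eq)
  then show "grid_time h n (next_index h n s) \<le> s + h / 2 ^ n" unfolding e d_def[symmetric] by (simp add: algebra_simps)
qed

lemma grid_time_next_tendsto: assumes "0 < h" "0 \<le> s" shows "(\<lambda>n. grid_time h n (next_index h n s)) \<longlonglongrightarrow> s"
proof (rule tendsto_sandwich)
  show "\<forall>\<^sub>F n in sequentially. s \<le> grid_time h n (next_index h n s)"
    by (intro always_eventually allI less_imp_le grid_time_next assms)
  show "\<forall>\<^sub>F n in sequentially. grid_time h n (next_index h n s) \<le> s + h / 2 ^ n"
    by (intro always_eventually allI grid_time_next assms)
  show "(\<lambda>n::nat. s) \<longlonglongrightarrow> s" by simp
  have "(\<lambda>n. s + h * (1 / 2) ^ n) \<longlonglongrightarrow> s + h * 0"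
    by (intro tendsto_intros LIMSEQ_realpow_zero) auto
  then show "(\<lambda>n. s + h / 2 ^ n) \<longlonglongrightarrow> s" by (simp add: power_divide)
qed

lemma rc_path_next_tendsto:
  "rc_path z \<Longrightarrow> 0 < h \<Longrightarrow> 0 \<le> s \<Longrightarrow> (\<lambda>n. z (grid_time h n (next_index h n s))) \<longlonglongrightarrow> z s"
  by (rule rc_path_seq[OF _ _ grid_time_next_tendsto grid_time_next(1)])

text \<open>The strict inequality s < t in \<open>alive\<close> leaves room for grid times between s
  and t, and right continuity recovers the sign at s from them. Survival is thus a countable
  condition on the path.\<close>

lemma alive_grid:
  assumes z: "rc_path z" and h: "0 < h"
  shows "alive z t \<longleftrightarrow> (\<forall>n j. grid_time h n j < t \<longrightarrow> 0 \<le> z (grid_time h n j))"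
proof
  assume a: "\<forall>n j. grid_time h n j < t \<longrightarrow> 0 \<le> z (grid_time h n j)"
  show "alive z t" unfolding alive_def
  proof (intro allI impI)
    fix s assume s: "0 \<le> s \<and> s < t"
    have "eventually (\<lambda>n. grid_time h n (next_index h n s) < t) sequentially"
      using grid_time_next_tendsto[OF h] s by (auto dest: order_tendstoD)
    then have "eventually (\<lambda>n. 0 \<le> z (grid_time h n (next_index h n s))) sequentially"
      by eventually_elim (use a in auto)
    then show "0 \<le> z s" using rc_path_next_tendsto[OF z h] s by (intro tendsto_lowerbound) auto
  qed
qed (use h in \<open>auto simp: alive_def grid_time_nonneg\<close>)

abbreviation vecs :: "(nat \<times> nat \<Rightarrow> real) measure" where
  "vecs \<equiv> PiM UNIV (\<lambda>_. borel)"

definition grid_vec :: "real \<Rightarrow> (real \<Rightarrow> real) \<Rightarrow> nat \<times> nat \<Rightarrow> real" where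
  "grid_vec h z = (\<lambda>(n, j). z (grid_time h n j))"

text \<open>Left inverse of \<open>grid_vec\<close> on right-continuous paths, at nonnegative times.
  As \<open>lim\<close> is total, the map is defined and measurable on all of
  \<open>vecs\<close>.\<close>

definition rec_path :: "real \<Rightarrow> (nat \<times> nat \<Rightarrow> real) \<Rightarrow> real \<Rightarrow> real" where
  "rec_path h v s = lim (\<lambda>n. v (n, next_index h n s))"

lemma measurable_next_index [measurable]: "next_index h n \<in> measurable borel (count_space UNIV)"
  unfolding next_index_def[abs_def] by measurable

lemma measurable_rec_path [measurable]:
  "(\<lambda>(v, s). rec_path h v s) \<in> borel_measurable (vecs \<Otimes>\<^sub>M borel)"
  unfolding rec_path_def split_beta'
proof (rule borel_measurable_lim_metric)
  fix n
  show "(\<lambda>w. fst w (n, next_index h n (snd w))) \<in> borel_measurable (vecs \<Otimes>\<^sub>M borel)"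
    by (rule measurable_compose_countable[where g="\<lambda>w. next_index h n (snd w)" and f="\<lambda>i w. fst w (n, i)"]) measurable
qed

lemma rec_path_grid_vec: "rc_path z \<Longrightarrow> 0 < h \<Longrightarrow> 0 \<le> s \<Longrightarrow> rec_path h (grid_vec h z) s = z s"
  unfolding rec_path_def grid_vec_def using rc_path_next_tendsto[of z h s] by (simp add: limI)

text \<open>Functionals of right-continuous paths which are measurable functions of the values along the
  dyadic multiples of \<open>h\<close>. The grid depends on \<open>h\<close> so that the Markov property at an arbitrary time
  \<open>t\<close> can be proved with \<open>t\<close> on the grid.\<close>

definition path_measurable :: "real \<Rightarrow> ((real \<Rightarrow> real) \<Rightarrow> ennreal) \<Rightarrow> bool" where
  "path_measurable h \<Phi> \<longleftrightarrow>
    (\<exists>\<Phi>'\<in>borel_measurable vecs. \<forall>z. rc_path z \<longrightarrow> \<Phi> z = \<Phi>' (grid_vec h z))"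

text \<open>The integral functional up to the killing time, with values in \<open>ennreal\<close> so
  that no integrability has to be carried along.\<close>

definition occ :: "(real \<Rightarrow> ennreal) \<Rightarrow> (real \<Rightarrow> real) \<Rightarrow> ennreal" where
  "occ k z = (\<integral>\<^sup>+t. (if 0 \<le> t \<and> alive z t then k (z t) else 0) \<partial>lborel)"

lemma path_measurable_dies: assumes "0 < h" shows "path_measurable h (\<lambda>z. of_bool (dies z))"
  unfolding path_measurable_def
proof (intro bexI allI impI)
  let ?P = "\<lambda>v. of_bool (\<exists>N::nat. \<exists>n j. grid_time h n j < real N \<and> v (n, j) < 0) :: ennreal"
  show "?P \<in> borel_measurable vecs" by measurable
  fix z :: "real \<Rightarrow> real" assume z: "rc_path z"
  show "of_bool (dies z) = ?P (grid_vec h z)"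
    unfolding dies_def by (simp add: alive_grid[OF z assms] grid_vec_def not_le)
qed

lemma path_measurable_occ:
  assumes h: "0 < h" and [measurable]: "k \<in> borel_measurable borel"
  shows "path_measurable h (occ k)"
  unfolding path_measurable_def
proof (intro bexI allI impI)
  let ?P = "\<lambda>v. (\<integral>\<^sup>+t. (if 0 \<le> t \<and> (\<forall>n j. grid_time h n j < t \<longrightarrow> 0 \<le> v (n, j)) then k (rec_path h v t) else 0) \<partial>lborel)"
  show "?P \<in> borel_measurable vecs" by measurable
  fix z :: "real \<Rightarrow> real" assume z: "rc_path z"
  show "occ k z = ?P (grid_vec h z)"
    unfolding occ_def
    by (intro nn_integral_cong)
       (auto simp: alive_grid[OF z h] rec_path_grid_vec[OF z h] grid_vec_def[of h z, THEN fun_cong])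
qed

lemma path_measurable_comp:
  assumes "path_measurable h \<Phi>" "F \<in> borel_measurable borel"
  shows "path_measurable h (\<lambda>z. F (\<Phi> z))"
proof -
  from assms(1) obtain \<Phi>' where [measurable]: "\<Phi>' \<in> borel_measurable vecs" and e: "\<And>z. rc_path z \<Longrightarrow> \<Phi> z = \<Phi>' (grid_vec h z)"
    by (auto simp: path_measurable_def)
  note assms(2)[measurable]
  show ?thesis unfolding path_measurable_def
    by (intro bexI[of _ "\<lambda>v. F (\<Phi>' v)"]) (auto simp: e)
qed

lemma path_measurable_times:
  assumes "path_measurable h \<Phi>" "path_measurable h \<Psi>"
  shows "path_measurable h (\<lambda>z. \<Phi> z * \<Psi> z)"
proof -
  from assms(1) obtain \<Phi>' where [measurable]: "\<Phi>' \<in> borel_measurable vecs" and e: "\<And>z. rc_path z \<Longrightarrow> \<Phi> z = \<Phi>' (grid_vec h z)"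
    by (auto simp: path_measurable_def)
  from assms(2) obtain \<Psi>' where [measurable]: "\<Psi>' \<in> borel_measurable vecs" and e': "\<And>z. rc_path z \<Longrightarrow> \<Psi> z = \<Psi>' (grid_vec h z)"
    by (auto simp: path_measurable_def)
  show ?thesis unfolding path_measurable_def
    by (intro bexI[of _ "\<lambda>v. \<Phi>' v * \<Psi>' v"]) (auto simp: e e')
qed

text \<open>A regular version of the process started at 0, with its path properties at every point
  of the space and value 0 before time 0. All starting points share this space, the process from y
  being y + X. About the law only three things enter: increments along equidistant grids,
  exponential moments, and the sign of \<open>\<psi>\<close> on either side of
  \<open>p\<close>.\<close>

locale spectrally_positive = prob_space M
  for M :: "'a measure" +
  fixes X :: "real \<Rightarrow> 'a \<Rightarrow> real" and \<psi> :: "real \<Rightarrow> real" and p :: real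
  assumes meas_X [measurable]: "\<And>t. X t \<in> borel_measurable M"
    and X_nonpos: "\<And>t \<omega>. t \<le> 0 \<Longrightarrow> X t \<omega> = 0"
    and X_path: "\<And>\<omega>. sp_path (\<lambda>t. X t \<omega>)"
    and indep: "\<And>h. 0 < h \<Longrightarrow>
      indep_vars (\<lambda>_. borel) (\<lambda>i \<omega>. X (real (Suc i) * h) \<omega> - X (real i * h) \<omega>) (UNIV :: nat set)"
    and stationary: "\<And>h i. 0 < h \<Longrightarrow>
      distr M borel (\<lambda>\<omega>. X (real (Suc i) * h) \<omega> - X (real i * h) \<omega>) = distr M borel (X h)"
    and laplace: "\<And>l t. 0 \<le> l \<Longrightarrow> 0 \<le> t \<Longrightarrow>
      has_bochner_integral M (\<lambda>\<omega>. exp (- l * X t \<omega>)) (exp (\<psi> l * t))"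
    and p_nonneg: "0 \<le> p"
    and psi_pos: "\<And>l. p < l \<Longrightarrow> 0 < \<psi> l"
    and psi_nonpos: "\<And>l. 0 < l \<Longrightarrow> l < p \<Longrightarrow> \<psi> l \<le> 0"
begin

lemma X_0 [simp]: "X 0 \<omega> = 0" by (rule X_nonpos) simp

lemma path: "sp_path (\<lambda>t. y + X t \<omega>)" by (rule sp_path_add[OF X_path])

lemma rcpath: "rc_path (\<lambda>t. y + X t \<omega>)" by (rule sp_path_imp_rc[OF path])

text \<open>Writes X as a limit of step processes in t, which yields joint measurability. For
  negative t, \<open>nat\<close> truncates in \<open>next_index\<close>, so the approximations are
  those of time 0, where X vanishes as well.\<close>

lemma X_eq_lim: "X t \<omega> = lim (\<lambda>n. X (grid_time 1 n (next_index 1 n t)) \<omega>)"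
proof (cases "0 \<le> t")
  case True
  then show ?thesis using rc_path_next_tendsto[OF sp_path_imp_rc[OF X_path], of 1 t \<omega>] by (simp add: limI)
next
  case False
  have "t * 2 ^ n < 1" for n
    using False mult_nonpos_nonneg[of t "2 ^ n"] by simp
  then have "next_index 1 n t = next_index 1 n 0" for n by (simp add: next_index_def)
  then show ?thesis using rc_path_next_tendsto[OF sp_path_imp_rc[OF X_path], of 1 0 \<omega>] False
    by (simp add: limI X_nonpos)
qed

lemma joint_measurable [measurable]: "(\<lambda>(t, \<omega>). X t \<omega>) \<in> borel_measurable (borel \<Otimes>\<^sub>M M)"
proof -
  have "(\<lambda>w. lim (\<lambda>n. X (grid_time 1 n (next_index 1 n (fst w))) (snd w))) \<in> borel_measurable (borel \<Otimes>\<^sub>M M)"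
  proof (rule borel_measurable_lim_metric)
    fix n
    show "(\<lambda>w. X (grid_time 1 n (next_index 1 n (fst w))) (snd w)) \<in> borel_measurable (borel \<Otimes>\<^sub>M M)"
      by (rule measurable_compose_countable[where g="\<lambda>w. next_index 1 n (fst w)" and f="\<lambda>i w. X (grid_time 1 n i) (snd w)"]) measurable
  qed
  then show ?thesis unfolding split_beta' X_eq_lim[symmetric] .
qed

lemma joint_measurable' [measurable (raw)]:
  "f \<in> borel_measurable N \<Longrightarrow> g \<in> measurable N M \<Longrightarrow> (\<lambda>w. X (f w) (g w)) \<in> borel_measurable N"
  using measurable_compose[OF measurable_Pair joint_measurable] by simp

lemma alive_X_iff: "alive (\<lambda>s. y + X s \<omega>) t \<longleftrightarrow> (\<forall>n j. grid_time 1 n j < t \<longrightarrow> 0 \<le> y + X (grid_time 1 n j) \<omega>)"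
  by (rule alive_grid[OF rcpath]) simp

lemma measurable_alive [measurable (raw)]:
  assumes [measurable]: "y \<in> borel_measurable N" "f \<in> borel_measurable N" "g \<in> measurable N M"
  shows "Measurable.pred N (\<lambda>w. alive (\<lambda>s. y w + X s (g w)) (f w))"
  unfolding alive_X_iff by measurable

lemma measurable_dies [measurable (raw)]:
  assumes [measurable]: "y \<in> borel_measurable N" "g \<in> measurable N M"
  shows "Measurable.pred N (\<lambda>w. dies (\<lambda>s. y w + X s (g w)))"
  unfolding dies_def by measurable

lemma measurable_occ [measurable (raw)]:
  assumes [measurable]: "k \<in> borel_measurable borel" "y \<in> borel_measurable N" "g \<in> measurable N M"
  shows "(\<lambda>w. occ k (\<lambda>s. y w + X s (g w))) \<in> borel_measurable N"
  unfolding occ_def by measurable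

abbreviation seqs :: "(nat \<Rightarrow> real) measure" where "seqs \<equiv> PiM UNIV (\<lambda>_. borel)"

section \<open>The Markov property at fixed times\<close>

text \<open>Increments along the grid are independent and identically distributed, so their sequence
  has a product law. That law is unchanged when the coordinates from k on are replaced by an
  independent copy (\<open>comb_seq\<close>), and partial sums carry this over to the path.\<close>

lemma concat_law_grid:
  assumes h: "0 < h"
  shows "distr M seqs (\<lambda>\<omega> j. X (real j * h) \<omega>) =
    distr (M \<Otimes>\<^sub>M M) seqs (\<lambda>(\<omega>, \<omega>') j. if j \<le> k then X (real j * h) \<omega>
      else X (real k * h) \<omega> + X (real (j - k) * h) \<omega>')"
proof -
  interpret MM: pair_prob_space M M ..
  define \<xi> where "\<xi> \<omega> i = X (real (Suc i) * h) \<omega> - X (real i * h) \<omega>" for \<omega> and i :: nat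
  define \<mu> where "\<mu> = distr M borel (X h)"
  have [measurable_cong]: "sets \<mu> = sets borel" by (simp add: \<mu>_def)
  have pr: "prob_space \<mu>" unfolding \<mu>_def by (rule prob_space_distr) measurable
  interpret seq: sequence_space \<mu>
    by (simp add: sequence_space_def product_prob_space_def product_prob_space_axioms_def
        product_sigma_finite_def pr prob_space_imp_sigma_finite)
  have [measurable]: "\<xi> \<in> measurable M (PiM UNIV (\<lambda>_::nat. \<mu>))"
    unfolding \<xi>_def[abs_def] by (intro measurable_PiM_single') (auto simp: \<mu>_def)
  have law: "distr M (PiM UNIV (\<lambda>_::nat. \<mu>)) \<xi> = PiM UNIV (\<lambda>_. \<mu>)"
  proof -
    have "distr M (PiM UNIV (\<lambda>_::nat. borel)) (\<lambda>x. \<lambda>i\<in>UNIV. \<xi> x i) = PiM UNIV (\<lambda>i. distr M borel (\<lambda>x. \<xi> x i))"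
      using indep[OF h] by (subst (asm) indep_vars_iff_distr_eq_PiM) (auto simp: \<xi>_def)
    moreover have "distr M borel (\<lambda>x. \<xi> x i) = \<mu>" for i
      unfolding \<xi>_def \<mu>_def by (rule stationary[OF h])
    moreover have "distr M (PiM UNIV (\<lambda>_::nat. \<mu>)) \<xi> = distr M (PiM UNIV (\<lambda>_::nat. borel)) \<xi>"
      by (intro distr_cong sets_PiM_cong) (auto simp: \<mu>_def)
    ultimately show ?thesis by (simp add: restrict_UNIV)
  qed
  define \<sigma> where "\<sigma> v j = (\<Sum>i<j. v i)" for v :: "nat \<Rightarrow> real" and j :: nat
  have [measurable]: "\<sigma> \<in> measurable (PiM UNIV (\<lambda>_::nat. \<mu>)) seqs"
    unfolding \<sigma>_def[abs_def] by (intro measurable_PiM_single') auto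
  have tele: "\<sigma> (\<xi> \<omega>) j = X (real j * h) \<omega>" for \<omega> j
    unfolding \<sigma>_def \<xi>_def by (subst sum_lessThan_telescope) simp
  have comb: "\<sigma> (comb_seq k v w) j = (if j \<le> k then \<sigma> v j else \<sigma> v k + \<sigma> w (j - k))" for v w j
  proof (cases "j \<le> k")
    case True then show ?thesis by (auto simp: \<sigma>_def comb_seq_def intro!: sum.cong)
  next
    case False
    then have "{..<j} = {..<k} \<union> {k..<j}" by auto
    then have "(\<Sum>i<j. comb_seq k v w i) = (\<Sum>i<k. comb_seq k v w i) + (\<Sum>i\<in>{k..<j}. comb_seq k v w i)"
      by (simp add: sum.union_disjoint ivl_disj_int)
    also have "(\<Sum>i<k. comb_seq k v w i) = \<sigma> v k"
      unfolding \<sigma>_def by (intro sum.cong) (auto simp: comb_seq_def)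
    also have "(\<Sum>i\<in>{k..<j}. comb_seq k v w i) = (\<Sum>i<j - k. comb_seq k v w (i + k))"
      using False by (intro sum.reindex_bij_witness[of _ "\<lambda>i. i + k" "\<lambda>i. i - k"]) auto
    also have "\<dots> = \<sigma> w (j - k)" unfolding \<sigma>_def by (simp add: comb_seq_add)
    finally show ?thesis using False by (simp add: \<sigma>_def)
  qed
  let ?Q = "PiM UNIV (\<lambda>_::nat. \<mu>)"
  have sfQ: "sigma_finite_measure (distr M ?Q \<xi>)"
    unfolding law by (rule prob_space_imp_sigma_finite) (rule seq.P.prob_space_axioms)
  have "distr M seqs (\<lambda>\<omega> j. X (real j * h) \<omega>) = distr M seqs (\<lambda>\<omega>. \<sigma> (\<xi> \<omega>))"
    by (rule arg_cong[where f="distr M seqs"]) (intro ext, simp only: tele)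
  also have "\<dots> = distr (distr M ?Q \<xi>) seqs \<sigma>" by (subst distr_distr) (auto simp: comp_def)
  also have "\<dots> = distr (distr (?Q \<Otimes>\<^sub>M ?Q) ?Q (\<lambda>(v, w). comb_seq k v w)) seqs \<sigma>"
    unfolding law seq.PiM_comb_seq ..
  also have "\<dots> = distr (?Q \<Otimes>\<^sub>M ?Q) seqs (\<lambda>(v, w). \<sigma> (comb_seq k v w))"
    by (subst distr_distr) (auto simp: comp_def split_beta')
  also have "?Q \<Otimes>\<^sub>M ?Q = distr M ?Q \<xi> \<Otimes>\<^sub>M distr M ?Q \<xi>" unfolding law ..
  also have "\<dots> = distr (M \<Otimes>\<^sub>M M) (?Q \<Otimes>\<^sub>M ?Q) (\<lambda>(x, y). (\<xi> x, \<xi> y))"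
    by (rule pair_measure_distr) (use sfQ in auto)
  also have "distr \<dots> seqs (\<lambda>(v, w). \<sigma> (comb_seq k v w)) =
     distr (M \<Otimes>\<^sub>M M) seqs (\<lambda>(x, y). \<sigma> (comb_seq k (\<xi> x) (\<xi> y)))"
    by (subst distr_distr) (auto simp: comp_def split_beta')
  also have "(\<lambda>(x, y). \<sigma> (comb_seq k (\<xi> x) (\<xi> y))) = (\<lambda>(\<omega>, \<omega>') j. if j \<le> k then X (real j * h) \<omega>
      else X (real k * h) \<omega> + X (real (j - k) * h) \<omega>')"
    by (simp add: fun_eq_iff comb tele)
  finally show ?thesis .
qed

text \<open>The path continued after time \<open>t\<close> by an independent copy has the same law. This is the form in
  which the Markov property is proved.\<close>

lemma concat_law:
  assumes t: "0 < t"
  shows "distr M vecs (\<lambda>\<omega>. grid_vec t (\<lambda>s. X s \<omega>)) =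
    distr (M \<Otimes>\<^sub>M M) vecs (\<lambda>(\<omega>, \<omega>') (n, j). if j \<le> 2 ^ n then X (grid_time t n j) \<omega>
      else X t \<omega> + X (grid_time t n (j - 2 ^ n)) \<omega>')" (is "?P = ?R")
proof (rule measure_eqI_PiM_infinite)
  interpret MM: pair_prob_space M M ..
  have [measurable]: "(\<lambda>\<omega>. grid_vec t (\<lambda>s. X s \<omega>)) \<in> measurable M vecs"
    unfolding grid_vec_def by (intro measurable_PiM_single') (auto simp: split_beta')
  let ?c = "\<lambda>(\<omega>, \<omega>') (n, j). if j \<le> 2 ^ n then X (grid_time t n j) \<omega> else X t \<omega> + X (grid_time t n (j - 2 ^ n)) \<omega>'"
  have [measurable]: "?c \<in> measurable (M \<Otimes>\<^sub>M M) vecs"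
    by (intro measurable_PiM_single') (auto simp: split_beta')
  show "finite_measure ?P"
    by (intro prob_space.finite_measure prob_space_distr) measurable
  fix A :: "nat \<times> nat \<Rightarrow> real set" and J :: "(nat \<times> nat) set"
  assume J: "finite J" and A: "\<And>i. i \<in> J \<Longrightarrow> A i \<in> sets borel"
  \<comment> \<open>Cylinder sets determine the law. The finitely many indices in \<open>J\<close>
    live on levels up to \<open>m\<close>, so all their times are multiples of \<open>h\<close>, and
    t is the multiple 2^m; \<open>\<phi> i\<close> is the index of the same time on level
    \<open>m\<close>. Now \<open>concat_law_grid\<close> applies with k = 2^m.\<close>
  define m where "m = Max (fst ` J)"
  have m: "fst i \<le> m" if "i \<in> J" for i unfolding m_def using J that by simp
  define h where "h = t / 2 ^ m"
  have h: "h > 0" using t by (simp add: h_def)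
  define \<phi> where "\<phi> i = snd i * 2 ^ (m - fst i)" for i :: "nat \<times> nat"
  define E where "E = {s :: nat \<Rightarrow> real. \<forall>i\<in>J. s (\<phi> i) \<in> A i}"
  have pw: "2 ^ m = 2 ^ n * (2 ^ (m - n) :: 'b::comm_semiring_1)" if "n \<le> m" for n
    using that by (simp flip: power_add)
  have gt_eq: "grid_time t n j = real (j * 2 ^ (m - n)) * h" if "n \<le> m" for n j
    using that by (simp add: grid_time_def h_def pw[OF that])
  have E: "E \<in> sets seqs"
  proof -
    have "E = {s \<in> space seqs. \<forall>i\<in>J. s (\<phi> i) \<in> A i}" by (auto simp: E_def space_PiM)
    also have "\<dots> \<in> sets seqs"
      using J A by (intro sets.sets_Collect_finite_All) (auto intro!: measurable_sets_Collect)
    finally show ?thesis .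
  qed
  let ?B = "prod_emb UNIV (\<lambda>_. borel) J (Pi\<^sub>E J A)"
  have B: "?B \<in> sets vecs" using J A by (intro sets_PiM_I) auto
  have B_iff: "v \<in> ?B \<longleftrightarrow> (\<forall>i\<in>J. v i \<in> A i)" for v
    by (auto simp: prod_emb_def)
  have "emeasure ?P ?B = emeasure M ((\<lambda>\<omega>. grid_vec t (\<lambda>s. X s \<omega>)) -` ?B \<inter> space M)"
    using B by (simp add: emeasure_distr)
  also have "(\<lambda>\<omega>. grid_vec t (\<lambda>s. X s \<omega>)) -` ?B \<inter> space M = (\<lambda>\<omega> j. X (real j * h) \<omega>) -` E \<inter> space M"
  proof -
    have "X (real (\<phi> i) * h) \<omega> = grid_vec t (\<lambda>s. X s \<omega>) i" if "i \<in> J" for i \<omega>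
      unfolding grid_vec_def split_beta' gt_eq[OF m[OF that]] \<phi>_def ..
    then show ?thesis by (auto simp: B_iff E_def)
  qed
  also have "emeasure M \<dots> = emeasure (distr M seqs (\<lambda>\<omega> j. X (real j * h) \<omega>)) E"
    using E by (subst emeasure_distr) (auto intro!: measurable_PiM_single')
  also have "\<dots> = emeasure (distr (M \<Otimes>\<^sub>M M) seqs (\<lambda>(\<omega>, \<omega>') j. if j \<le> 2 ^ m then X (real j * h) \<omega>
      else X (real (2 ^ m) * h) \<omega> + X (real (j - 2 ^ m) * h) \<omega>')) E"
    by (subst concat_law_grid[OF h, of "2 ^ m"]) simp
  also have "\<dots> = emeasure (M \<Otimes>\<^sub>M M) ((\<lambda>(\<omega>, \<omega>') j. if j \<le> 2 ^ m then X (real j * h) \<omega>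
      else X (real (2 ^ m) * h) \<omega> + X (real (j - 2 ^ m) * h) \<omega>') -` E \<inter> space (M \<Otimes>\<^sub>M M))"
    using E by (subst emeasure_distr) (auto intro!: measurable_PiM_single' simp: split_beta')
  also have "(\<lambda>(\<omega>, \<omega>') j. if j \<le> 2 ^ m then X (real j * h) \<omega>
      else X (real (2 ^ m) * h) \<omega> + X (real (j - 2 ^ m) * h) \<omega>') -` E \<inter> space (M \<Otimes>\<^sub>M M) = ?c -` ?B \<inter> space (M \<Otimes>\<^sub>M M)"
  proof -
    have "(if \<phi> i \<le> 2 ^ m then X (real (\<phi> i) * h) \<omega> else X (real (2 ^ m) * h) \<omega> + X (real (\<phi> i - 2 ^ m) * h) \<omega>')
      = (if snd i \<le> 2 ^ fst i then X (grid_time t (fst i) (snd i)) \<omega> else X t \<omega> + X (grid_time t (fst i) (snd i - 2 ^ fst i)) \<omega>')"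
      if "i \<in> J" for i \<omega> \<omega>'
    proof -
      note mi = m[OF that]
      have 1: "\<phi> i \<le> 2 ^ m \<longleftrightarrow> snd i \<le> 2 ^ fst i"
        unfolding \<phi>_def pw[OF mi] by simp
      have 2: "real (\<phi> i) * h = grid_time t (fst i) (snd i)" unfolding \<phi>_def gt_eq[OF mi] ..
      have 3: "real (2 ^ m) * h = t" by (simp add: h_def)
      have 4: "real (\<phi> i - 2 ^ m) * h = grid_time t (fst i) (snd i - 2 ^ fst i)"
        unfolding gt_eq[OF mi] \<phi>_def pw[OF mi] by (simp only: diff_mult_distrib)
      show ?thesis by (simp only: 1 2 3 4)
    qed
    then have key: "(\<lambda>(\<omega>, \<omega>') j. if j \<le> 2 ^ m then X (real j * h) \<omega>
        else X (real (2 ^ m) * h) \<omega> + X (real (j - 2 ^ m) * h) \<omega>') w (\<phi> i) = ?c w i" if "i \<in> J" for i w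
      using that by (simp only: split_beta')
    show ?thesis
      by (rule set_eqI) (simp only: vimage_eq Int_iff B_iff E_def mem_Collect_eq key cong: ball_cong)
  qed
  also have "emeasure (M \<Otimes>\<^sub>M M) \<dots> = emeasure ?R ?B"
    using B by (simp add: emeasure_distr)
  finally show "emeasure ?P ?B = emeasure ?R ?B" .
qed (auto simp: comp_def)

text \<open>Survival up to t and the position at t depend on the path up to t only, and the path
  after t comes from the independent copy in \<open>concat_law\<close>, which Fubini's theorem
  integrates out. With t as the grid unit, t lies on the grid of every level.\<close>

theorem markov:
  assumes t: "0 < t" and \<Phi>: "path_measurable t \<Phi>" and [measurable]: "g \<in> borel_measurable borel"
  shows "(\<integral>\<^sup>+\<omega>. (if alive (\<lambda>s. y + X s \<omega>) t then g (y + X t \<omega>) * \<Phi> (\<lambda>s. y + X (t + s) \<omega>) else 0) \<partial>M) =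
    (\<integral>\<^sup>+\<omega>. (if alive (\<lambda>s. y + X s \<omega>) t then g (y + X t \<omega>) * (\<integral>\<^sup>+\<omega>'. \<Phi> (\<lambda>s. y + X t \<omega> + X s \<omega>') \<partial>M) else 0) \<partial>M)"
proof -
  interpret MM: pair_prob_space M M ..
  obtain \<Phi>' where [measurable]: "\<Phi>' \<in> borel_measurable vecs"
    and \<Phi>': "\<And>z. rc_path z \<Longrightarrow> \<Phi> z = \<Phi>' (grid_vec t z)"
    using \<Phi> by (auto simp: path_measurable_def)
  define sh where "sh v = (\<lambda>(n, j). y + v (n, j + 2 ^ n))" for v :: "nat \<times> nat \<Rightarrow> real"
  have [measurable]: "sh \<in> measurable vecs vecs"
    unfolding sh_def by (intro measurable_PiM_single') (auto simp: split_beta')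
  \<comment> \<open>On level n the indices below 2^n are the times before t, index 1 on level 0 is t
    itself, and adding 2^n to an index shifts time by t.\<close>
  define \<Psi> where "\<Psi> v = (if \<forall>n j. j < 2 ^ n \<longrightarrow> 0 \<le> y + v (n, j) then g (y + v (0, 1)) * \<Phi>' (sh v) else 0)"
    for v :: "nat \<times> nat \<Rightarrow> real"
  have [measurable]: "\<Psi> \<in> borel_measurable vecs" unfolding \<Psi>_def[abs_def] by measurable
  have [measurable]: "(\<lambda>\<omega>. grid_vec t (\<lambda>s. X s \<omega>)) \<in> measurable M vecs"
    unfolding grid_vec_def by (intro measurable_PiM_single') (auto simp: split_beta')
  let ?c = "\<lambda>(\<omega>, \<omega>') (n, j). if j \<le> 2 ^ n then X (grid_time t n j) \<omega> else X t \<omega> + X (grid_time t n (j - 2 ^ n)) \<omega>'"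
  have c_meas [measurable]: "?c \<in> measurable (M \<Otimes>\<^sub>M M) vecs"
    by (intro measurable_PiM_single') (auto simp: split_beta')
  have gt_less: "grid_time t n j < t \<longleftrightarrow> j < 2 ^ n" for n j
  proof -
    have "grid_time t n j < t \<longleftrightarrow> real j < 2 ^ n" using t by (simp add: grid_time_def divide_simps)
    also have "\<dots> \<longleftrightarrow> real j < real (2 ^ n)" by simp
    finally show ?thesis by (simp only: of_nat_less_iff)
  qed
  have gt_add: "grid_time t n (j + 2 ^ n) = t + grid_time t n j" for n j
    using t by (simp add: grid_time_def algebra_simps add_divide_distrib)
  have al: "alive (\<lambda>s. y + X s \<omega>) t \<longleftrightarrow> (\<forall>n j. j < 2 ^ n \<longrightarrow> 0 \<le> y + X (grid_time t n j) \<omega>)" for \<omega>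
    by (simp add: alive_grid[OF rcpath t] gt_less)
  have gt01: "grid_time t 0 1 = t" by (simp add: grid_time_def)
  have sh1: "sh (grid_vec t (\<lambda>s. X s \<omega>)) = grid_vec t (\<lambda>s. y + X (t + s) \<omega>)" for \<omega>
    by (simp add: sh_def grid_vec_def gt_add fun_eq_iff)
  have L: "(if alive (\<lambda>s. y + X s \<omega>) t then g (y + X t \<omega>) * \<Phi> (\<lambda>s. y + X (t + s) \<omega>) else 0)
      = \<Psi> (grid_vec t (\<lambda>s. X s \<omega>))" for \<omega>
  proof -
    have "\<Phi> (\<lambda>s. y + X (t + s) \<omega>) = \<Phi>' (grid_vec t (\<lambda>s. y + X (t + s) \<omega>))"
      using t by (intro \<Phi>' rc_path_shift[OF rcpath]) simp
    then show ?thesis unfolding \<Psi>_def sh1 by (simp only: al grid_vec_def split gt01)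
  qed
  have sh2: "sh (?c (\<omega>, \<omega>')) = grid_vec t (\<lambda>s. y + X t \<omega> + X s \<omega>')" for \<omega> \<omega>'
  proof -
    have "grid_time t n (2 ^ n) = t" for n by (simp add: grid_time_def)
    moreover have "grid_time t n 0 = 0" for n by (simp add: grid_time_def)
    ultimately show ?thesis by (auto simp: sh_def grid_vec_def fun_eq_iff)
  qed
  have R: "\<Psi> (?c (\<omega>, \<omega>')) = (if alive (\<lambda>s. y + X s \<omega>) t then g (y + X t \<omega>) * \<Phi> (\<lambda>s. y + X t \<omega> + X s \<omega>') else 0)"
    for \<omega> \<omega>'
    unfolding \<Psi>_def sh2 \<Phi>'[OF rcpath] al by (auto simp: gt01 gt01[unfolded One_nat_def] less_imp_le)
  have R_meas: "(\<lambda>\<omega>'. \<Phi> (\<lambda>s. a + X s \<omega>')) \<in> borel_measurable M" for a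
  proof -
    have "(\<lambda>\<omega>'. grid_vec t (\<lambda>s. a + X s \<omega>')) \<in> measurable M vecs"
      unfolding grid_vec_def by (intro measurable_PiM_single') (auto simp: split_beta')
    then show ?thesis unfolding \<Phi>'[OF rcpath] by measurable
  qed
  have "(\<integral>\<^sup>+\<omega>. (if alive (\<lambda>s. y + X s \<omega>) t then g (y + X t \<omega>) * \<Phi> (\<lambda>s. y + X (t + s) \<omega>) else 0) \<partial>M)
     = (\<integral>\<^sup>+v. \<Psi> v \<partial>distr M vecs (\<lambda>\<omega>. grid_vec t (\<lambda>s. X s \<omega>)))"
    unfolding L by (subst nn_integral_distr) auto
  also have "\<dots> = (\<integral>\<^sup>+w. \<Psi> (?c w) \<partial>(M \<Otimes>\<^sub>M M))"
    unfolding concat_law[OF t] by (subst nn_integral_distr) auto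
  also have "\<dots> = (\<integral>\<^sup>+\<omega>. \<integral>\<^sup>+\<omega>'. \<Psi> (?c (\<omega>, \<omega>')) \<partial>M \<partial>M)"
    by (rule nn_integral_fst[symmetric]) measurable
  also have "\<dots> = (\<integral>\<^sup>+\<omega>. (if alive (\<lambda>s. y + X s \<omega>) t then g (y + X t \<omega>) * (\<integral>\<^sup>+\<omega>'. \<Phi> (\<lambda>s. y + X t \<omega> + X s \<omega>') \<partial>M) else 0) \<partial>M)"
    unfolding R by (intro nn_integral_cong) (auto intro!: nn_integral_cmult R_meas)
  finally show ?thesis .
qed

end

section \<open>Optional stopping along dyadic grids\<close>

text \<open>Let T be the infimum of the times with negative value. No jump leads below 0, so z T
  \<ge> 0. The times \<open>u n\<close> carry negative values and detect negativity without delay,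
  hence they approach T from the right, and z T \<le> 0 by right continuity. So there is no
  undershoot in the limit.\<close>

lemma first_negative_limit:
  assumes z: "sp_path z" and z0: "0 \<le> z 0" and s: "0 \<le> s" "z s < 0"
    and neg: "\<forall>\<^sub>F n in sequentially. 0 \<le> u n \<and> z (u n) < 0"
    and first: "\<And>r r'. 0 \<le> r \<Longrightarrow> z r < 0 \<Longrightarrow> r < r' \<Longrightarrow> \<forall>\<^sub>F n in sequentially. u n < r'"
  shows "(\<lambda>n. z (u n)) \<longlonglongrightarrow> 0"
proof -
  let ?N = "{r. 0 \<le> r \<and> z r < 0}"
  define T where "T = Inf ?N"
  have bdd: "bdd_below ?N" by (rule bdd_belowI[of _ 0]) simp
  have ne: "?N \<noteq> {}" using s by auto
  have T0: "0 \<le> T" unfolding T_def by (rule cInf_greatest[OF ne]) simp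
  have Tle: "T \<le> r" if "0 \<le> r" "z r < 0" for r unfolding T_def using that by (intro cInf_lower bdd) simp
  have zT: "0 \<le> z T"
  proof (cases "T = 0")
    case False
    then have "0 < T" using T0 by simp
    then show ?thesis
    proof (rule sp_path_ge_at[OF z])
      fix s assume "0 \<le> s" "s < T"
      then show "0 \<le> z s" using Tle[of s] by linarith
    qed
  qed (use z0 in simp)
  have gt: "\<forall>\<^sub>F n in sequentially. T < u n"
    using neg
  proof eventually_elim
    case (elim n)
    then have "T \<le> u n" using Tle by blast
    moreover have "u n \<noteq> T" using elim zT by auto
    ultimately show ?case by simp
  qed
  have lim: "u \<longlonglongrightarrow> T"
  proof (rule order_tendstoI)
    fix a assume "a < T"
    then show "\<forall>\<^sub>F n in sequentially. a < u n" using gt by (auto elim!: eventually_mono)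
  next
    fix a assume "T < a"
    then have "\<exists>r\<in>?N. r < a" unfolding T_def by (rule cInf_lessD[OF ne])
    then obtain r where "r \<in> ?N" "r < a" by blast
    then show "\<forall>\<^sub>F n in sequentially. u n < a" by (intro first) auto
  qed
  have "filterlim u (at_right T) sequentially"
    unfolding filterlim_at using lim gt by (auto elim: eventually_mono)
  then have l: "(\<lambda>n. z (u n)) \<longlonglongrightarrow> z T"
    using z T0 by (auto simp: sp_path_def rc_path_def intro: filterlim_compose)
  then have "z T \<le> 0" using neg by (intro tendsto_upperbound[OF l]) (auto elim: eventually_mono)
  with zT l show ?thesis by simp
qed

context spectrally_positive
begin

lemma laplace_nn:
  assumes "0 \<le> l" "0 \<le> t"
  shows "(\<integral>\<^sup>+\<omega>. ennreal (exp (- l * X t \<omega>)) \<partial>M) = ennreal (exp (\<psi> l * t))"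
    "integrable M (\<lambda>\<omega>. exp (- l * X t \<omega>))" "(\<integral>\<omega>. exp (- l * X t \<omega>) \<partial>M) = exp (\<psi> l * t)"
proof -
  note b = laplace[OF assms]
  show i: "integrable M (\<lambda>\<omega>. exp (- l * X t \<omega>))" using b by (rule integrable.intros)
  show e: "(\<integral>\<omega>. exp (- l * X t \<omega>) \<partial>M) = exp (\<psi> l * t)" using b by (rule has_bochner_integral_integral_eq)
  show "(\<integral>\<^sup>+\<omega>. ennreal (exp (- l * X t \<omega>)) \<partial>M) = ennreal (exp (\<psi> l * t))"
    using nn_integral_eq_integral[OF i] e by simp
qed

lemma exp_start: "exp (- l * (y + X t \<omega>)) = exp (- l * y) * exp (- l * X t \<omega>)"
  by (simp only: mult_exp_exp distrib_left)

lemma laplace_start: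
  assumes "0 \<le> l" "0 \<le> t"
  shows "integrable M (\<lambda>\<omega>. exp (- l * (y + X t \<omega>)))"
    "(\<integral>\<omega>. exp (- l * (y + X t \<omega>)) \<partial>M) = exp (- l * y + \<psi> l * t)"
proof -
  have e: "exp (- l * y + \<psi> l * t) = exp (- l * y) * exp (\<psi> l * t)" by (rule exp_add)
  show "integrable M (\<lambda>\<omega>. exp (- l * (y + X t \<omega>)))"
    unfolding exp_start by (rule integrable_mult_right[OF laplace_nn(2)[OF assms]])
  show "(\<integral>\<omega>. exp (- l * (y + X t \<omega>)) \<partial>M) = exp (- l * y + \<psi> l * t)"
  proof -
    have "(\<integral>\<omega>. exp (- l * (y + X t \<omega>)) \<partial>M) = (\<integral>\<omega>. exp (- l * y) * exp (- l * X t \<omega>) \<partial>M)"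
      by (simp only: exp_start)
    also have "\<dots> = exp (- l * y) * (\<integral>\<omega>. exp (- l * X t \<omega>) \<partial>M)"
      by (rule Bochner_Integration.integral_mult_right_zero)
    finally show ?thesis unfolding laplace_nn(3)[OF assms] e .
  qed
qed

definition grid_ok :: "real \<Rightarrow> real \<Rightarrow> nat \<Rightarrow> nat \<Rightarrow> 'a \<Rightarrow> bool" where
  "grid_ok y t n j \<omega> \<longleftrightarrow> (\<forall>i\<le>j. 0 \<le> y + X (grid_time t n i) \<omega>)"

text \<open>The first index at which the sampled path is negative, capped at j. The recursion
  exposes the single step that \<open>stopped_step\<close> analyses.\<close>

primrec stop :: "real \<Rightarrow> real \<Rightarrow> nat \<Rightarrow> nat \<Rightarrow> 'a \<Rightarrow> nat" where
  "stop y t n 0 \<omega> = 0"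
| "stop y t n (Suc j) \<omega> = (if grid_ok y t n j \<omega> then Suc j else stop y t n j \<omega>)"

lemma measurable_grid_ok [measurable]: "Measurable.pred M (grid_ok y t n j)"
  unfolding grid_ok_def[abs_def] by measurable

lemma measurable_stop [measurable]: "stop y t n j \<in> measurable M (count_space UNIV)"
proof (induction j)
  case (Suc j)
  note Suc [measurable]
  show ?case unfolding stop.simps by measurable
qed simp

lemma stop_le: "stop y t n j \<omega> \<le> j"
  by (induction j) auto

lemma grid_ok_antimono: "grid_ok y t n j \<omega> \<Longrightarrow> i \<le> j \<Longrightarrow> grid_ok y t n i \<omega>"
  by (auto simp: grid_ok_def)

lemma stop_eq: "grid_ok y t n (j - 1) \<omega> \<Longrightarrow> stop y t n j \<omega> = j"
  by (cases j) auto

lemma stop_eq': "grid_ok y t n j \<omega> \<Longrightarrow> stop y t n j \<omega> = j"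
  by (rule stop_eq) (erule grid_ok_antimono, simp)

lemma stop_neg:
  "0 \<le> y \<Longrightarrow> \<not> grid_ok y t n j \<omega> \<Longrightarrow>
    y + X (grid_time t n (stop y t n j \<omega>)) \<omega> < 0 \<and> (\<forall>i<stop y t n j \<omega>. 0 \<le> y + X (grid_time t n i) \<omega>)"
proof (induction j)
  case 0
  then show ?case by (simp add: grid_ok_def grid_time_def)
next
  case (Suc j)
  show ?case
  proof (cases "grid_ok y t n j \<omega>")
    case True
    then have ok: "\<forall>i\<le>j. 0 \<le> y + X (grid_time t n i) \<omega>" by (simp only: grid_ok_def)
    have "\<not> 0 \<le> y + X (grid_time t n (Suc j)) \<omega>"
    proof
      assume "0 \<le> y + X (grid_time t n (Suc j)) \<omega>"
      then have "grid_ok y t n (Suc j) \<omega>" unfolding grid_ok_def using ok le_Suc_eq by blast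
      then show False using Suc(3) by blast
    qed
    moreover have "stop y t n (Suc j) \<omega> = Suc j" using True by (simp only: stop.simps if_True)
    ultimately show ?thesis using ok by (simp only: not_le less_Suc_eq_le simp_thms)
  next
    case False
    then have "stop y t n (Suc j) \<omega> = stop y t n j \<omega>" by (simp only: stop.simps if_False)
    then show ?thesis using Suc(1)[OF Suc(2) False] by (rule ssubst)
  qed
qed

text \<open>The next increment is independent of survival up to index j and has exponential moment
  \<open>exp (\<psi> l * h)\<close>, h being the mesh; this is \<open>concat_law_grid\<close> with k
  = j.\<close>

lemma grid_step:
  assumes t: "0 < t" and l: "0 \<le> l"
  shows "integrable M (\<lambda>\<omega>. of_bool (grid_ok y t n j \<omega>) * exp (- l * (y + X (grid_time t n i) \<omega>)))"
    "(\<integral>\<omega>. of_bool (grid_ok y t n j \<omega>) * exp (- l * (y + X (grid_time t n (Suc j)) \<omega>)) \<partial>M) =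
      exp (\<psi> l * (t / 2 ^ n)) * (\<integral>\<omega>. of_bool (grid_ok y t n j \<omega>) * exp (- l * (y + X (grid_time t n j) \<omega>)) \<partial>M)"
proof -
  interpret MM: pair_prob_space M M ..
  show int: "integrable M (\<lambda>\<omega>. of_bool (grid_ok y t n j \<omega>) * exp (- l * (y + X (grid_time t n i) \<omega>)))" for i
    by (rule Bochner_Integration.integrable_bound[OF laplace_start(1)[OF l grid_time_nonneg[OF t], of y n i]]) auto
  define h where "h = t / 2 ^ n"
  have h: "0 < h" using t by (simp add: h_def)
  have gt: "grid_time t n i = real i * h" for i by (simp add: grid_time_def h_def)
  let ?F = "\<lambda>s::nat\<Rightarrow>real. ennreal (of_bool (\<forall>i\<le>j. 0 \<le> y + s i) * exp (- l * (y + s (Suc j))))"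
  let ?a = "\<lambda>\<omega>. of_bool (grid_ok y t n j \<omega>) * exp (- l * (y + X (grid_time t n j) \<omega>))"
  let ?c = "\<lambda>(\<omega>, \<omega>') i. if i \<le> j then X (real i * h) \<omega> else X (real j * h) \<omega> + X (real (i - j) * h) \<omega>'"
  have F_meas: "?F \<in> borel_measurable seqs" by measurable
  have m1: "(\<lambda>\<omega> j. X (real j * h) \<omega>) \<in> measurable M seqs"
    by (intro measurable_PiM_single') auto
  have m2: "?c \<in> measurable (M \<Otimes>\<^sub>M M) seqs"
    by (intro measurable_PiM_single') (auto simp: split_beta')
  have "(\<integral>\<^sup>+\<omega>. ennreal (of_bool (grid_ok y t n j \<omega>) * exp (- l * (y + X (grid_time t n (Suc j)) \<omega>))) \<partial>M)
    = (\<integral>\<^sup>+\<omega>. ?F (\<lambda>j. X (real j * h) \<omega>) \<partial>M)"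
    by (simp only: grid_ok_def gt)
  also have "\<dots> = (\<integral>\<^sup>+s. ?F s \<partial>distr M seqs (\<lambda>\<omega> j. X (real j * h) \<omega>))"
    by (rule nn_integral_distr[OF m1, symmetric]) (simp add: F_meas)
  also have "\<dots> = (\<integral>\<^sup>+w. ?F (?c w) \<partial>(M \<Otimes>\<^sub>M M))"
    unfolding concat_law_grid[OF h, of j] by (rule nn_integral_distr[OF m2]) (simp add: F_meas)
  also have "\<dots> = (\<integral>\<^sup>+w. ennreal (?a (fst w)) * ennreal (exp (- l * X h (snd w))) \<partial>(M \<Otimes>\<^sub>M M))"
  proof (rule nn_integral_cong)
    fix w :: "'a \<times> 'a"
    have 1: "exp (- l * (y + (a + b))) = exp (- l * (y + a)) * exp (- l * b)" for a b
      unfolding exp_add[symmetric] by (rule arg_cong[where f=exp]) (simp add: distrib_left)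
    have 2: "(\<forall>i\<le>j. 0 \<le> y + (if i \<le> j then X (real i * h) (fst w) else c i)) = grid_ok y t n j (fst w)" for c
      by (simp add: grid_ok_def gt)
    have 3: "\<not> Suc j \<le> j" "real (Suc j - j) * h = h" by auto
    show "?F (?c w) = ennreal (?a (fst w)) * ennreal (exp (- l * X h (snd w)))"
      unfolding split_beta' 2 by (simp only: 3 if_False 1 gt ennreal_mult''[symmetric] exp_ge_zero mult.assoc)
  qed
  also have "\<dots> = (\<integral>\<^sup>+\<omega>. \<integral>\<^sup>+\<omega>'. ennreal (?a \<omega>) * ennreal (exp (- l * X h \<omega>')) \<partial>M \<partial>M)"
  proof -
    have "(\<lambda>w. ennreal (?a (fst w)) * ennreal (exp (- l * X h (snd w)))) \<in> borel_measurable (M \<Otimes>\<^sub>M M)"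
      by measurable
    from nn_integral_fst[OF this] show ?thesis by (simp only: fst_conv snd_conv)
  qed
  also have "\<dots> = (\<integral>\<^sup>+\<omega>. ennreal (?a \<omega>) * ennreal (exp (\<psi> l * h)) \<partial>M)"
  proof -
    have "(\<integral>\<^sup>+\<omega>'. c * ennreal (exp (- l * X h \<omega>')) \<partial>M) = c * ennreal (exp (\<psi> l * h))" for c
      unfolding laplace_nn(1)[OF l less_imp_le[OF h], symmetric] by (rule nn_integral_cmult) measurable
    then show ?thesis by (simp only:)
  qed
  also have "\<dots> = (\<integral>\<^sup>+\<omega>. ennreal (?a \<omega>) \<partial>M) * ennreal (exp (\<psi> l * h))"
    by (rule nn_integral_multc) measurable
  also have "\<dots> = ennreal (exp (\<psi> l * h)) * (\<integral>\<^sup>+\<omega>. ennreal (?a \<omega>) \<partial>M)"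
    by (rule mult.commute)
  finally have "(\<integral>\<^sup>+\<omega>. ennreal (of_bool (grid_ok y t n j \<omega>) * exp (- l * (y + X (grid_time t n (Suc j)) \<omega>))) \<partial>M)
    = ennreal (exp (\<psi> l * h)) * (\<integral>\<^sup>+\<omega>. ennreal (?a \<omega>) \<partial>M)" .
  moreover have "(\<integral>\<^sup>+\<omega>. ennreal (of_bool (grid_ok y t n j \<omega>) * exp (- l * (y + X (grid_time t n i) \<omega>))) \<partial>M)
    = ennreal (\<integral>\<omega>. of_bool (grid_ok y t n j \<omega>) * exp (- l * (y + X (grid_time t n i) \<omega>)) \<partial>M)" for i
    by (rule nn_integral_eq_integral[OF int]) simp
  ultimately have eq: "ennreal (\<integral>\<omega>. of_bool (grid_ok y t n j \<omega>) * exp (- l * (y + X (grid_time t n (Suc j)) \<omega>)) \<partial>M)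
      = ennreal (exp (\<psi> l * h) * (\<integral>\<omega>. ?a \<omega> \<partial>M))"
    by (simp only: ennreal_mult' exp_ge_zero)
  have nn: "0 \<le> (\<integral>\<omega>. of_bool (grid_ok y t n j \<omega>) * exp (- l * (y + X (grid_time t n i) \<omega>)) \<partial>M)" for i
    by (rule Bochner_Integration.integral_nonneg) simp
  have nn': "0 \<le> exp (\<psi> l * h) * (\<integral>\<omega>. ?a \<omega> \<partial>M)"
    by (rule mult_nonneg_nonneg[OF exp_ge_zero nn])
  show "(\<integral>\<omega>. of_bool (grid_ok y t n j \<omega>) * exp (- l * (y + X (grid_time t n (Suc j)) \<omega>)) \<partial>M) =
      exp (\<psi> l * (t / 2 ^ n)) * (\<integral>\<omega>. ?a \<omega> \<partial>M)"
    unfolding h_def[symmetric] by (rule iffD1[OF ennreal_inj[OF nn nn'] eq])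
qed

text \<open>Raising the cap from j to j + 1 moves the stopped position on the event
  \<open>grid_ok\<close> only; elsewhere it is frozen. The exponential is integrable because at most
  j + 1 positions are possible.\<close>

lemma stopped_step:
  fixes y :: real
  assumes t: "0 < t" and l: "0 \<le> l"
  defines "S \<equiv> \<lambda>n j. \<integral>\<omega>. exp (- l * (y + X (grid_time t n (stop y t n j \<omega>)) \<omega>)) \<partial>M"
  shows "integrable M (\<lambda>\<omega>. exp (- l * (y + X (grid_time t n (stop y t n j \<omega>)) \<omega>)))"
    "S n (Suc j) = S n j + ((\<integral>\<omega>. of_bool (grid_ok y t n j \<omega>) * exp (- l * (y + X (grid_time t n (Suc j)) \<omega>)) \<partial>M)
        - (\<integral>\<omega>. of_bool (grid_ok y t n j \<omega>) * exp (- l * (y + X (grid_time t n j) \<omega>)) \<partial>M))"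
    "(\<integral>\<omega>. of_bool (grid_ok y t n j \<omega>) * exp (- l * (y + X (grid_time t n j) \<omega>)) \<partial>M) \<le> S n j"
proof -
  let ?e = "\<lambda>j \<omega>. exp (- l * (y + X (grid_time t n (stop y t n j \<omega>)) \<omega>))"
  let ?s = "\<lambda>i \<omega>. exp (- l * (y + X (grid_time t n i) \<omega>))"
  have m: "(\<lambda>\<omega>. X (grid_time t n (stop y t n j \<omega>)) \<omega>) \<in> borel_measurable M" for j
    by (rule measurable_compose_countable[OF meas_X measurable_stop])
  note [measurable] = m
  show int: "integrable M (?e j)" for j
  proof (rule Bochner_Integration.integrable_bound)
    show "integrable M (\<lambda>\<omega>. \<Sum>i\<le>j. ?s i \<omega>)"
      by (intro Bochner_Integration.integrable_sum laplace_start(1) l grid_time_nonneg t)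
    show "AE \<omega> in M. norm (?e j \<omega>) \<le> norm (\<Sum>i\<le>j. ?s i \<omega>)"
    proof (rule AE_I2)
      fix \<omega>
      have "?e j \<omega> \<le> (\<Sum>i\<le>j. ?s i \<omega>)"
        using member_le_sum[of "stop y t n j \<omega>" "{..j}" "\<lambda>i. ?s i \<omega>"] stop_le[of y t n j \<omega>] by simp
      then show "norm (?e j \<omega>) \<le> norm (\<Sum>i\<le>j. ?s i \<omega>)" by (simp add: sum_nonneg)
    qed
  qed measurable
  let ?g = "\<lambda>i \<omega>. of_bool (grid_ok y t n j \<omega>) * ?s i \<omega>"
  have gi: "integrable M (?g i)" for i by (rule grid_step(1)[OF t l])
  have "?e (Suc j) \<omega> = ?e j \<omega> + (?g (Suc j) \<omega> - ?g j \<omega>)" for \<omega>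
    by (cases "grid_ok y t n j \<omega>") (auto simp: stop_eq')
  then have "S n (Suc j) = (\<integral>\<omega>. ?e j \<omega> + (?g (Suc j) \<omega> - ?g j \<omega>) \<partial>M)" by (simp only: S_def)
  also have "\<dots> = S n j + ((\<integral>\<omega>. ?g (Suc j) \<omega> \<partial>M) - (\<integral>\<omega>. ?g j \<omega> \<partial>M))"
    unfolding S_def by (simp only: Bochner_Integration.integral_add Bochner_Integration.integral_diff int gi Bochner_Integration.integrable_diff)
  finally show "S n (Suc j) = S n j + ((\<integral>\<omega>. ?g (Suc j) \<omega> \<partial>M) - (\<integral>\<omega>. ?g j \<omega> \<partial>M))" .
  show "(\<integral>\<omega>. ?g j \<omega> \<partial>M) \<le> S n j"
    unfolding S_def
  proof (rule integral_mono[OF gi int])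
    fix \<omega> show "?g j \<omega> \<le> ?e j \<omega>" by (cases "grid_ok y t n j \<omega>") (auto simp: stop_eq')
  qed
qed

text \<open>A discrete Gronwall estimate: each step multiplies by at most
  \<open>exp (\<bar>\<psi> l\<bar> * h)\<close>, and at most 2^n steps of mesh h = t / 2^n are made.
  The bound does not depend on n; with \<open>2 * l\<close> for \<open>l\<close> it supplies the
  second moments for \<open>tendsto_integral_L2_bounded\<close>.\<close>

lemma stopped_bound:
  assumes t: "0 < t" and l: "0 \<le> l" and y: "0 \<le> y" and j: "j \<le> 2 ^ n"
  shows "(\<integral>\<omega>. exp (- l * (y + X (grid_time t n (stop y t n j \<omega>)) \<omega>)) \<partial>M) \<le> exp (\<bar>\<psi> l\<bar> * t)"
proof -
  define h where "h = t / 2 ^ n"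
  have h: "0 < h" using t by (simp add: h_def)
  define S where "S j = (\<integral>\<omega>. exp (- l * (y + X (grid_time t n (stop y t n j \<omega>)) \<omega>)) \<partial>M)" for j
  define a where "a j = (\<integral>\<omega>. of_bool (grid_ok y t n j \<omega>) * exp (- l * (y + X (grid_time t n j) \<omega>)) \<partial>M)" for j
  have a: "0 \<le> a j" "a j \<le> S j" for j
    using stopped_step(3)[OF t l, where y=y and n=n and j=j]
    by (auto simp: a_def S_def intro!: Bochner_Integration.integral_nonneg)
  have step: "S (Suc j) = S j + (exp (\<psi> l * h) - 1) * a j" for j
    using stopped_step(2)[OF t l, where y=y and n=n and j=j] grid_step(2)[OF t l, where y=y and n=n and j=j]
    unfolding S_def[symmetric] a_def[symmetric] h_def[symmetric] by (simp add: algebra_simps)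
  have "S j \<le> exp (\<bar>\<psi> l\<bar> * (real j * h))" for j
  proof (induction j)
    case 0
    have "S 0 = exp (- l * y)" by (simp add: S_def grid_time_def prob_space)
    also have "\<dots> \<le> 1" using l y by simp
    finally show ?case by simp
  next
    case (Suc j)
    have e: "1 \<le> exp (\<bar>\<psi> l\<bar> * h)" using h by simp
    have "(exp (\<psi> l * h) - 1) * a j \<le> (exp (\<bar>\<psi> l\<bar> * h) - 1) * a j"
      using h a by (intro mult_right_mono) (auto intro!: mult_right_mono)
    also have "\<dots> \<le> (exp (\<bar>\<psi> l\<bar> * h) - 1) * S j" using a e by (intro mult_left_mono) auto
    finally have "S (Suc j) \<le> exp (\<bar>\<psi> l\<bar> * h) * S j" unfolding step by (simp add: algebra_simps)
    also have "\<dots> \<le> exp (\<bar>\<psi> l\<bar> * h) * exp (\<bar>\<psi> l\<bar> * (real j * h))" using Suc by (intro mult_left_mono) auto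
    also have "\<dots> = exp (\<bar>\<psi> l\<bar> * (real (Suc j) * h))" by (simp add: algebra_simps flip: exp_add)
    finally show ?case .
  qed
  also have "exp (\<bar>\<psi> l\<bar> * (real j * h)) \<le> exp (\<bar>\<psi> l\<bar> * t)"
  proof -
    have "real j * h \<le> 2 ^ n * h" using h j by (intro mult_right_mono) (simp_all flip: of_nat_power_eq_of_nat_cancel_iff)
    also have "\<dots> = t" by (simp add: h_def)
    finally show ?thesis by (simp add: mult_left_mono)
  qed
  finally show ?thesis by (simp add: S_def)
qed

text \<open>A surviving path is stopped at index 2^n, that is at time t. Otherwise the stopping
  times satisfy \<open>first_negative_limit\<close>, the stopped values tend to 0, and the
  exponential tends to 1 whatever l is.\<close>

lemma stopped_limit:
  assumes t: "0 < t" and y: "0 \<le> y"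
  shows "(\<lambda>n. exp (- l * (y + X (grid_time t n (stop y t n (2 ^ n) \<omega>)) \<omega>)))
    \<longlonglongrightarrow> (if alive (\<lambda>s. y + X s \<omega>) t then exp (- l * (y + X t \<omega>)) else 1)"
proof -
  let ?z = "\<lambda>s. y + X s \<omega>"
  have gtt: "grid_time t n (2 ^ n) = t" for n by (simp add: grid_time_def)
  have gt_mono: "i \<le> j \<Longrightarrow> grid_time t n i \<le> grid_time t n j" for n i j using t by (simp add: grid_time_def mult_right_mono divide_right_mono)
  show ?thesis
  proof (cases "alive ?z t")
    case True
    have "0 \<le> ?z (grid_time t n i)" if "i \<le> 2 ^ n" for n i
    proof (cases "grid_time t n i < t")
      case True
      then show ?thesis using \<open>alive ?z t\<close> grid_time_nonneg[OF t] by (auto simp: alive_def)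
    next
      case False
      then have "grid_time t n i = t" using gt_mono[OF that, of n] gtt[of n] by linarith
      then show ?thesis using alive_nonneg[OF path \<open>alive ?z t\<close> t] by simp
    qed
    then have "grid_ok y t n (2 ^ n) \<omega>" for n by (auto simp: grid_ok_def)
    then show ?thesis using True by (simp add: stop_eq' gtt)
  next
    case False
    then obtain s where s: "0 \<le> s" "s < t" "?z s < 0" by (auto simp: alive_def not_le)
    define u where "u n = grid_time t n (stop y t n (2 ^ n) \<omega>)" for n
    have up_neg: "\<forall>\<^sub>F n in sequentially. ?z (grid_time t n (next_index t n r)) < 0" if "0 \<le> r" "?z r < 0" for r
      by (rule order_tendstoD(2)[OF rc_path_next_tendsto[OF rcpath t that(1)] that(2)])
    have up_le: "\<forall>\<^sub>F n in sequentially. grid_time t n (next_index t n r) < r'" if "0 \<le> r" "r < r'" for r r'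
      using grid_time_next_tendsto[OF t that(1)] that(2) by (rule order_tendstoD)
    have nok: "\<forall>\<^sub>F n in sequentially. \<not> grid_ok y t n (2 ^ n) \<omega>"
      using up_neg[OF s(1,3)] up_le[OF s(1,2)]
    proof eventually_elim
      case (elim n)
      have "next_index t n s \<le> 2 ^ n"
      proof (rule ccontr)
        assume "\<not> next_index t n s \<le> 2 ^ n"
        then have "grid_time t n (2 ^ n) \<le> grid_time t n (next_index t n s)" by (intro gt_mono) simp
        then show False using elim(2) gtt[of n] by linarith
      qed
      then show ?case using elim(1) by (auto simp: grid_ok_def not_le)
    qed
    have "(\<lambda>n. ?z (u n)) \<longlonglongrightarrow> 0"
    proof (rule first_negative_limit[OF path _ s(1,3)])
      show "0 \<le> y + X 0 \<omega>" using y by simp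
      show "\<forall>\<^sub>F n in sequentially. 0 \<le> u n \<and> y + X (u n) \<omega> < 0"
        using nok by eventually_elim (use stop_neg[OF y] grid_time_nonneg[OF t] in \<open>auto simp: u_def\<close>)
      fix r r' assume r: "0 \<le> r" "y + X r \<omega> < 0" "r < r'"
      show "\<forall>\<^sub>F n in sequentially. u n < r'"
        using nok up_neg[OF r(1,2)] up_le[OF r(1,3)]
      proof eventually_elim
        case (elim n)
        have "stop y t n (2 ^ n) \<omega> \<le> next_index t n r"
          using stop_neg[OF y elim(1)] elim(2) by (meson not_le)
        then show ?case using gt_mono[of _ _ n] elim(3) unfolding u_def by (meson le_less_trans)
      qed
    qed
    then have "(\<lambda>n. exp (- l * ?z (u n))) \<longlonglongrightarrow> exp (- l * 0)" by (intro tendsto_intros)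
    then show ?thesis using False by (simp add: u_def)
  qed
qed

end

lemma exp_difference_quotient:
  fixes a :: real
  assumes "filterlim h (at 0) F"
  shows "((\<lambda>n. (1 - exp (- a * h n)) / h n) \<longlongrightarrow> a) F"
proof -
  have "((\<lambda>x. - exp (- a * x)) has_real_derivative a) (at 0)"
    by (auto intro!: derivative_eq_intros)
  then have "((\<lambda>x. (- exp (- a * x) - - exp (- a * 0)) / (x - 0)) \<longlongrightarrow> a) (at 0)"
    unfolding has_field_derivative_iff .
  then have "((\<lambda>x. (1 - exp (- a * x)) / x) \<longlongrightarrow> a) (at 0)" by simp
  then show ?thesis using assms by (rule filterlim_compose)
qed

lemma halving_filterlim: assumes "0 < t" shows "filterlim (\<lambda>n. t / 2 ^ n :: real) (at 0) sequentially"
  unfolding filterlim_at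
proof
  have "(\<lambda>n. t * (1 / 2) ^ n) \<longlonglongrightarrow> t * 0" by (intro tendsto_intros LIMSEQ_realpow_zero) auto
  then show "(\<lambda>n. t / 2 ^ n) \<longlonglongrightarrow> 0" by (simp add: power_divide)
  show "\<forall>\<^sub>F n in sequentially. t / 2 ^ n \<in> UNIV \<and> t / 2 ^ n \<noteq> 0" using assms by simp
qed

context spectrally_positive
begin

text \<open>The transition kernel of the killed process, seen through its Laplace transform in the
  end point.\<close>

definition killed :: "real \<Rightarrow> real \<Rightarrow> real \<Rightarrow> real" where
  "killed l y s = (\<integral>\<omega>. of_bool (alive (\<lambda>s. y + X s \<omega>) s) * exp (- l * (y + X s \<omega>)) \<partial>M)"

definition dead_prob :: "real \<Rightarrow> real \<Rightarrow> real" where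
  "dead_prob y t = prob {\<omega> \<in> space M. \<not> alive (\<lambda>s. y + X s \<omega>) t}"

lemma measurable_killed [measurable]: "killed l y \<in> borel_measurable borel"
  unfolding killed_def[abs_def] by (rule borel_measurable_lebesgue_integral) measurable

lemma alive_start_nonneg: "0 \<le> y \<Longrightarrow> 0 \<le> s \<Longrightarrow> alive (\<lambda>s. y + X s \<omega>) s \<Longrightarrow> 0 \<le> y + X s \<omega>"
  using alive_nonneg[OF path, of y \<omega> s] by (cases "s = 0") simp_all

lemma killed_integrand_le_1:
  assumes "0 \<le> l" "0 \<le> y" "0 \<le> s"
  shows "of_bool (alive (\<lambda>s. y + X s \<omega>) s) * exp (- l * (y + X s \<omega>)) \<le> 1"
proof (cases "alive (\<lambda>s. y + X s \<omega>) s")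
  case True
  then have "0 \<le> l * (y + X s \<omega>)" using alive_start_nonneg[OF assms(2,3)] assms(1) by simp
  then show ?thesis using True by simp
qed simp

lemma killed_integrable:
  assumes "0 \<le> l" "0 \<le> y" "0 \<le> s"
  shows "integrable M (\<lambda>\<omega>. of_bool (alive (\<lambda>s. y + X s \<omega>) s) * exp (- l * (y + X s \<omega>)))"
proof (rule integrable_const_bound[where B=1])
  show "AE \<omega> in M. norm (of_bool (alive (\<lambda>s. y + X s \<omega>) s) * exp (- l * (y + X s \<omega>))) \<le> 1"
    using killed_integrand_le_1[OF assms] by (intro AE_I2) (simp add: abs_mult)
qed measurable

lemma killed_bounds:
  assumes "0 \<le> l" "0 \<le> y" "0 \<le> s"
  shows "0 \<le> killed l y s" "killed l y s \<le> 1"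
proof -
  show "0 \<le> killed l y s" unfolding killed_def by (rule Bochner_Integration.integral_nonneg) simp
  have "killed l y s \<le> (\<integral>\<omega>. 1 \<partial>M)"
    unfolding killed_def by (rule integral_mono[OF killed_integrable[OF assms]]) (use killed_integrand_le_1[OF assms] in auto)
  then show "killed l y s \<le> 1" by (simp add: prob_space)
qed

lemma killed_le: 
  assumes "0 \<le> l" "0 \<le> y" "0 \<le> s"
  shows "killed l y s \<le> 1 - dead_prob y s"
proof -
  have "killed l y s \<le> (\<integral>\<omega>. of_bool (alive (\<lambda>s. y + X s \<omega>) s) \<partial>M)"
    unfolding killed_def
  proof (rule integral_mono[OF killed_integrable[OF assms]])
    show "integrable M (\<lambda>\<omega>. of_bool (alive (\<lambda>s. y + X s \<omega>) s) :: real)"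
      by (rule integrable_const_bound[where B=1]) auto
    fix \<omega> show "of_bool (alive (\<lambda>s. y + X s \<omega>) s) * exp (- l * (y + X s \<omega>)) \<le> of_bool (alive (\<lambda>s. y + X s \<omega>) s)"
      using killed_integrand_le_1[OF assms, of \<omega>] by (cases "alive (\<lambda>s. y + X s \<omega>) s") simp_all
  qed
  also have "\<dots> = (\<integral>\<omega>. indicator {\<omega> \<in> space M. alive (\<lambda>s. y + X s \<omega>) s} \<omega> \<partial>M)"
    by (intro Bochner_Integration.integral_cong) (auto simp: indicator_def)
  also have "\<dots> = prob {\<omega> \<in> space M. alive (\<lambda>s. y + X s \<omega>) s}" by simp
  also have "\<dots> = 1 - dead_prob y s"
    unfolding dead_prob_def by (subst prob_neg) simp_all
  finally show ?thesis .
qed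

text \<open>Survival is tested up to index j, but the position is taken at j + 1. When j + 1 is the
  \<open>next_index\<close> of s, the tests concern times up to s and the position is read just
  after s, as right continuity demands.\<close>

definition grid_killed :: "real \<Rightarrow> real \<Rightarrow> real \<Rightarrow> nat \<Rightarrow> nat \<Rightarrow> real" where
  "grid_killed l y t n j =
    (\<integral>\<omega>. of_bool (grid_ok y t n j \<omega>) * exp (- l * (y + X (grid_time t n (Suc j)) \<omega>)) \<partial>M)"

lemma grid_killed_bounds:
  assumes t: "0 < t" and l: "0 \<le> l" and y: "0 \<le> y" and j: "j < 2 ^ n"
  shows "0 \<le> grid_killed l y t n j" "grid_killed l y t n j \<le> exp (\<bar>\<psi> l\<bar> * t)"
proof -
  show "0 \<le> grid_killed l y t n j" unfolding grid_killed_def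
    by (rule Bochner_Integration.integral_nonneg) simp
  have g: "0 \<le> grid_time t n (Suc j)" by (rule grid_time_nonneg[OF t])
  have gl: "grid_time t n (Suc j) \<le> t"
  proof -
    have "real (Suc j) \<le> real (2 ^ n)" using j by (intro of_nat_mono) (rule Suc_leI)
    then have "real (Suc j) * (t / 2 ^ n) \<le> real (2 ^ n) * (t / 2 ^ n)"
      by (rule mult_right_mono) (use t in simp)
    then show ?thesis by (simp add: grid_time_def)
  qed
  have "grid_killed l y t n j \<le> (\<integral>\<omega>. exp (- l * (y + X (grid_time t n (Suc j)) \<omega>)) \<partial>M)"
    unfolding grid_killed_def
    by (rule integral_mono[OF grid_step(1)[OF t l] laplace_start(1)[OF l g]]) simp
  also have "\<dots> = exp (- l * y + \<psi> l * grid_time t n (Suc j))" by (rule laplace_start(2)[OF l g])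
  also have "\<dots> \<le> exp (\<bar>\<psi> l\<bar> * t)"
  proof -
    have "\<psi> l * grid_time t n (Suc j) \<le> \<bar>\<psi> l\<bar> * t" using g gl by (intro mult_mono) auto
    moreover have "0 \<le> l * y" using l y by simp
    ultimately show ?thesis by simp
  qed
  finally show "grid_killed l y t n j \<le> exp (\<bar>\<psi> l\<bar> * t)" .
qed

lemma next_index_bounds:
  assumes t: "0 < t" and s: "0 \<le> s" "s < t"
  shows "next_index t n s - 1 < 2 ^ n" "Suc (next_index t n s - 1) = next_index t n s"
    "real (next_index t n s - 1) * (t / 2 ^ n) \<le> s" "s < real (next_index t n s - 1 + 1) * (t / 2 ^ n)"
proof -
  define d where "d = t / 2 ^ n"
  have d: "0 < d" using t by (simp add: d_def)
  have u: "next_index t n s - 1 = nat \<lfloor>s / d\<rfloor>" by (simp add: next_index_def d_def)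
  show "Suc (next_index t n s - 1) = next_index t n s" by (simp add: next_index_def)
  have r: "real (next_index t n s - 1) = real_of_int \<lfloor>s / d\<rfloor>" unfolding u using s d by simp
  have "real (next_index t n s - 1) \<le> s / d" unfolding r by linarith
  then have le: "real (next_index t n s - 1) * d \<le> s" using d by (simp only: pos_le_divide_eq)
  then show "real (next_index t n s - 1) * (t / 2 ^ n) \<le> s" by (simp only: d_def)
  have "s / d < real_of_int \<lfloor>s / d\<rfloor> + 1" by (rule real_of_int_floor_add_one_gt)
  then have "s / d < real (next_index t n s - 1 + 1)" unfolding of_nat_add r by (simp only: of_nat_1)
  then show "s < real (next_index t n s - 1 + 1) * (t / 2 ^ n)" using d by (simp only: pos_divide_less_eq d_def)
  have "real (next_index t n s - 1) * d < 2 ^ n * d" using le s by (simp add: d_def)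
  then have "real (next_index t n s - 1) < real (2 ^ n)" using d by simp
  then show "next_index t n s - 1 < 2 ^ n" by (simp only: of_nat_less_iff)
qed

text \<open>Turns the sum in \<open>stopped_sum\<close> into the integral of a step function, so
  that the limit of vanishing mesh can be taken by dominated convergence.\<close>

lemma grid_integral:
  assumes t: "0 < t"
  shows "(\<integral>s. indicator {0..<t} s * \<phi> (next_index t n s - 1) \<partial>lborel) = (\<Sum>j<2 ^ n. (t / 2 ^ n) * \<phi> j)"
proof -
  define d where "d = t / 2 ^ n"
  have d: "0 < d" using t by (simp add: d_def)
  have "indicator {0..<t} s * \<phi> (next_index t n s - 1) = (\<Sum>j<2 ^ n. \<phi> j * indicator {real j * d..<real (j + 1) * d} s)" for s
  proof (cases "0 \<le> s \<and> s < t")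
    case True
    let ?j = "next_index t n s - 1"
    note u = next_index_bounds[OF t, of s n, folded d_def]
    have eq: "indicator {real j * d..<real (j + 1) * d} s = (if j = ?j then 1 else 0 :: real)" for j
    proof (cases j ?j rule: linorder_cases)
      case less
      then have "real (j + 1) * d \<le> real ?j * d" using d by (intro mult_right_mono) auto
      then have "real (j + 1) * d \<le> s" using u True by linarith
      then show ?thesis using less by (simp add: indicator_def)
    next
      case equal
      then show ?thesis using u True by (simp add: indicator_def)
    next
      case greater
      then have "real (?j + 1) * d \<le> real j * d" using d by (intro mult_right_mono) auto
      then have "s < real j * d" using u True by linarith
      then show ?thesis using greater by (simp add: indicator_def)
    qed
    have "(\<Sum>j<2 ^ n. \<phi> j * indicator {real j * d..<real (j + 1) * d} s) = (\<Sum>j<2 ^ n. if j = ?j then \<phi> j else 0)"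
      unfolding eq by (intro sum.cong) auto
    also have "\<dots> = \<phi> ?j" using u(1) True by (subst sum.delta) auto
    finally show ?thesis using True by simp
  next
    case False
    have "indicator {real j * d..<real (j + 1) * d} s = (0::real)" if j: "j < 2 ^ n" for j
    proof -
      have "0 \<le> real j * d" using d by simp
      moreover have "real (j + 1) * d \<le> real (2 ^ n) * d" using j d by (intro mult_right_mono) (simp_all only: of_nat_le_iff Suc_eq_plus1[symmetric] Suc_le_eq less_imp_le)
      moreover have "real (2 ^ n) * d = t" by (simp add: d_def)
      ultimately show ?thesis using False by (auto simp: indicator_def)
    qed
    then have "(\<Sum>j<2 ^ n. \<phi> j * indicator {real j * d..<real (j + 1) * d} s) = 0"
      by (intro sum.neutral ballI) simp
    then show ?thesis using False by simp
  qed
  then have "(\<integral>s. indicator {0..<t} s * \<phi> (next_index t n s - 1) \<partial>lborel)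
    = (\<integral>s. (\<Sum>j<2 ^ n. \<phi> j * indicator {real j * d..<real (j + 1) * d} s) \<partial>lborel)" by (simp only:)
  also have "\<dots> = (\<Sum>j<2 ^ n. (\<integral>s. \<phi> j * indicator {real j * d..<real (j + 1) * d} s \<partial>lborel))"
    by (rule Bochner_Integration.integral_sum, rule integrable_mult_right, rule integrable_real_indicator)
       (use d in simp_all)
  also have "\<dots> = (\<Sum>j<2 ^ n. d * \<phi> j)"
  proof (intro sum.cong refl)
    fix j
    have "(\<integral>s. \<phi> j * indicator {real j * d..<real (j + 1) * d} s \<partial>lborel) = \<phi> j * measure lborel {real j * d..<real (j + 1) * d}"
      by simp
    also have "measure lborel {real j * d..<real (j + 1) * d} = d" using d by (simp add: algebra_simps)
    finally show "(\<integral>s. \<phi> j * indicator {real j * d..<real (j + 1) * d} s \<partial>lborel) = d * \<phi> j" by simp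
  qed
  finally show ?thesis by (simp only: d_def)
qed

text \<open>Telescopes \<open>stopped_step\<close>. By \<open>grid_step\<close> the earlier position
  contributes \<open>grid_killed\<close> times \<open>exp (- \<psi> l * h)\<close> with mesh h,
  whence the factor in front of the sum.\<close>

lemma stopped_sum:
  assumes t: "0 < t" and l: "0 \<le> l"
  shows "(\<integral>\<omega>. exp (- l * (y + X (grid_time t n (stop y t n j \<omega>)) \<omega>)) \<partial>M) =
    exp (- l * y) + (1 - exp (- \<psi> l * (t / 2 ^ n))) * (\<Sum>i<j. grid_killed l y t n i)"
proof (induction j)
  case 0
  show ?case by (simp add: grid_time_def prob_space)
next
  case (Suc j)
  let ?a = "\<integral>\<omega>. of_bool (grid_ok y t n j \<omega>) * exp (- l * (y + X (grid_time t n j) \<omega>)) \<partial>M"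
  define E where "E = exp (\<psi> l * (t / 2 ^ n))"
  have E: "exp (- \<psi> l * (t / 2 ^ n)) = 1 / E" by (simp add: E_def exp_minus divide_inverse)
  have E0: "E \<noteq> 0" by (simp add: E_def)
  have b: "grid_killed l y t n j = E * ?a" unfolding grid_killed_def E_def by (rule grid_step(2)[OF t l])
  have "(\<integral>\<omega>. exp (- l * (y + X (grid_time t n (stop y t n (Suc j) \<omega>)) \<omega>)) \<partial>M) =
     (\<integral>\<omega>. exp (- l * (y + X (grid_time t n (stop y t n j \<omega>)) \<omega>)) \<partial>M) + (grid_killed l y t n j - ?a)"
    unfolding grid_killed_def by (rule stopped_step(2)[OF t l])
  also have "grid_killed l y t n j - ?a = (1 - 1 / E) * grid_killed l y t n j"
    unfolding b using E0 by (simp add: field_simps)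
  finally show ?case unfolding Suc E by (simp add: algebra_simps)
qed

text \<open>The grid tests up to s converge to survival: a negative value before s is found on all
  fine grids, and a path alive at s is nonnegative up to and including s. The integrands are bounded
  in L2 because squaring them doubles l.\<close>

lemma grid_killed_limit:
  assumes t: "0 < t" and l: "0 \<le> l" and y: "0 \<le> y" and s: "0 \<le> s" "s < t"
  shows "(\<lambda>n. grid_killed l y t n (next_index t n s - 1)) \<longlonglongrightarrow> killed l y s"
  unfolding grid_killed_def killed_def
proof (rule tendsto_integral_L2_bounded(1))
  let ?z = "\<lambda>\<omega> s. y + X s \<omega>"
  have gt_mono: "i \<le> j \<Longrightarrow> grid_time t n i \<le> grid_time t n j" for n i j using t by (simp add: grid_time_def mult_right_mono divide_right_mono)
  have gt_before: "grid_time t n i \<le> s" if "i \<le> next_index t n s - 1" for n i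
    using gt_mono[OF that, of n] next_index_bounds(3)[OF t s, of n] by (simp add: grid_time_def)
  show "AE \<omega> in M. (\<lambda>n. of_bool (grid_ok y t n (next_index t n s - 1) \<omega>) * exp (- l * (y + X (grid_time t n (Suc (next_index t n s - 1))) \<omega>)))
    \<longlonglongrightarrow> of_bool (alive (\<lambda>s. y + X s \<omega>) s) * exp (- l * (y + X s \<omega>))"
  proof (rule AE_I2, rule tendsto_mult)
    fix \<omega>
    show "(\<lambda>n. exp (- l * (y + X (grid_time t n (Suc (next_index t n s - 1))) \<omega>))) \<longlonglongrightarrow> exp (- l * (y + X s \<omega>))"
      unfolding next_index_bounds(2)[OF t s]
      by (rule tendsto_exp[OF tendsto_mult[OF tendsto_const rc_path_next_tendsto[OF rcpath t s(1)]]])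
    show "(\<lambda>n. of_bool (grid_ok y t n (next_index t n s - 1) \<omega>) :: real) \<longlonglongrightarrow> of_bool (alive (?z \<omega>) s)"
    proof (cases "alive (?z \<omega>) s")
      case True
      have "0 \<le> ?z \<omega> r" if "0 \<le> r" "r \<le> s" for r
        using True alive_start_nonneg[OF y s(1) True] that by (cases "r = s") (auto simp: alive_def)
      then have "grid_ok y t n (next_index t n s - 1) \<omega>" for n
        unfolding grid_ok_def using gt_before grid_time_nonneg[OF t] by blast
      then show ?thesis using True by simp
    next
      case False
      then obtain r where r: "0 \<le> r" "r < s" "?z \<omega> r < 0" by (auto simp: alive_def not_le)
      have "\<forall>\<^sub>F n in sequentially. ?z \<omega> (grid_time t n (next_index t n r)) < 0"
        by (rule order_tendstoD(2)[OF rc_path_next_tendsto[OF rcpath t r(1)] r(3)])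
      moreover have "\<forall>\<^sub>F n in sequentially. grid_time t n (next_index t n r) < s"
        by (rule order_tendstoD(2)[OF grid_time_next_tendsto[OF t r(1)] r(2)])
      ultimately have "\<forall>\<^sub>F n in sequentially. of_bool (grid_ok y t n (next_index t n s - 1) \<omega>) = (0::real)"
      proof eventually_elim
        case (elim n)
        have "next_index t n r \<le> next_index t n s - 1"
        proof (rule ccontr)
          assume "\<not> next_index t n r \<le> next_index t n s - 1"
          then have "next_index t n s \<le> next_index t n r" by simp
          then have "grid_time t n (next_index t n s) \<le> grid_time t n (next_index t n r)" by (rule gt_mono)
          then show False using grid_time_next(1)[OF t s(1), of n] elim(2) by linarith
        qed
        then have "\<not> grid_ok y t n (next_index t n s - 1) \<omega>" using elim(1) unfolding grid_ok_def by (meson not_le)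
        then show ?case by simp
      qed
      then show ?thesis using False by (simp add: tendsto_eventually)
    qed
  qed
  fix n
  have g: "0 \<le> grid_time t n (Suc (next_index t n s - 1))" by (rule grid_time_nonneg[OF t])
  have l2: "0 \<le> 2 * l" using l by simp
  have "(\<integral>\<^sup>+\<omega>. ennreal ((of_bool (grid_ok y t n (next_index t n s - 1) \<omega>) * exp (- l * (y + X (grid_time t n (Suc (next_index t n s - 1))) \<omega>)))\<^sup>2) \<partial>M)
    = (\<integral>\<^sup>+\<omega>. ennreal (of_bool (grid_ok y t n (next_index t n s - 1) \<omega>) * exp (- (2 * l) * (y + X (grid_time t n (Suc (next_index t n s - 1))) \<omega>))) \<partial>M)"
  proof (rule nn_integral_cong, rule arg_cong[where f=ennreal])
    fix \<omega>
    have e: "(exp u)\<^sup>2 = exp (2 * u)" for u :: real by (simp add: power2_eq_square mult_exp_exp)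
    show "(of_bool (grid_ok y t n (next_index t n s - 1) \<omega>) * exp (- l * (y + X (grid_time t n (Suc (next_index t n s - 1))) \<omega>)))\<^sup>2
      = of_bool (grid_ok y t n (next_index t n s - 1) \<omega>) * exp (- (2 * l) * (y + X (grid_time t n (Suc (next_index t n s - 1))) \<omega>))"
      unfolding power_mult_distrib e by (cases "grid_ok y t n (next_index t n s - 1) \<omega>") simp_all
  qed
  also have "\<dots> = ennreal (grid_killed (2 * l) y t n (next_index t n s - 1))"
    unfolding grid_killed_def by (rule nn_integral_eq_integral[OF grid_step(1)[OF t l2]]) simp
  also have "\<dots> \<le> ennreal (exp (\<bar>\<psi> (2 * l)\<bar> * t))"
    by (rule ennreal_leI, rule grid_killed_bounds(2)[OF t l2 y next_index_bounds(1)[OF t s]])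
  finally show "(\<integral>\<^sup>+\<omega>. ennreal ((of_bool (grid_ok y t n (next_index t n s - 1) \<omega>) * exp (- l * (y + X (grid_time t n (Suc (next_index t n s - 1))) \<omega>)))\<^sup>2) \<partial>M)
     \<le> ennreal (exp (\<bar>\<psi> (2 * l)\<bar> * t))" .
qed measurable

text \<open>Dynkin's formula for exp (- l z) up to the first passage below 0. The exponential equals
  1 there, hence the bare probability of death on the left.\<close>

theorem stopped_identity:
  assumes t: "0 < t" and l: "0 \<le> l" and y: "0 \<le> y"
  shows "dead_prob y t + killed l y t =
    exp (- l * y) + \<psi> l * (\<integral>s. indicator {0..<t} s * killed l y s \<partial>lborel)"
proof -
  let ?S = "\<lambda>n. \<integral>\<omega>. exp (- l * (y + X (grid_time t n (stop y t n (2 ^ n) \<omega>)) \<omega>)) \<partial>M"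
  let ?I = "\<lambda>n. \<integral>s. indicator {0..<t} s * grid_killed l y t n (next_index t n s - 1) \<partial>lborel"
  have l2: "0 \<le> 2 * l" using l by simp
  have m: "(\<lambda>\<omega>. X (grid_time t n (stop y t n j \<omega>)) \<omega>) \<in> borel_measurable M" for n j
    by (rule measurable_compose_countable[OF meas_X measurable_stop])
  have lim1: "?S \<longlonglongrightarrow> (\<integral>\<omega>. (if alive (\<lambda>s. y + X s \<omega>) t then exp (- l * (y + X t \<omega>)) else 1) \<partial>M)"
  proof (rule tendsto_integral_L2_bounded(1))
    show "AE \<omega> in M. (\<lambda>n. exp (- l * (y + X (grid_time t n (stop y t n (2 ^ n) \<omega>)) \<omega>)))
      \<longlonglongrightarrow> (if alive (\<lambda>s. y + X s \<omega>) t then exp (- l * (y + X t \<omega>)) else 1)"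
      by (rule AE_I2) (rule stopped_limit[OF t y])
    show "(\<lambda>\<omega>. exp (- l * (y + X (grid_time t n (stop y t n (2 ^ n) \<omega>)) \<omega>))) \<in> borel_measurable M" for n
      using m by measurable
    fix n
    have e: "(exp (- l * u))\<^sup>2 = exp (- (2 * l) * u)" for u :: real by (simp add: power2_eq_square mult_exp_exp)
    have "(\<integral>\<^sup>+\<omega>. ennreal ((exp (- l * (y + X (grid_time t n (stop y t n (2 ^ n) \<omega>)) \<omega>)))\<^sup>2) \<partial>M)
      = ennreal (\<integral>\<omega>. exp (- (2 * l) * (y + X (grid_time t n (stop y t n (2 ^ n) \<omega>)) \<omega>)) \<partial>M)"
      unfolding e by (rule nn_integral_eq_integral[OF stopped_step(1)[OF t l2]]) simp
    also have "\<dots> \<le> ennreal (exp (\<bar>\<psi> (2 * l)\<bar> * t))"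
      by (rule ennreal_leI, rule stopped_bound[OF t l2 y]) simp
    finally show "(\<integral>\<^sup>+\<omega>. ennreal ((exp (- l * (y + X (grid_time t n (stop y t n (2 ^ n) \<omega>)) \<omega>)))\<^sup>2) \<partial>M)
       \<le> ennreal (exp (\<bar>\<psi> (2 * l)\<bar> * t))" .
  qed measurable
  have lim2: "?I \<longlonglongrightarrow> (\<integral>s. indicator {0..<t} s * killed l y s \<partial>lborel)"
  proof (rule integral_dominated_convergence[where w="\<lambda>s. exp (\<bar>\<psi> l\<bar> * t) * indicator {0..<t} s"])
    show "integrable lborel (\<lambda>s. exp (\<bar>\<psi> l\<bar> * t) * indicator {0..<t} s :: real)"
      by (rule integrable_mult_right, rule integrable_real_indicator) (use t in simp_all)
    show "AE s in lborel. (\<lambda>n. indicator {0..<t} s * grid_killed l y t n (next_index t n s - 1)) \<longlonglongrightarrow> indicator {0..<t} s * killed l y s"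
    proof (rule AE_I2)
      fix s show "(\<lambda>n. indicator {0..<t} s * grid_killed l y t n (next_index t n s - 1)) \<longlonglongrightarrow> indicator {0..<t} s * killed l y s"
        using grid_killed_limit[OF t l y, of s] by (cases "s \<in> {0..<t}") simp_all
    qed
    fix n
    show "(\<lambda>s. indicator {0..<t} s * grid_killed l y t n (next_index t n s - 1)) \<in> borel_measurable lborel"
    proof -
      have "(\<lambda>s. grid_killed l y t n (next_index t n s - 1)) \<in> borel_measurable borel"
        by (rule measurable_compose[OF measurable_next_index, of "\<lambda>i. grid_killed l y t n (i - 1)"]) simp
      then show ?thesis by measurable
    qed
    show "AE s in lborel. norm (indicator {0..<t} s * grid_killed l y t n (next_index t n s - 1)) \<le> exp (\<bar>\<psi> l\<bar> * t) * indicator {0..<t} s"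
    proof (rule AE_I2)
      fix s
      show "norm (indicator {0..<t} s * grid_killed l y t n (next_index t n s - 1)) \<le> exp (\<bar>\<psi> l\<bar> * t) * indicator {0..<t} s"
      proof (cases "s \<in> {0..<t}")
        case True
        then have "next_index t n s - 1 < 2 ^ n" by (intro next_index_bounds(1)[OF t]) auto
        then show ?thesis using grid_killed_bounds[OF t l y] True by simp
      qed simp
    qed
  qed measurable
  \<comment> \<open>Divided by the mesh, the factor in \<open>stopped_sum\<close> is a difference
    quotient tending to \<open>\<psi> l\<close>, while the sum multiplied by the mesh becomes the
    integral.\<close>
  have S: "?S n = exp (- l * y) + ((1 - exp (- \<psi> l * (t / 2 ^ n))) / (t / 2 ^ n)) * ?I n" for n
  proof -
    have "(1 - exp (- \<psi> l * (t / 2 ^ n))) * (\<Sum>i<2^n. grid_killed l y t n i)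
       = ((1 - exp (- \<psi> l * (t / 2 ^ n))) / (t / 2 ^ n)) * (\<Sum>i<2^n. (t / 2 ^ n) * grid_killed l y t n i)"
      unfolding sum_distrib_left[symmetric] using t by simp
    then show ?thesis unfolding stopped_sum[OF t l] grid_integral[OF t] by (simp only:)
  qed
  have "?S \<longlonglongrightarrow> exp (- l * y) + \<psi> l * (\<integral>s. indicator {0..<t} s * killed l y s \<partial>lborel)"
    unfolding S by (intro tendsto_add tendsto_const tendsto_mult lim2 exp_difference_quotient halving_filterlim t)
  then have "(\<integral>\<omega>. (if alive (\<lambda>s. y + X s \<omega>) t then exp (- l * (y + X t \<omega>)) else 1) \<partial>M)
    = exp (- l * y) + \<psi> l * (\<integral>s. indicator {0..<t} s * killed l y s \<partial>lborel)"
    using lim1 by (rule LIMSEQ_unique[rotated])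
  moreover have "(\<integral>\<omega>. (if alive (\<lambda>s. y + X s \<omega>) t then exp (- l * (y + X t \<omega>)) else 1) \<partial>M)
    = (\<integral>\<omega>. indicator {\<omega> \<in> space M. \<not> alive (\<lambda>s. y + X s \<omega>) t} \<omega>
        + of_bool (alive (\<lambda>s. y + X s \<omega>) t) * exp (- l * (y + X t \<omega>)) \<partial>M)"
    by (intro Bochner_Integration.integral_cong) (auto simp: indicator_def)
  moreover have "\<dots> = dead_prob y t + killed l y t"
  proof -
    have "integrable M (indicator {\<omega> \<in> space M. \<not> alive (\<lambda>s. y + X s \<omega>) t} :: 'a \<Rightarrow> real)"
      by (rule integrable_const_bound[where B=1]) (auto simp: indicator_def)
    from Bochner_Integration.integral_add[OF this killed_integrable[OF l y less_imp_le[OF t]]]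
    show ?thesis unfolding dead_prob_def killed_def by simp
  qed
  ultimately show ?thesis by simp
qed

end

section \<open>Probability of dying and the potential measure\<close>

context spectrally_positive
begin

lemma dead_prob_lim: "(\<lambda>n. dead_prob y (real n)) \<longlonglongrightarrow> prob {\<omega> \<in> space M. dies (\<lambda>s. y + X s \<omega>)}"
proof -
  let ?A = "\<lambda>n. {\<omega> \<in> space M. \<not> alive (\<lambda>s. y + X s \<omega>) (real n)}"
  have "(\<lambda>n. prob (?A n)) \<longlonglongrightarrow> prob (\<Union>n. ?A n)"
  proof (rule finite_Lim_measure_incseq)
    show "range ?A \<subseteq> events" by auto
    have "\<not> alive z (real n)" if "\<not> alive z (real m)" "m \<le> n" for m n z
      using that alive_mono[of z "real n" "real m"] by auto
    then show "incseq ?A" by (intro monoI subsetI) blast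
  qed
  moreover have "(\<Union>n. ?A n) = {\<omega> \<in> space M. dies (\<lambda>s. y + X s \<omega>)}"
    by (auto simp: dies_def)
  ultimately show ?thesis by (simp add: dead_prob_def)
qed

lemma dead_prob_mono: "s \<le> t \<Longrightarrow> dead_prob y s \<le> dead_prob y t"
proof -
  assume st: "s \<le> t"
  show ?thesis unfolding dead_prob_def
  proof (rule finite_measure_mono)
    show "{\<omega> \<in> space M. \<not> alive (\<lambda>s. y + X s \<omega>) s} \<subseteq> {\<omega> \<in> space M. \<not> alive (\<lambda>s. y + X s \<omega>) t}"
      using alive_mono st by blast
  qed measurable
qed

lemma killed_set_integrable:
  assumes "0 \<le> l" "0 \<le> y" "0 \<le> a"
  shows "integrable lborel (\<lambda>s. indicator {a..<b} s * killed l y s)"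
proof (rule Bochner_Integration.integrable_bound[where f="indicator {a..<b} :: real \<Rightarrow> real"])
  show "integrable lborel (indicator {a..<b} :: real \<Rightarrow> real)"
    by (cases "a \<le> b") (simp_all add: integrable_real_indicator)
  show "AE s in lborel. norm (indicator {a..<b} s * killed l y s) \<le> norm (indicator {a..<b} s :: real)"
  proof (rule AE_I2)
    fix s show "norm (indicator {a..<b} s * killed l y s) \<le> norm (indicator {a..<b} s :: real)"
      using killed_bounds[OF assms(1,2), of s] assms(3) by (cases "s \<in> {a..<b}") simp_all
  qed
qed measurable

lemma killed_integral_bounds:
  assumes l: "0 \<le> l" and y: "0 \<le> y"
  shows "0 \<le> (\<integral>s. indicator {0..<t} s * killed l y s \<partial>lborel)"
proof (rule Bochner_Integration.integral_nonneg)
  fix s show "0 \<le> indicator {0..<t} s * killed l y s"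
    using killed_bounds(1)[OF l y, of s] by (cases "s \<in> {0..<t}") simp_all
qed

lemma dead_prob_upper:
  assumes y: "0 \<le> y" and t: "0 < t"
  shows "dead_prob y t \<le> exp (- p * y)"
proof (cases "p = 0")
  case True
  then show ?thesis by (simp add: dead_prob_def)
next
  case False
  then have p: "0 < p" using p_nonneg by simp
  have le: "dead_prob y t \<le> exp (- l * y)" if l: "0 < l" "l < p" for l
  proof -
    have l0: "0 \<le> l" using l by simp
    have "\<psi> l * (\<integral>s. indicator {0..<t} s * killed l y s \<partial>lborel) \<le> 0"
      using psi_nonpos[OF l] killed_integral_bounds[OF l0 y] by (rule mult_nonpos_nonneg)
    then show ?thesis
      using stopped_identity[OF t l0 y] killed_bounds(1)[OF l0 y less_imp_le[OF t]] by linarith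
  qed
  have "((\<lambda>l. exp (- l * y)) \<longlongrightarrow> exp (- p * y)) (at_left p)" by (intro tendsto_intros)
  moreover have "\<forall>\<^sub>F l in at_left p. dead_prob y t \<le> exp (- l * y)"
    using eventually_at_left_real[OF p] by eventually_elim (rule le; simp)
  ultimately show ?thesis by (intro tendsto_lowerbound) auto
qed

lemma dead_killed_identity:
  assumes "p < l" and y: "0 \<le> y" and t: "0 < t"
  shows "(\<integral>s. indicator {0..<t} s * killed l y s \<partial>lborel) = (dead_prob y t + killed l y t - exp (- l * y)) / \<psi> l"
proof -
  have l: "0 \<le> l" using assms(1) p_nonneg by simp
  show ?thesis using stopped_identity[OF t l y] psi_pos[OF assms(1)] by (simp add: field_simps)
qed

text \<open>By the stopped identity, \<open>killed\<close> can only decrease on \<open>[n, n + 1)\<close> by the increase of \<open>dead_prob\<close>,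
  so \<open>killed\<close> at \<open>n\<close> is bounded by increments of two convergent sequences.\<close>

lemma killed_tendsto_0:
  assumes pl: "p < l" and y: "0 \<le> y"
  shows "(\<lambda>n. killed l y (real n)) \<longlonglongrightarrow> 0"
proof -
  have l: "0 \<le> l" using pl p_nonneg by simp
  define I where "I n = (\<integral>s. indicator {0..<real n} s * killed l y s \<partial>lborel)" for n
  have I_diff: "I (Suc n) - I n = (\<integral>s. indicator {real n..<real (Suc n)} s * killed l y s \<partial>lborel)" for n
  proof -
    have "I (Suc n) - I n = (\<integral>s. indicator {0..<real (Suc n)} s * killed l y s - indicator {0..<real n} s * killed l y s \<partial>lborel)"
      unfolding I_def by (rule Bochner_Integration.integral_diff[symmetric]) (intro killed_set_integrable l y order_refl)+
    also have "\<dots> = (\<integral>s. indicator {real n..<real (Suc n)} s * killed l y s \<partial>lborel)"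
      by (intro Bochner_Integration.integral_cong refl) (auto simp: indicator_def)
    finally show ?thesis .
  qed
  have I_mono: "I n \<le> I (Suc n)" for n
  proof -
    have "0 \<le> (\<integral>s. indicator {real n..<real (Suc n)} s * killed l y s \<partial>lborel)"
    proof (rule Bochner_Integration.integral_nonneg)
      fix s show "0 \<le> indicator {real n..<real (Suc n)} s * killed l y s"
        using killed_bounds(1)[OF l y, of s] by (cases "s \<in> {real n..<real (Suc n)}") simp_all
    qed
    then show ?thesis using I_diff[of n] by simp
  qed
  have I_bound: "I n \<le> 1 / \<psi> l" if "0 < n" for n
  proof -
    have "dead_prob y (real n) + killed l y (real n) - exp (- l * y) \<le> 1"
      using killed_le[OF l y, of "real n"] exp_ge_zero[of "- l * y"] by linarith
    then show ?thesis unfolding I_def dead_killed_identity[OF pl y of_nat_0_less_iff[THEN iffD2, OF that]]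
      using psi_pos[OF pl] by (intro divide_right_mono) auto
  qed
  have "incseq I" using I_mono by (rule incseq_SucI)
  moreover have "\<forall>n. I n \<le> 1 / \<psi> l"
  proof
    fix n show "I n \<le> 1 / \<psi> l" using I_bound[of "Suc n"] I_mono[of n] by simp
  qed
  ultimately obtain L where L: "I \<longlonglongrightarrow> L" by (rule incseq_convergent)
  have d: "(\<lambda>n. (I (Suc n) - I n) + (dead_prob y (real (Suc n)) - dead_prob y (real n))) \<longlonglongrightarrow> (L - L) +
      (prob {\<omega> \<in> space M. dies (\<lambda>s. y + X s \<omega>)} - prob {\<omega> \<in> space M. dies (\<lambda>s. y + X s \<omega>)})"
    using L dead_prob_lim[of y] by (intro tendsto_intros LIMSEQ_Suc[of I] LIMSEQ_Suc[of "\<lambda>n. dead_prob y (real n)"])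
  have le: "killed l y (real n) \<le> (I (Suc n) - I n) + (dead_prob y (real (Suc n)) - dead_prob y (real n))" if n: "0 < n" for n
  proof -
    let ?c = "killed l y (real n) - (dead_prob y (real (Suc n)) - dead_prob y (real n))"
    \<comment> \<open>The integral of \<open>killed\<close> grows with its upper limit, so by the
      identity the sum of \<open>dead_prob\<close> and \<open>killed\<close> is nondecreasing in
      time.\<close>
    have ge: "?c \<le> killed l y s" if s: "real n \<le> s" "s < real (Suc n)" for s
    proof -
      have n0: "0 < real n" using n by simp
      have s0: "0 < s" using n0 s by linarith
      have "(\<integral>s. indicator {0..<real n} s * killed l y s \<partial>lborel) \<le> (\<integral>r. indicator {0..<s} r * killed l y r \<partial>lborel)"
      proof (rule integral_mono)
        fix r show "indicator {0..<real n} r * killed l y r \<le> indicator {0..<s} r * killed l y r"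
          using killed_bounds(1)[OF l y, of r] s by (cases "0 \<le> r") (auto simp: indicator_def)
      qed (intro killed_set_integrable l y order_refl)+
      then have "dead_prob y (real n) + killed l y (real n) \<le> dead_prob y s + killed l y s"
        unfolding dead_killed_identity[OF pl y n0] dead_killed_identity[OF pl y s0]
        using psi_pos[OF pl] by (simp add: divide_le_cancel)
      moreover have "dead_prob y s \<le> dead_prob y (real (Suc n))" using s by (intro dead_prob_mono) simp
      ultimately show ?thesis by simp
    qed
    have "?c = (\<integral>s. ?c * indicator {real n..<real (Suc n)} s \<partial>lborel)" by simp
    also have "\<dots> \<le> (\<integral>s. indicator {real n..<real (Suc n)} s * killed l y s \<partial>lborel)"
    proof (rule integral_mono)
      show "integrable lborel (\<lambda>s. ?c * indicator {real n..<real (Suc n)} s)"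
        by (rule integrable_mult_right, rule integrable_real_indicator) simp_all
      show "integrable lborel (\<lambda>s. indicator {real n..<real (Suc n)} s * killed l y s)"
        by (intro killed_set_integrable l y) simp
      fix s show "?c * indicator {real n..<real (Suc n)} s \<le> indicator {real n..<real (Suc n)} s * killed l y s"
        using ge[of s] by (cases "s \<in> {real n..<real (Suc n)}") simp_all
    qed
    finally show ?thesis using I_diff[of n] by simp
  qed
  show ?thesis
  proof (rule tendsto_sandwich)
    show "\<forall>\<^sub>F n in sequentially. 0 \<le> killed l y (real n)"
      by (intro always_eventually allI killed_bounds l y) simp
    show "\<forall>\<^sub>F n in sequentially. killed l y (real n) \<le> (I (Suc n) - I n) + (dead_prob y (real (Suc n)) - dead_prob y (real n))"
      using eventually_gt_at_top[of 0] by eventually_elim (rule le)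
    show "(\<lambda>n::nat. 0::real) \<longlonglongrightarrow> 0" by simp
    show "(\<lambda>n. (I (Suc n) - I n) + (dead_prob y (real (Suc n)) - dead_prob y (real n))) \<longlonglongrightarrow> 0" using d by simp
  qed
qed

text \<open>For l above p the integral in \<open>stopped_identity\<close> enters with a positive
  sign and \<open>killed\<close> disappears in the long run, which gives the lower bound exp (- l
  y). As l decreases to p it meets the upper bound obtained from below p.\<close>

theorem prob_dies:
  assumes y: "0 \<le> y"
  shows "prob {\<omega> \<in> space M. dies (\<lambda>s. y + X s \<omega>)} = exp (- p * y)"
proof (rule antisym)
  let ?P = "prob {\<omega> \<in> space M. dies (\<lambda>s. y + X s \<omega>)}"
  show "?P \<le> exp (- p * y)"
  proof (rule tendsto_upperbound[OF dead_prob_lim])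
    show "\<forall>\<^sub>F n in sequentially. dead_prob y (real n) \<le> exp (- p * y)"
      using eventually_gt_at_top[of 0] by eventually_elim (intro dead_prob_upper y, simp)
  qed simp
  have le: "exp (- l * y) \<le> ?P" if pl: "p < l" for l
  proof -
    have l: "0 \<le> l" using pl p_nonneg by simp
    have "(\<lambda>n. dead_prob y (real n) + killed l y (real n)) \<longlonglongrightarrow> ?P + 0"
      by (intro tendsto_add dead_prob_lim killed_tendsto_0 pl y)
    moreover have "\<forall>\<^sub>F n in sequentially. exp (- l * y) \<le> dead_prob y (real n) + killed l y (real n)"
      using eventually_gt_at_top[of 0]
    proof eventually_elim
      case (elim n)
      then have "0 < real n" by simp
      from stopped_identity[OF this l y] psi_pos[OF pl] killed_integral_bounds[OF l y, of "real n"]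
      show ?case by simp
    qed
    ultimately show ?thesis by (intro tendsto_lowerbound[where f="\<lambda>n. dead_prob y (real n) + killed l y (real n)" and F=sequentially]) auto
  qed
  have "((\<lambda>l. exp (- l * y)) \<longlongrightarrow> exp (- p * y)) (at_right p)" by (intro tendsto_intros)
  moreover have "\<forall>\<^sub>F l in at_right p. exp (- l * y) \<le> ?P"
    using eventually_at_right_less[of p] by eventually_elim (rule le)
  ultimately show "exp (- p * y) \<le> ?P" by (intro tendsto_upperbound) auto
qed

text \<open>As time tends to infinity in \<open>dead_killed_identity\<close>,
  \<open>dead_prob\<close> tends to exp (- p y) and \<open>killed\<close> to 0.\<close>

lemma killed_integral_lim:
  assumes pl: "p < l" and y: "0 \<le> y"
  shows "(\<integral>\<^sup>+s. ennreal (indicator {0..} s * killed l y s) \<partial>lborel) = ennreal ((exp (- p * y) - exp (- l * y)) / \<psi> l)"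
proof -
  have l: "0 \<le> l" using pl p_nonneg by simp
  define I where "I n = (\<integral>s. indicator {0..<real n} s * killed l y s \<partial>lborel)" for n
  have nn: "0 \<le> indicator {0..<real n} s * killed l y s" for n s
    using killed_bounds(1)[OF l y, of s] by (cases "s \<in> {0..<real n}") simp_all
  have "(\<integral>\<^sup>+s. ennreal (indicator {0..} s * killed l y s) \<partial>lborel)
    = (\<integral>\<^sup>+s. (SUP n. ennreal (indicator {0..<real n} s * killed l y s)) \<partial>lborel)"
  proof (intro nn_integral_cong antisym)
    fix s :: real
    obtain m :: nat where m: "s < real m" using reals_Archimedean2 by blast
    have "ennreal (indicator {0..} s * killed l y s) \<le> ennreal (indicator {0..<real m} s * killed l y s)"
      using m by (simp add: indicator_def)
    then show "ennreal (indicator {0..} s * killed l y s) \<le> (SUP n. ennreal (indicator {0..<real n} s * killed l y s))"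
      by (rule SUP_upper2[OF UNIV_I])
    show "(SUP n. ennreal (indicator {0..<real n} s * killed l y s)) \<le> ennreal (indicator {0..} s * killed l y s)"
      using killed_bounds(1)[OF l y, of s] by (intro SUP_least ennreal_leI) (simp add: indicator_def)
  qed
  also have "\<dots> = (SUP n. \<integral>\<^sup>+s. ennreal (indicator {0..<real n} s * killed l y s) \<partial>lborel)"
  proof (rule nn_integral_monotone_convergence_SUP)
    show "incseq (\<lambda>n s. ennreal (indicator {0..<real n} s * killed l y s))"
    proof (intro incseq_SucI le_funI ennreal_leI)
      fix n s show "indicator {0..<real n} s * killed l y s \<le> indicator {0..<real (Suc n)} s * killed l y s"
        using killed_bounds(1)[OF l y, of s] by (simp add: indicator_def)
    qed
  qed measurable
  also have "\<dots> = (SUP n. ennreal (I n))"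
    unfolding I_def by (intro SUP_cong refl nn_integral_eq_integral killed_set_integrable l y AE_I2 nn) simp
  also have "\<dots> = ennreal ((exp (- p * y) - exp (- l * y)) / \<psi> l)"
  proof (rule LIMSEQ_unique)
    show "(\<lambda>n. ennreal (I n)) \<longlonglongrightarrow> (SUP n. ennreal (I n))"
    proof (rule LIMSEQ_SUP, intro incseq_SucI ennreal_leI)
      fix n show "I n \<le> I (Suc n)" unfolding I_def
      proof (rule integral_mono)
        fix s show "indicator {0..<real n} s * killed l y s \<le> indicator {0..<real (Suc n)} s * killed l y s"
          using killed_bounds(1)[OF l y, of s] by (simp add: indicator_def)
      qed (intro killed_set_integrable l y order_refl)+
    qed
    have "(\<lambda>n. (dead_prob y (real n) + killed l y (real n) - exp (- l * y)) / \<psi> l) \<longlonglongrightarrow> (exp (- p * y) + 0 - exp (- l * y)) / \<psi> l"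
      using psi_pos[OF pl] dead_prob_lim[of y] unfolding prob_dies[OF y]
      by (intro tendsto_divide tendsto_diff tendsto_add killed_tendsto_0 pl y tendsto_const) auto
    moreover have "\<forall>\<^sub>F n in sequentially. (dead_prob y (real n) + killed l y (real n) - exp (- l * y)) / \<psi> l = I n"
      using eventually_gt_at_top[of 0]
    proof eventually_elim
      case (elim n)
      then have "0 < real n" by simp
      from dead_killed_identity[OF pl y this] show ?case by (simp add: I_def)
    qed
    ultimately have "I \<longlonglongrightarrow> (exp (- p * y) - exp (- l * y)) / \<psi> l" by (simp add: tendsto_cong)
    then show "(\<lambda>n. ennreal (I n)) \<longlonglongrightarrow> ennreal ((exp (- p * y) - exp (- l * y)) / \<psi> l)" by (rule tendsto_ennrealI)
  qed
  finally show ?thesis .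
qed

text \<open>The Green measure of the killed process. Being the image of a density on the product of
  time and sample space, it can be integrated in either order.\<close>

definition potential :: "real \<Rightarrow> real measure" where
  "potential y = distr (density (lborel \<Otimes>\<^sub>M M) (\<lambda>(t, \<omega>). of_bool (0 \<le> t \<and> alive (\<lambda>s. y + X s \<omega>) t)))
     borel (\<lambda>(t, \<omega>). y + X t \<omega>)"

lemma sets_potential [simp, measurable_cong]: "sets (potential y) = sets borel"
  by (simp add: potential_def)

lemma space_potential [simp]: "space (potential y) = UNIV"
  by (simp add: potential_def)

lemma nn_integral_potential:
  assumes [measurable]: "g \<in> borel_measurable borel"
  shows "(\<integral>\<^sup>+u. g u \<partial>potential y) =
      (\<integral>\<^sup>+t. (\<integral>\<^sup>+\<omega>. (if 0 \<le> t \<and> alive (\<lambda>s. y + X s \<omega>) t then g (y + X t \<omega>) else 0) \<partial>M) \<partial>lborel)"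
    "(\<integral>\<^sup>+u. g u \<partial>potential y) = (\<integral>\<^sup>+\<omega>. occ g (\<lambda>s. y + X s \<omega>) \<partial>M)"
proof -
  interpret P: pair_sigma_finite lborel M ..
  let ?h = "\<lambda>w. (if 0 \<le> fst w \<and> alive (\<lambda>s. y + X s (snd w)) (fst w) then g (y + X (fst w) (snd w)) else 0)"
  have h [measurable]: "?h \<in> borel_measurable (lborel \<Otimes>\<^sub>M M)" by measurable
  have m1: "(\<lambda>(t, \<omega>). y + X t \<omega>) \<in> measurable (density (lborel \<Otimes>\<^sub>M M) (\<lambda>(t, \<omega>). of_bool (0 \<le> t \<and> alive (\<lambda>s. y + X s \<omega>) t))) borel"
    by measurable
  have "(\<integral>\<^sup>+u. g u \<partial>potential y) = (\<integral>\<^sup>+w. g ((\<lambda>(t, \<omega>). y + X t \<omega>) w) \<partial>density (lborel \<Otimes>\<^sub>M M) (\<lambda>(t, \<omega>). of_bool (0 \<le> t \<and> alive (\<lambda>s. y + X s \<omega>) t)))"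
    unfolding potential_def by (rule nn_integral_distr[OF m1]) simp
  also have "\<dots> = (\<integral>\<^sup>+w. (\<lambda>(t, \<omega>). of_bool (0 \<le> t \<and> alive (\<lambda>s. y + X s \<omega>) t)) w * g ((\<lambda>(t, \<omega>). y + X t \<omega>) w) \<partial>(lborel \<Otimes>\<^sub>M M))"
    by (rule nn_integral_density) measurable
  also have "\<dots> = (\<integral>\<^sup>+w. ?h w \<partial>(lborel \<Otimes>\<^sub>M M))"
    by (intro nn_integral_cong) (simp add: split_beta')
  finally have e: "(\<integral>\<^sup>+u. g u \<partial>potential y) = (\<integral>\<^sup>+w. ?h w \<partial>(lborel \<Otimes>\<^sub>M M))" .
  show "(\<integral>\<^sup>+u. g u \<partial>potential y) =
      (\<integral>\<^sup>+t. (\<integral>\<^sup>+\<omega>. (if 0 \<le> t \<and> alive (\<lambda>s. y + X s \<omega>) t then g (y + X t \<omega>) else 0) \<partial>M) \<partial>lborel)"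
    unfolding e nn_integral_fst[OF h, symmetric] by (simp only: fst_conv snd_conv)
  show "(\<integral>\<^sup>+u. g u \<partial>potential y) = (\<integral>\<^sup>+\<omega>. occ g (\<lambda>s. y + X s \<omega>) \<partial>M)"
    unfolding e P.nn_integral_snd[OF h, symmetric] occ_def by (simp only: fst_conv snd_conv)
qed

theorem potential_laplace:
  assumes pl: "p < l" and y: "0 \<le> y"
  shows "(\<integral>\<^sup>+u. ennreal (exp (- l * u)) \<partial>potential y) = ennreal ((exp (- p * y) - exp (- l * y)) / \<psi> l)"
proof -
  have l: "0 \<le> l" using pl p_nonneg by simp
  have "(\<integral>\<^sup>+u. ennreal (exp (- l * u)) \<partial>potential y) =
      (\<integral>\<^sup>+t. (\<integral>\<^sup>+\<omega>. (if 0 \<le> t \<and> alive (\<lambda>s. y + X s \<omega>) t then ennreal (exp (- l * (y + X t \<omega>))) else 0) \<partial>M) \<partial>lborel)"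
    by (rule nn_integral_potential(1)) measurable
  also have "\<dots> = (\<integral>\<^sup>+s. ennreal (indicator {0..} s * killed l y s) \<partial>lborel)"
  proof (rule nn_integral_cong)
    fix t
    show "(\<integral>\<^sup>+\<omega>. (if 0 \<le> t \<and> alive (\<lambda>s. y + X s \<omega>) t then ennreal (exp (- l * (y + X t \<omega>))) else 0) \<partial>M)
      = ennreal (indicator {0..} t * killed l y t)"
    proof (cases "0 \<le> t")
      case True
      have "(\<integral>\<^sup>+\<omega>. (if 0 \<le> t \<and> alive (\<lambda>s. y + X s \<omega>) t then ennreal (exp (- l * (y + X t \<omega>))) else 0) \<partial>M)
        = (\<integral>\<^sup>+\<omega>. ennreal (of_bool (alive (\<lambda>s. y + X s \<omega>) t) * exp (- l * (y + X t \<omega>))) \<partial>M)"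
        using True by (intro nn_integral_cong) simp
      also have "\<dots> = ennreal (killed l y t)"
        unfolding killed_def by (rule nn_integral_eq_integral[OF killed_integrable[OF l y True]]) simp
      finally show ?thesis using True by simp
    qed simp
  qed
  also have "\<dots> = ennreal ((exp (- p * y) - exp (- l * y)) / \<psi> l)" by (rule killed_integral_lim[OF pl y])
  finally show ?thesis .
qed

lemma potential_nonneg:
  assumes y: "0 \<le> y"
  shows "AE u in potential y. 0 \<le> u"
proof -
  have "(\<integral>\<^sup>+u. of_bool (u < 0) \<partial>potential y) =
    (\<integral>\<^sup>+t. (\<integral>\<^sup>+\<omega>. (if 0 \<le> t \<and> alive (\<lambda>s. y + X s \<omega>) t then of_bool (y + X t \<omega> < 0) else 0) \<partial>M) \<partial>lborel)"
    by (rule nn_integral_potential(1)) measurable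
  also have "\<dots> = (\<integral>\<^sup>+t. (\<integral>\<^sup>+\<omega>. 0 \<partial>M) \<partial>(lborel :: real measure))"
  proof (intro nn_integral_cong)
    fix t \<omega>
    show "(if 0 \<le> t \<and> alive (\<lambda>s. y + X s \<omega>) t then of_bool (y + X t \<omega> < 0) else 0) = (0::ennreal)"
      using alive_start_nonneg[OF y, of t \<omega>] by auto
  qed
  finally have "(\<integral>\<^sup>+u. of_bool (u < 0) \<partial>potential y) = 0" by simp
  then have "AE u in potential y. of_bool (u < 0) = (0::ennreal)"
    by (subst (asm) nn_integral_0_iff_AE) simp_all
  then show ?thesis by eventually_elim (simp add: not_less)
qed

end

text \<open>Makes the right-hand side of \<open>potential_add\<close> a single measure, to which
  uniqueness of Laplace transforms can be applied.\<close>

lemma ex_sum_measure: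
  fixes A B :: "'b::topological_space measure"
  assumes A: "sets A = sets borel" and B: "sets B = sets borel"
  obtains C where "sets C = sets borel"
    "\<And>g. g \<in> borel_measurable borel \<Longrightarrow> (\<integral>\<^sup>+u. g u \<partial>C) = (\<integral>\<^sup>+u. g u \<partial>A) + (\<integral>\<^sup>+u. g u \<partial>B)"
proof
  let ?\<mu> = "\<lambda>S. emeasure A S + emeasure B S"
  let ?C = "measure_of UNIV (sets borel) ?\<mu>"
  have sa: "sigma_algebra (UNIV :: 'b set) (sets borel)"
    using sets.sigma_algebra_axioms[of "borel :: 'b measure"] by simp
  show sC: "sets ?C = sets borel"
    by (rule sigma_algebra.sets_measure_of_eq[OF sa])
  have ca: "countably_additive (sets borel) ?\<mu>"
    unfolding countably_additive_def
  proof (intro allI impI)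
    fix S :: "nat \<Rightarrow> 'b set" assume S: "range S \<subseteq> sets borel" "disjoint_family S" "\<Union> (range S) \<in> sets borel"
    have "(\<Sum>i. emeasure A (S i)) = emeasure A (\<Union> (range S))" "(\<Sum>i. emeasure B (S i)) = emeasure B (\<Union> (range S))"
      using S A B by (auto intro!: suminf_emeasure)
    then show "(\<Sum>i. emeasure A (S i) + emeasure B (S i)) = emeasure A (\<Union> (range S)) + emeasure B (\<Union> (range S))"
      by (subst suminf_add[symmetric]) simp_all
  qed
  have em: "emeasure ?C S = ?\<mu> S" if "S \<in> sets borel" for S
    by (rule emeasure_measure_of_sigma[OF sa _ ca that]) (simp add: positive_def)
  note [measurable_cong] = sC A B
  have sp: "space ?C = UNIV" "space A = UNIV" "space B = UNIV"
    using sets_eq_imp_space_eq[OF sC] sets_eq_imp_space_eq[OF A] sets_eq_imp_space_eq[OF B] by simp_all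
  fix g :: "'b \<Rightarrow> ennreal" assume "g \<in> borel_measurable borel"
  then show "(\<integral>\<^sup>+u. g u \<partial>?C) = (\<integral>\<^sup>+u. g u \<partial>A) + (\<integral>\<^sup>+u. g u \<partial>B)"
  proof (induction rule: borel_measurable_induct)
    case (cong f g)
    then have "f = g" by (auto simp: fun_eq_iff)
    then show ?case using cong by simp
  next
    case (set S)
    then show ?case using em[of S] sC A B by simp
  next
    case (mult u c)
    note [measurable] = mult(2)
    have "(\<integral>\<^sup>+x. c * u x \<partial>N) = c * (\<integral>\<^sup>+x. u x \<partial>N)" if [measurable_cong]: "sets N = sets borel" for N
      by (rule nn_integral_cmult) measurable
    then show ?case using sC A B mult by (simp add: distrib_left)
  next
    case (add u v)
    note [measurable] = add(1,3)
    have "(\<integral>\<^sup>+x. v x + u x \<partial>N) = (\<integral>\<^sup>+x. v x \<partial>N) + (\<integral>\<^sup>+x. u x \<partial>N)" if [measurable_cong]: "sets N = sets borel" for N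
      by (rule nn_integral_add) measurable
    then show ?case using sC A B add by (simp add: ac_simps)
  next
    case (seq U)
    note [measurable] = seq(1)
    have *: "(\<integral>\<^sup>+x. (SUP i. U i) x \<partial>N) = (SUP i. \<integral>\<^sup>+x. U i x \<partial>N)" if [measurable_cong]: "sets N = sets borel" for N
      unfolding SUP_apply by (rule nn_integral_monotone_convergence_SUP) (use seq in measurable)
    have inc: "incseq (\<lambda>i. \<integral>\<^sup>+x. U i x \<partial>N)" for N
      using seq(3) by (intro monoI nn_integral_mono) (auto simp: incseq_def le_fun_def)
    show ?case unfolding *[OF sC] *[OF A] *[OF B] seq.IH by (rule ennreal_SUP_add) (rule inc)+
  qed
qed

lemma finite_borel_measure_eqI_nn_laplace:
  assumes \<mu>: "sets \<mu> = sets borel" and \<nu>: "sets \<nu> = sets borel"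
    and pos: "AE y in \<mu>. 0 \<le> y" "AE y in \<nu>. 0 \<le> y"
    and eq: "\<And>n::nat. (\<integral>\<^sup>+y. ennreal (exp (- (real n * y))) \<partial>\<mu>) = (\<integral>\<^sup>+y. ennreal (exp (- (real n * y))) \<partial>\<nu>)"
    and fin: "(\<integral>\<^sup>+y. 1 \<partial>\<mu>) < \<infinity>"
  shows "\<mu> = \<nu>"
proof (rule finite_borel_measure_eqI_laplace[OF _ _ pos])
  have f: "finite_borel_measure N" if "sets N = sets borel" "(\<integral>\<^sup>+y. 1 \<partial>N) < \<infinity>" for N :: "real measure"
    unfolding finite_borel_measure_def finite_borel_measure_axioms_def
    using that by (auto intro!: finite_measureI)
  show "finite_borel_measure \<mu>" by (rule f[OF \<mu> fin])
  show "finite_borel_measure \<nu>" by (rule f[OF \<nu>]) (use eq[of 0] fin in simp)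
  fix n :: nat
  have e: "(\<integral>y. exp (- (real n * y)) \<partial>N) = enn2real (\<integral>\<^sup>+y. ennreal (exp (- (real n * y))) \<partial>N)" if [measurable_cong]: "sets N = sets borel" for N
    by (rule integral_eq_nn_integral) simp_all
  show "(\<integral>y. exp (- (real n * y)) \<partial>\<mu>) = (\<integral>y. exp (- (real n * y)) \<partial>\<nu>)"
    unfolding e[OF \<mu>] e[OF \<nu>] eq ..
qed

context spectrally_positive
begin

text \<open>A path from x + h is, until it falls below x, a path from h translated by x; with
  probability exp (- p h) it then starts afresh at x. The proof works with transforms instead: the
  identity to be checked is exp (- p(x + h)) - exp (- l(x + h)) = exp (- p h) (exp (- p x) - exp (-
  l x)) + exp (- l x) (exp (- p h) - exp (- l h)).\<close>

lemma potential_add: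
  assumes x: "0 \<le> x" and h: "0 \<le> h" and g [measurable]: "g \<in> borel_measurable borel"
  shows "(\<integral>\<^sup>+u. g u \<partial>potential (x + h)) =
    ennreal (exp (- p * h)) * (\<integral>\<^sup>+u. g u \<partial>potential x) + (\<integral>\<^sup>+u. g (x + u) \<partial>potential h)"
proof -
  \<comment> \<open>The potential measure may be infinite. This weight makes it finite and moves the
    transforms at the integers n to the arguments p + 1 + n, where \<open>potential_laplace\<close>
    applies.\<close>
  define w where "w u = ennreal (exp (- (p + 1) * u))" for u :: real
  have [measurable]: "w \<in> borel_measurable borel" unfolding w_def[abs_def] by measurable
  define c where "c = ennreal (exp (- p * h))"
  let ?S = "distr (potential h) borel (\<lambda>u. x + u)"
  let ?\<mu> = "density (potential (x + h)) w"
  let ?A = "density (potential x) (\<lambda>u. c * w u)"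
  let ?B = "density ?S w"
  have D: "(\<integral>\<^sup>+u. k u \<partial>density (potential y) v) = (\<integral>\<^sup>+u. v u * k u \<partial>potential y)"
    if [measurable]: "k \<in> borel_measurable borel" "v \<in> borel_measurable borel" for k v y
    by (rule nn_integral_density) measurable
  have DB: "(\<integral>\<^sup>+u. k u \<partial>?B) = (\<integral>\<^sup>+u. w (x + u) * k (x + u) \<partial>potential h)"
    if [measurable]: "k \<in> borel_measurable borel" for k
  proof -
    have "(\<integral>\<^sup>+u. k u \<partial>?B) = (\<integral>\<^sup>+u. w u * k u \<partial>?S)" by (rule nn_integral_density) measurable
    also have "\<dots> = (\<integral>\<^sup>+u. w (x + u) * k (x + u) \<partial>potential h)" by (rule nn_integral_distr) measurable
    finally show ?thesis .
  qed
  obtain C where C: "sets C = sets borel"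
    and Ci: "\<And>k. k \<in> borel_measurable borel \<Longrightarrow> (\<integral>\<^sup>+u. k u \<partial>C) = (\<integral>\<^sup>+u. k u \<partial>?A) + (\<integral>\<^sup>+u. k u \<partial>?B)"
    by (rule ex_sum_measure[of ?A ?B]) auto
  have Ci': "(\<integral>\<^sup>+u. k u \<partial>C) = c * (\<integral>\<^sup>+u. w u * k u \<partial>potential x) + (\<integral>\<^sup>+u. w (x + u) * k (x + u) \<partial>potential h)"
    if [measurable]: "k \<in> borel_measurable borel" for k
  proof -
    have "(\<integral>\<^sup>+u. k u \<partial>?A) = (\<integral>\<^sup>+u. (c * w u) * k u \<partial>potential x)" by (rule D) measurable
    also have "\<dots> = (\<integral>\<^sup>+u. c * (w u * k u) \<partial>potential x)" by (simp only: mult.assoc)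
    also have "\<dots> = c * (\<integral>\<^sup>+u. w u * k u \<partial>potential x)" by (rule nn_integral_cmult) measurable
    finally show ?thesis using Ci[OF that] DB[OF that] by simp
  qed
  have we: "w u * ennreal (exp (- (real n * u))) = ennreal (exp (- (p + 1 + real n) * u))" for u n
    unfolding w_def by (subst ennreal_mult'[symmetric]) (simp_all add: mult_exp_exp algebra_simps)
  have lt: "(\<integral>\<^sup>+u. w u * ennreal (exp (- (real n * u))) \<partial>potential y) = ennreal ((exp (- p * y) - exp (- (p + 1 + real n) * y)) / \<psi> (p + 1 + real n))"
    if "0 \<le> y" for y n
    unfolding we by (rule potential_laplace) (use that in auto)
  have "?\<mu> = C"
  proof (rule finite_borel_measure_eqI_nn_laplace)
    show "sets ?\<mu> = sets borel" "sets C = sets borel" using C by simp_all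
    show "AE y in ?\<mu>. 0 \<le> y"
      using potential_nonneg[of "x + h"] x h by (subst AE_density) (auto elim: eventually_mono)
    have "(\<integral>\<^sup>+u. of_bool (u < 0) \<partial>C) = c * (\<integral>\<^sup>+u. w u * of_bool (u < 0) \<partial>potential x) + (\<integral>\<^sup>+u. w (x + u) * of_bool (x + u < 0) \<partial>potential h)"
      by (rule Ci') measurable
    also have "(\<integral>\<^sup>+u. w u * of_bool (u < 0) \<partial>potential x) = (\<integral>\<^sup>+u. 0 \<partial>potential x)"
      using potential_nonneg[OF x] by (intro nn_integral_cong_AE) (auto elim!: eventually_mono)
    also have "(\<integral>\<^sup>+u. w (x + u) * of_bool (x + u < 0) \<partial>potential h) = (\<integral>\<^sup>+u. 0 \<partial>potential h)"
      using potential_nonneg[OF h] x by (intro nn_integral_cong_AE) (auto elim!: eventually_mono)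
    finally have z: "(\<integral>\<^sup>+u. of_bool (u < 0) \<partial>C) = 0" by simp
    have "(\<lambda>u::real. of_bool (u < 0) :: ennreal) \<in> borel_measurable C"
      unfolding measurable_cong_sets[OF C refl] by measurable
    then have "AE u in C. of_bool (u < 0) = (0::ennreal)" using z by (subst (asm) nn_integral_0_iff_AE)
    then show "AE u in C. 0 \<le> u" by eventually_elim (simp add: not_less)
    show "(\<integral>\<^sup>+y. ennreal (exp (- (real n * y))) \<partial>?\<mu>) = (\<integral>\<^sup>+y. ennreal (exp (- (real n * y))) \<partial>C)" for n
    proof -
      define l where "l = p + 1 + real n"
      have psi: "0 < \<psi> l" by (rule psi_pos) (simp add: l_def)
      have "(\<integral>\<^sup>+y. ennreal (exp (- (real n * y))) \<partial>?\<mu>) = (\<integral>\<^sup>+u. w u * ennreal (exp (- (real n * u))) \<partial>potential (x + h))"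
        by (rule D) measurable
      also have "\<dots> = ennreal ((exp (- p * (x + h)) - exp (- l * (x + h))) / \<psi> l)"
        unfolding l_def by (rule lt) (use x h in simp)
      finally have 1: "(\<integral>\<^sup>+y. ennreal (exp (- (real n * y))) \<partial>?\<mu>) = ennreal ((exp (- p * (x + h)) - exp (- l * (x + h))) / \<psi> l)" .
      have "(\<integral>\<^sup>+u. w (x + u) * ennreal (exp (- (real n * (x + u)))) \<partial>potential h)
        = (\<integral>\<^sup>+u. ennreal (exp (- l * x)) * (w u * ennreal (exp (- (real n * u)))) \<partial>potential h)"
        unfolding we l_def[symmetric]
        by (intro nn_integral_cong) (simp add: ennreal_mult'[symmetric] mult_exp_exp algebra_simps)
      also have "\<dots> = ennreal (exp (- l * x)) * ennreal ((exp (- p * h) - exp (- l * h)) / \<psi> l)"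
        unfolding l_def lt[OF h, symmetric] by (rule nn_integral_cmult) measurable
      finally have 2: "(\<integral>\<^sup>+u. w (x + u) * ennreal (exp (- (real n * (x + u)))) \<partial>potential h)
        = ennreal (exp (- l * x)) * ennreal ((exp (- p * h) - exp (- l * h)) / \<psi> l)" .
      have nn: "0 \<le> (exp (- p * y) - exp (- l * y)) / \<psi> l" if "0 \<le> y" for y
      proof -
        have "p * y \<le> l * y" using that by (intro mult_right_mono) (simp_all add: l_def)
        then show ?thesis using psi by (intro divide_nonneg_pos) simp_all
      qed
      have "(\<integral>\<^sup>+y. ennreal (exp (- (real n * y))) \<partial>C) =
        c * (\<integral>\<^sup>+u. w u * ennreal (exp (- (real n * u))) \<partial>potential x) + (\<integral>\<^sup>+u. w (x + u) * ennreal (exp (- (real n * (x + u)))) \<partial>potential h)"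
        by (rule Ci') measurable
      also have "\<dots> = ennreal (exp (- p * h)) * ennreal ((exp (- p * x) - exp (- l * x)) / \<psi> l)
         + ennreal (exp (- l * x)) * ennreal ((exp (- p * h) - exp (- l * h)) / \<psi> l)"
        unfolding 2 lt[OF x] c_def l_def ..
      also have "\<dots> = ennreal (exp (- p * h) * ((exp (- p * x) - exp (- l * x)) / \<psi> l)
         + exp (- l * x) * ((exp (- p * h) - exp (- l * h)) / \<psi> l))"
        unfolding ennreal_mult'[OF exp_ge_zero, symmetric]
        by (rule ennreal_plus[symmetric]) (intro mult_nonneg_nonneg exp_ge_zero nn x h)+
      also have "exp (- p * h) * ((exp (- p * x) - exp (- l * x)) / \<psi> l) + exp (- l * x) * ((exp (- p * h) - exp (- l * h)) / \<psi> l)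
         = (exp (- p * (x + h)) - exp (- l * (x + h))) / \<psi> l"
      proof -
        have e: "exp (- a * (x + h)) = exp (- a * x) * exp (- a * h)" for a
          by (simp only: mult_exp_exp distrib_left)
        show ?thesis unfolding e by (simp add: algebra_simps add_divide_distrib diff_divide_distrib)
      qed
      finally show ?thesis using 1 by simp
    qed
    have "(\<integral>\<^sup>+u. 1 \<partial>?\<mu>) = (\<integral>\<^sup>+u. w u * 1 \<partial>potential (x + h))" by (rule D) measurable
    also have "\<dots> = (\<integral>\<^sup>+u. w u * ennreal (exp (- (real 0 * u))) \<partial>potential (x + h))" by simp
    also have "\<dots> < \<infinity>" by (subst lt) (use x h in simp_all)
    finally show "(\<integral>\<^sup>+u. 1 \<partial>?\<mu>) < \<infinity>" .
  qed
  \<comment> \<open>The weight is positive, so it can be divided out again for arbitrary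
    \<open>g\<close>.\<close>
  have inv: "w u * (ennreal (exp ((p + 1) * u)) * k) = k" for u k
  proof -
    have "w u * ennreal (exp ((p + 1) * u)) = 1"
      unfolding w_def by (subst ennreal_mult'[symmetric]) (simp_all add: mult_exp_exp algebra_simps)
    then show ?thesis by (simp add: mult.assoc[symmetric])
  qed
  let ?k = "\<lambda>u. ennreal (exp ((p + 1) * u)) * g u"
  have "(\<integral>\<^sup>+u. g u \<partial>potential (x + h)) = (\<integral>\<^sup>+u. w u * ?k u \<partial>potential (x + h))" by (simp only: inv)
  also have "\<dots> = (\<integral>\<^sup>+u. ?k u \<partial>?\<mu>)" by (rule D[symmetric]) measurable
  also have "\<dots> = (\<integral>\<^sup>+u. ?k u \<partial>C)" by (simp only: \<open>?\<mu> = C\<close>)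
  also have "\<dots> = c * (\<integral>\<^sup>+u. w u * ?k u \<partial>potential x) + (\<integral>\<^sup>+u. w (x + u) * ?k (x + u) \<partial>potential h)"
    by (rule Ci') measurable
  finally show ?thesis by (simp only: inv c_def)
qed

text \<open>Drops the translated summand of \<open>potential_add\<close>.\<close>

lemma potential_mono_start:
  assumes "0 \<le> x" "x \<le> y" and [measurable]: "g \<in> borel_measurable borel"
  shows "ennreal (exp (p * x)) * (\<integral>\<^sup>+u. g u \<partial>potential x) \<le> ennreal (exp (p * y)) * (\<integral>\<^sup>+u. g u \<partial>potential y)"
proof -
  have "(\<integral>\<^sup>+u. g u \<partial>potential y) \<ge> ennreal (exp (- p * (y - x))) * (\<integral>\<^sup>+u. g u \<partial>potential x)"
    using potential_add[of x "y - x" g] assms by simp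
  then have "ennreal (exp (p * y)) * (\<integral>\<^sup>+u. g u \<partial>potential y) \<ge> ennreal (exp (p * y)) * (ennreal (exp (- p * (y - x))) * (\<integral>\<^sup>+u. g u \<partial>potential x))"
    by (rule mult_left_mono) simp
  also have "ennreal (exp (p * y)) * (ennreal (exp (- p * (y - x))) * (\<integral>\<^sup>+u. g u \<partial>potential x)) = ennreal (exp (p * x)) * (\<integral>\<^sup>+u. g u \<partial>potential x)"
    unfolding mult.assoc[symmetric] by (subst ennreal_mult'[symmetric]) (simp_all add: mult_exp_exp algebra_simps)
  finally show ?thesis .
qed

text \<open>\<open>potential_add\<close> is applied to x + h and to h + x. In the first order the
  translated summand vanishes because \<open>g\<close> is 0 from x on, and what remains is at most
  the integral against U(x). In the second order the translated summand is the left-hand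
  side.\<close>

lemma potential_shift:
  assumes x: "0 \<le> x" and h: "0 \<le> h" and g [measurable]: "g \<in> borel_measurable borel"
    and supp: "\<And>u. x \<le> u \<Longrightarrow> g u = 0"
  shows "(\<integral>\<^sup>+u. g (h + u) \<partial>potential x) \<le> (\<integral>\<^sup>+u. g u \<partial>potential x)"
proof -
  have "(\<integral>\<^sup>+u. g (x + u) \<partial>potential h) = (\<integral>\<^sup>+u. 0 \<partial>potential h)"
    using potential_nonneg[OF h] by (intro nn_integral_cong_AE) (auto elim!: eventually_mono simp: supp)
  then have "(\<integral>\<^sup>+u. g u \<partial>potential (x + h)) = ennreal (exp (- p * h)) * (\<integral>\<^sup>+u. g u \<partial>potential x)"
    unfolding potential_add[OF x h g] by simp
  also have "\<dots> \<le> 1 * (\<integral>\<^sup>+u. g u \<partial>potential x)"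
    using p_nonneg h by (intro mult_right_mono) simp_all
  also have "(\<integral>\<^sup>+u. g u \<partial>potential (x + h)) = (\<integral>\<^sup>+u. g u \<partial>potential (h + x))" by (simp only: add.commute)
  finally have "(\<integral>\<^sup>+u. g u \<partial>potential (h + x)) \<le> (\<integral>\<^sup>+u. g u \<partial>potential x)" by simp
  then show ?thesis unfolding potential_add[OF h x g] by (rule order_trans[rotated]) simp
qed

text \<open>An exponential Chebyshev bound with l = p + 1. It gives the sigma-finiteness on which
  the averaging by Fubini's theorem rests.\<close>

lemma potential_bounded_finite:
  assumes y: "0 \<le> y"
  shows "emeasure (potential y) {..d} < \<infinity>"
proof -
  define l where "l = p + 1"
  have "emeasure (potential y) {..d} = (\<integral>\<^sup>+u. indicator {..d} u \<partial>potential y)" by simp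
  also have "\<dots> \<le> (\<integral>\<^sup>+u. ennreal (exp (l * d)) * ennreal (exp (- l * u)) \<partial>potential y)"
  proof (rule nn_integral_mono)
    fix u
    show "indicator {..d} u \<le> ennreal (exp (l * d)) * ennreal (exp (- l * u))"
    proof (cases "u \<le> d")
      case True
      then have "l * u \<le> l * d" using p_nonneg by (intro mult_left_mono) (simp_all add: l_def)
      then have "1 \<le> exp (l * d) * exp (- l * u)" unfolding mult_exp_exp by simp
      then have "ennreal 1 \<le> ennreal (exp (l * d) * exp (- l * u))" by (rule ennreal_leI)
      then show ?thesis using True by (simp add: ennreal_mult')
    qed simp
  qed
  also have "\<dots> = ennreal (exp (l * d)) * (\<integral>\<^sup>+u. ennreal (exp (- l * u)) \<partial>potential y)"
    by (rule nn_integral_cmult) measurable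
  also have "\<dots> < \<infinity>" by (subst potential_laplace) (use y in \<open>simp_all add: l_def ennreal_mult_less_top\<close>)
  finally show ?thesis .
qed

lemma sigma_finite_potential:
  assumes y: "0 \<le> y"
  shows "sigma_finite_measure (potential y)"
proof
  let ?A = "range (\<lambda>n::nat. {..real n})"
  have "emeasure (potential y) {..real n} \<noteq> \<infinity>" for n
    using potential_bounded_finite[OF y, of "real n"] by simp
  moreover have "\<Union> ?A = space (potential y)"
    using real_arch_simple by auto
  ultimately show "\<exists>A. countable A \<and> A \<subseteq> sets (potential y) \<and> \<Union> A = space (potential y) \<and> (\<forall>a\<in>A. emeasure (potential y) a \<noteq> \<infinity>)"
    by (intro exI[of _ ?A]) auto
qed

end

text \<open>Reduces a comparison of integrals near 0 to blocks on which the variable changes by a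
  factor of at most 2.\<close>

lemma nn_integral_dyadic_blocks:
  fixes N :: "real measure" and g :: "real \<Rightarrow> ennreal"
  assumes N: "sets N = sets borel" and g [measurable]: "g \<in> borel_measurable borel" and \<delta>: "0 < \<delta>"
  shows "(\<integral>\<^sup>+u\<in>{0<..<\<delta>}. g u \<partial>N) = (\<Sum>k. \<integral>\<^sup>+u\<in>{\<delta> / 2 ^ Suc k..<\<delta> / 2 ^ k}. g u \<partial>N)"
proof -
  note [measurable_cong] = N
  let ?I = "\<lambda>k. {\<delta> / 2 ^ Suc k..<\<delta> / 2 ^ k}"
  have un: "(\<Union>k. ?I k) = {0<..<\<delta>}"
  proof (intro equalityI subsetI)
    fix u assume "u \<in> (\<Union>k. ?I k)"
    then obtain k where k: "\<delta> / 2 ^ Suc k \<le> u" "u < \<delta> / 2 ^ k" by auto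
    have "0 < \<delta> / 2 ^ Suc k" using \<delta> by simp
    moreover have "\<delta> / 2 ^ k \<le> \<delta> / 1" using \<delta> by (intro divide_left_mono) simp_all
    ultimately have "0 < u" "u < \<delta>" using k by linarith+
    then show "u \<in> {0<..<\<delta>}" by simp
  next
    fix u assume u: "u \<in> {0<..<\<delta>}"
    have "(\<lambda>k. \<delta> * (1 / 2) ^ k) \<longlonglongrightarrow> \<delta> * 0" by (intro tendsto_intros LIMSEQ_realpow_zero) auto
    then have "\<forall>\<^sub>F k in sequentially. \<delta> * (1 / 2) ^ k < u" using u by (intro order_tendstoD(2)[where y="\<delta> * 0"]) auto
    then have "\<exists>k. \<delta> / 2 ^ k \<le> u" by (auto simp: eventually_sequentially power_divide intro: less_imp_le)
    define k where "k = (LEAST k. \<delta> / 2 ^ k \<le> u)"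
    have k: "\<delta> / 2 ^ k \<le> u" unfolding k_def by (rule LeastI_ex) fact
    have "k \<noteq> 0" using k u by (intro notI) simp
    then obtain j where j: "k = Suc j" by (cases k) auto
    then have "\<not> \<delta> / 2 ^ j \<le> u" unfolding k_def by (intro not_less_Least) simp
    then have "u \<in> ?I j" using k j by simp
    then show "u \<in> (\<Union>k. ?I k)" by blast
  qed
  have disj: "disjoint_family ?I"
  proof -
    have less: "?I j \<inter> ?I k = {}" if "j < k" for j k
    proof -
      have "\<delta> / 2 ^ k \<le> \<delta> / 2 ^ Suc j" using \<delta> that by (intro divide_left_mono power_increasing) auto
      then show ?thesis by auto
    qed
    show ?thesis unfolding disjoint_family_on_def
    proof (intro ballI impI)
      fix j k :: nat assume "j \<noteq> k"
      then show "?I j \<inter> ?I k = {}" using less[of j k] less[of k j] by (cases "j < k") (simp_all add: Int_commute)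
    qed
  qed
  have em: "emeasure (density N g) S = (\<integral>\<^sup>+u\<in>S. g u \<partial>N)" if "S \<in> sets borel" for S
    by (rule emeasure_density) (use that N in \<open>simp_all add: measurable_cong_sets[OF N refl]\<close>)
  have "(\<Sum>k. emeasure (density N g) (?I k)) = emeasure (density N g) (\<Union>k. ?I k)"
  proof (rule suminf_emeasure[OF _ disj])
    show "range ?I \<subseteq> sets (density N g)" unfolding sets_density N by (intro image_subsetI) simp
  qed
  then show ?thesis unfolding un by (simp add: em)
qed

context spectrally_positive
begin

section \<open>Comparison of the potential measure with Lebesgue measure\<close>

text \<open>Translating \<open>g\<close> to the right by h \<le> a does not decrease its integral
  (\<open>potential_shift\<close>). The average over h replaces \<open>g\<close> by a function that
  is at most its Lebesgue integral on [a, 3 a] and 0 elsewhere. On that interval the indicator is at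
  most exp 3 times exp (- u / a), whose integral is at most \<open>1 / \<psi> (1 / a)\<close>. The
  condition 3 a < x keeps all translates below x.\<close>

lemma potential_upper_block:
  assumes a: "0 < a" "3 * a < x" and pa: "p < 1 / a" and g [measurable]: "g \<in> borel_measurable borel"
    and supp: "\<And>u. u \<notin> {a..2 * a} \<Longrightarrow> g u = 0"
  shows "ennreal a * (\<integral>\<^sup>+u. g u \<partial>potential x) \<le> ennreal (exp 3 / \<psi> (1 / a)) * (\<integral>\<^sup>+u. g u \<partial>lborel)"
proof -
  have x: "0 \<le> x" using a by simp
  interpret S: sigma_finite_measure "potential x" by (rule sigma_finite_potential[OF x])
  interpret P: pair_sigma_finite lborel "potential x" ..
  let ?I = "\<integral>\<^sup>+u. g u \<partial>potential x" and ?J = "\<integral>\<^sup>+u. g u \<partial>lborel"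
  have "ennreal a * ?I = (\<integral>\<^sup>+h. ?I * indicator {0..a} h \<partial>lborel)"
    using a by (subst nn_integral_cmult_indicator) (simp_all add: mult.commute)
  also have "\<dots> \<le> (\<integral>\<^sup>+h. (\<integral>\<^sup>+u. g (u - h) * indicator {0..a} h \<partial>potential x) \<partial>lborel)"
  proof (rule nn_integral_mono)
    fix h
    show "?I * indicator {0..a} h \<le> (\<integral>\<^sup>+u. g (u - h) * indicator {0..a} h \<partial>potential x)"
    proof (cases "h \<in> {0..a}")
      case True
      have "(\<integral>\<^sup>+u. (\<lambda>v. g (v - h)) (h + u) \<partial>potential x) \<le> (\<integral>\<^sup>+u. g (u - h) \<partial>potential x)"
      proof (rule potential_shift[OF x])
        fix u assume "x \<le> u"
        then have "2 * a < u - h" using a True by simp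
        then show "g (u - h) = 0" by (intro supp) simp
      qed (use True in simp_all)
      then show ?thesis using True by simp
    qed simp
  qed
  also have "\<dots> = (\<integral>\<^sup>+u. (\<integral>\<^sup>+h. g (u - h) * indicator {0..a} h \<partial>lborel) \<partial>potential x)"
    by (rule P.Fubini'[symmetric]) measurable
  also have "\<dots> \<le> (\<integral>\<^sup>+u. ?J * (ennreal (exp 3) * ennreal (exp (- (1 / a) * u))) \<partial>potential x)"
  proof (rule nn_integral_mono)
    fix u
    have "(\<integral>\<^sup>+h. g (u - h) * indicator {0..a} h \<partial>lborel) \<le> ?J * indicator {a..3 * a} u"
    proof (cases "u \<in> {a..3 * a}")
      case True
      have "(\<integral>\<^sup>+h. g (u - h) * indicator {0..a} h \<partial>lborel) \<le> (\<integral>\<^sup>+h. g (u - h) \<partial>lborel)"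
        by (intro nn_integral_mono) (simp add: indicator_def)
      also have "\<dots> = ?J"
        by (subst (2) nn_integral_real_affine[where c="-1" and t=u]) simp_all
      finally show ?thesis using True by simp
    next
      case False
      then have "g (u - h) * indicator {0..a} h = 0" for h
        using a by (cases "h \<in> {0..a}") (auto intro!: supp)
      then have "(\<integral>\<^sup>+h. g (u - h) * indicator {0..a} h \<partial>lborel) = (\<integral>\<^sup>+h. 0 \<partial>(lborel :: real measure))"
        by (simp only:)
      then show ?thesis by simp
    qed
    also have "indicator {a..3 * a} u \<le> ennreal (exp 3) * ennreal (exp (- (1 / a) * u))"
    proof (cases "u \<in> {a..3 * a}")
      case True
      have "u / a \<le> 3" using True a by (simp add: divide_le_eq)
      then have "1 \<le> exp 3 * exp (- (1 / a) * u)" unfolding mult_exp_exp by simp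
      then show ?thesis using True by (metis ennreal_1 ennreal_leI ennreal_mult' exp_ge_zero indicator_simps(1))
    qed simp
    finally show "(\<integral>\<^sup>+h. g (u - h) * indicator {0..a} h \<partial>lborel) \<le> ?J * (ennreal (exp 3) * ennreal (exp (- (1 / a) * u)))"
      by (simp add: mult_left_mono)
  qed
  also have "\<dots> = ?J * (\<integral>\<^sup>+u. ennreal (exp 3) * ennreal (exp (- (1 / a) * u)) \<partial>potential x)"
    by (rule nn_integral_cmult) measurable
  also have "\<dots> = ?J * (ennreal (exp 3) * (\<integral>\<^sup>+u. ennreal (exp (- (1 / a) * u)) \<partial>potential x))"
    by (rule arg_cong[where f="\<lambda>v. ?J * v"], rule nn_integral_cmult) measurable
  also have "\<dots> \<le> ?J * ennreal (exp 3 / \<psi> (1 / a))"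
  proof (rule mult_left_mono)
    have "exp (- p * x) - exp (- (1 / a) * x) \<le> 1"
    proof -
      have "exp (- p * x) \<le> 1" using p_nonneg x by simp
      then show ?thesis using exp_ge_zero[of "- (1 / a) * x"] by linarith
    qed
    then have "(exp (- p * x) - exp (- (1 / a) * x)) / \<psi> (1 / a) \<le> 1 / \<psi> (1 / a)"
      using psi_pos[OF pa] by (intro divide_right_mono) simp_all
    then have "ennreal (exp 3) * (\<integral>\<^sup>+u. ennreal (exp (- (1 / a) * u)) \<partial>potential x) \<le> ennreal (exp 3) * ennreal (1 / \<psi> (1 / a))"
      unfolding potential_laplace[OF pa x] by (intro mult_left_mono ennreal_leI) simp_all
    also have "\<dots> = ennreal (exp 3 / \<psi> (1 / a))" by (subst ennreal_mult'[symmetric]) simp_all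
    finally show "ennreal (exp 3) * (\<integral>\<^sup>+u. ennreal (exp (- (1 / a) * u)) \<partial>potential x) \<le> ennreal (exp 3 / \<psi> (1 / a))" .
  qed simp
  finally show ?thesis by (simp add: mult.commute)
qed

text \<open>The same averaging in the other direction: moving \<open>g\<close> to the left by h does
  not increase its integral, and for every u in [0, a] the points h + u with h in [0, 2 a] cover the
  whole support of \<open>g\<close>.\<close>

lemma potential_lower_block:
  assumes a: "0 < a" "2 * a < x" and g [measurable]: "g \<in> borel_measurable borel"
    and supp: "\<And>u. u \<notin> {a..2 * a} \<Longrightarrow> g u = 0"
  shows "emeasure (potential x) {0..a} * (\<integral>\<^sup>+u. g u \<partial>lborel) \<le> ennreal (2 * a) * (\<integral>\<^sup>+u. g u \<partial>potential x)"
proof -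
  have x: "0 \<le> x" using a by simp
  interpret S: sigma_finite_measure "potential x" by (rule sigma_finite_potential[OF x])
  interpret P: pair_sigma_finite lborel "potential x" ..
  let ?I = "\<integral>\<^sup>+u. g u \<partial>potential x" and ?J = "\<integral>\<^sup>+u. g u \<partial>lborel"
  have "emeasure (potential x) {0..a} * ?J = (\<integral>\<^sup>+u. ?J * indicator {0..a} u \<partial>potential x)"
    by (subst nn_integral_cmult_indicator) (simp_all add: mult.commute)
  also have "\<dots> \<le> (\<integral>\<^sup>+u. (\<integral>\<^sup>+h. g (h + u) * indicator {0..2 * a} h \<partial>lborel) \<partial>potential x)"
  proof (rule nn_integral_mono)
    fix u
    show "?J * indicator {0..a} u \<le> (\<integral>\<^sup>+h. g (h + u) * indicator {0..2 * a} h \<partial>lborel)"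
    proof (cases "u \<in> {0..a}")
      case True
      have "g (h + u) * indicator {0..2 * a} h = g (h + u)" for h
        using True supp[of "h + u"] by (cases "h \<in> {0..2 * a}") auto
      then have "(\<integral>\<^sup>+h. g (h + u) * indicator {0..2 * a} h \<partial>lborel) = (\<integral>\<^sup>+h. g (h + u) \<partial>lborel)" by simp
      also have "\<dots> = ?J"
        by (subst (2) nn_integral_real_affine[where c=1 and t=u]) (simp_all add: add.commute)
      finally show ?thesis using True by simp
    qed simp
  qed
  also have "\<dots> = (\<integral>\<^sup>+h. (\<integral>\<^sup>+u. g (h + u) * indicator {0..2 * a} h \<partial>potential x) \<partial>lborel)"
    by (rule P.Fubini') measurable
  also have "\<dots> \<le> (\<integral>\<^sup>+h. ?I * indicator {0..2 * a} h \<partial>lborel)"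
  proof (rule nn_integral_mono)
    fix h
    show "(\<integral>\<^sup>+u. g (h + u) * indicator {0..2 * a} h \<partial>potential x) \<le> ?I * indicator {0..2 * a} h"
    proof (cases "h \<in> {0..2 * a}")
      case True
      have "(\<integral>\<^sup>+u. g (h + u) \<partial>potential x) \<le> ?I"
        by (rule potential_shift[OF x _ g]) (use True a in \<open>auto intro!: supp\<close>)
      then show ?thesis using True by simp
    qed simp
  qed
  also have "\<dots> = ennreal (2 * a) * ?I"
    using a by (subst nn_integral_cmult_indicator) (simp_all add: mult.commute)
  finally show ?thesis .
qed

end

text \<open>The regularity of \<open>\<psi>\<close> behind the comparison near 0. Together with
  monotonicity, doubling says that a bounded factor in the argument costs a bounded factor in the
  value.\<close>

locale regular_spectrally_positive = spectrally_positive +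
  assumes psi_measurable [measurable]: "\<psi> \<in> borel_measurable borel"
    and psi_mono: "\<And>l l'. p < l \<Longrightarrow> l \<le> l' \<Longrightarrow> \<psi> l \<le> \<psi> l'"
    and psi_doubling: "\<exists>C\<ge>1. \<exists>K>p. \<forall>l\<ge>K. \<psi> (2 * l) \<le> C * \<psi> l"
begin

text \<open>A Tauberian bound, from splitting the transform at l = 2^m / a. Up to a the exponential
  is at most 1. Beyond a it is at most exp (- 2^m / 2) times exp (- (l / 2) u), whose transform is
  of order \<open>C / \<psi> l\<close> by doubling. For large m that part cannot account for the
  whole transform, so the mass of [0, a] has to.\<close>

lemma potential_near_0:
  assumes x: "0 < x"
  obtains c A where "0 < c" "0 < A" "\<And>a. 0 < a \<Longrightarrow> a \<le> A \<Longrightarrow> ennreal (c / \<psi> (1 / a)) \<le> emeasure (potential x) {0..a}"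
proof -
  obtain C K where C: "1 \<le> C" and K: "p < K" and dbl: "\<And>l. K \<le> l \<Longrightarrow> \<psi> (2 * l) \<le> C * \<psi> l"
    using psi_doubling by auto
  have K0: "0 < K" using K p_nonneg by simp
  have iter: "\<psi> (2 ^ m * l) \<le> C ^ m * \<psi> l" if "K \<le> l" for m l
  proof (induction m)
    case (Suc m)
    have "1 * l \<le> 2 ^ m * l" using that K0 by (intro mult_right_mono) simp_all
    then have "K \<le> 2 ^ m * l" using that by simp
    then have "\<psi> (2 * (2 ^ m * l)) \<le> C * \<psi> (2 ^ m * l)" by (rule dbl)
    also have "\<dots> \<le> C * (C ^ m * \<psi> l)" using C Suc by (intro mult_left_mono) simp_all
    finally show ?case by (simp add: mult.assoc)
  qed simp
  \<comment> \<open>Chosen so that the part beyond a takes at most half of the lower bound for the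
    transform at l, after a factor \<open>C\<close> is paid for halving l.\<close>
  obtain m :: nat where m: "2 * ln (4 * C) < 2 ^ m" using real_arch_pow[of 2 "2 * ln (4 * C)"] by auto
  have eK: "exp (- (2 ^ m / 2)) * C \<le> 1 / 4"
  proof -
    have "ln (4 * C) \<le> 2 ^ m / 2" using m by simp
    then have "exp (ln (4 * C)) \<le> exp (2 ^ m / 2)" by (simp only: exp_le_cancel_iff)
    then have "4 * C \<le> exp (2 ^ m / 2)" using C by simp
    then show ?thesis by (simp add: exp_minus divide_simps)
  qed
  \<comment> \<open>For l above \<open>L\<close>, l / 2 is still in the doubling range, and exp (- l
    x) is at most half of exp (- p x), so that the transform at l is at least
    \<open>exp (- p * x) / (2 * \<psi> l)\<close>.\<close>
  define L where "L = max (2 * K) (p + ln 2 / x)"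
  have L: "2 * K \<le> L" "p + ln 2 / x \<le> L" by (simp_all add: L_def)
  \<comment> \<open>For a up to \<open>A\<close>, the point 1/a is at least \<open>K\<close> and 2^m
    / a is at least \<open>L\<close>.\<close>
  define A where "A = min (1 / K) (2 ^ m / L)"
  have Lpos: "0 < L" using L K0 by linarith
  have A: "0 < A" using K0 Lpos by (simp add: A_def)
  \<comment> \<open>A quarter of exp (- p x) is left once the part beyond a is subtracted;
    \<open>C ^ m\<close> pays for the m doublings from 1/a to 2^m / a.\<close>
  define c where "c = exp (- p * x) / (4 * C ^ m)"
  have c: "0 < c" using C by (simp add: c_def)
  show thesis
  proof (rule that[OF c A])
    fix a assume a: "0 < a" "a \<le> A"
    define l where "l = 2 ^ m * (1 / a)"
    have aK: "K \<le> 1 / a"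
    proof -
      have "a \<le> 1 / K" using a by (simp add: A_def)
      then show ?thesis using a K0 by (simp add: field_simps)
    qed
    have lL: "L \<le> l"
    proof -
      have "a \<le> 2 ^ m / L" using a by (simp add: A_def)
      then show ?thesis using a Lpos unfolding l_def by (simp add: field_simps)
    qed
    have l2: "K \<le> l / 2" "p < l / 2" using lL L K by linarith+
    then have pl: "p < l" using K0 by linarith
    have psl: "0 < \<psi> l" by (rule psi_pos[OF pl])
    have half: "\<psi> l \<le> C * \<psi> (l / 2)" using dbl[OF l2(1)] by simp
    have psl2: "0 < \<psi> (l / 2)" by (rule psi_pos[OF l2(2)])
    let ?E = "exp (- p * x)"
    have "ln 2 \<le> (l - p) * x"
    proof -
      have "ln 2 / x \<le> l - p" using lL L by linarith
      then show ?thesis using x by (simp add: divide_le_eq)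
    qed
    then have "exp (- l * x) \<le> exp (- p * x - ln 2)" by (simp add: algebra_simps)
    also have "\<dots> = ?E / 2" by (simp add: exp_diff)
    finally have el: "?E / 2 \<le> ?E - exp (- l * x)" by simp
    have x0: "0 \<le> x" using x by simp
    have "ennreal ((?E / 2) / \<psi> l) \<le> (\<integral>\<^sup>+u. ennreal (exp (- l * u)) \<partial>potential x)"
      unfolding potential_laplace[OF pl x0] using el psl by (intro ennreal_leI divide_right_mono) simp_all
    also have "\<dots> \<le> (\<integral>\<^sup>+u. indicator {0..a} u + ennreal (exp (- (2 ^ m / 2))) * ennreal (exp (- (l / 2) * u)) \<partial>potential x)"
    proof (rule nn_integral_mono_AE)
      show "AE u in potential x. ennreal (exp (- l * u)) \<le> indicator {0..a} u + ennreal (exp (- (2 ^ m / 2))) * ennreal (exp (- (l / 2) * u))"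
        using potential_nonneg[OF x0]
      proof eventually_elim
        case (elim u)
        show ?case
        proof (cases "u \<le> a")
          case True
          have "ennreal (exp (- l * u)) \<le> 1" using elim pl p_nonneg by simp
          then show ?thesis using True elim by (simp add: add_increasing2)
        next
          case False
          have "2 ^ m = l * a" using a by (simp add: l_def)
          also have "\<dots> \<le> l * u" using False pl p_nonneg by (intro mult_left_mono) simp_all
          finally have "exp (- l * u) \<le> exp (- (2 ^ m / 2)) * exp (- (l / 2) * u)" unfolding mult_exp_exp by simp
          then show ?thesis using False by (simp add: ennreal_leI flip: ennreal_mult')
        qed
      qed
    qed
    also have "\<dots> = emeasure (potential x) {0..a} + ennreal (exp (- (2 ^ m / 2))) * (\<integral>\<^sup>+u. ennreal (exp (- (l / 2) * u)) \<partial>potential x)"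
    proof -
      have "(\<integral>\<^sup>+u. ennreal (exp (- (2 ^ m / 2))) * ennreal (exp (- (l / 2) * u)) \<partial>potential x)
        = ennreal (exp (- (2 ^ m / 2))) * (\<integral>\<^sup>+u. ennreal (exp (- (l / 2) * u)) \<partial>potential x)"
        by (rule nn_integral_cmult) measurable
      moreover have "(\<integral>\<^sup>+u. indicator {0..a} u + ennreal (exp (- (2 ^ m / 2))) * ennreal (exp (- (l / 2) * u)) \<partial>potential x)
        = (\<integral>\<^sup>+u. indicator {0..a} u \<partial>potential x) + (\<integral>\<^sup>+u. ennreal (exp (- (2 ^ m / 2))) * ennreal (exp (- (l / 2) * u)) \<partial>potential x)"
        by (rule nn_integral_add) measurable
      ultimately show ?thesis by simp
    qed
    also have "\<dots> \<le> emeasure (potential x) {0..a} + ennreal ((?E / 4) / \<psi> l)"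
    proof (rule add_left_mono)
      have "(?E - exp (- (l / 2) * x)) / \<psi> (l / 2) \<le> ?E / \<psi> (l / 2)"
        using psl2 by (intro divide_right_mono) simp_all
      also have "\<dots> \<le> ?E * C / \<psi> l"
      proof -
        have "?E * \<psi> l \<le> ?E * (C * \<psi> (l / 2))" using half by (intro mult_left_mono) simp_all
        then show ?thesis using psl psl2 by (simp add: divide_le_eq le_divide_eq mult.assoc mult.commute)
      qed
      finally have "exp (- (2 ^ m / 2)) * ((?E - exp (- (l / 2) * x)) / \<psi> (l / 2)) \<le> exp (- (2 ^ m / 2)) * (?E * C / \<psi> l)"
        by (intro mult_left_mono) simp_all
      also have "\<dots> = (exp (- (2 ^ m / 2)) * C) * (?E / \<psi> l)" by simp
      also have "\<dots> \<le> (1 / 4) * (?E / \<psi> l)" using eK psl by (intro mult_right_mono) simp_all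
      finally have "exp (- (2 ^ m / 2)) * ((?E - exp (- (l / 2) * x)) / \<psi> (l / 2)) \<le> (?E / 4) / \<psi> l" by simp
      then show "ennreal (exp (- (2 ^ m / 2))) * (\<integral>\<^sup>+u. ennreal (exp (- (l / 2) * u)) \<partial>potential x) \<le> ennreal ((?E / 4) / \<psi> l)"
        unfolding potential_laplace[OF l2(2) x0] by (simp add: ennreal_leI flip: ennreal_mult')
    qed
    finally have main: "ennreal ((?E / 2) / \<psi> l) \<le> emeasure (potential x) {0..a} + ennreal ((?E / 4) / \<psi> l)" .
    have "ennreal ((?E / 4) / \<psi> l) \<le> emeasure (potential x) {0..a}"
    proof -
      have "(?E / 2) / \<psi> l = (?E / 4) / \<psi> l + (?E / 4) / \<psi> l" by simp
      then have "ennreal ((?E / 2) / \<psi> l) = ennreal ((?E / 4) / \<psi> l) + ennreal ((?E / 4) / \<psi> l)"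
        using psl by (simp add: ennreal_plus[symmetric] del: ennreal_plus)
      then show ?thesis using main by (simp add: ennreal_add_left_cancel_le add.commute)
    qed
    moreover have "c / \<psi> (1 / a) \<le> (?E / 4) / \<psi> l"
    proof -
      have pa: "0 < \<psi> (1 / a)" using aK K by (intro psi_pos) simp
      have "\<psi> l \<le> C ^ m * \<psi> (1 / a)" unfolding l_def by (rule iter[OF aK])
      then have "(?E / 4) / (C ^ m * \<psi> (1 / a)) \<le> (?E / 4) / \<psi> l"
        using psl pa C by (intro divide_left_mono mult_pos_pos) simp_all
      moreover have "(?E / 4) / (C ^ m * \<psi> (1 / a)) = c / \<psi> (1 / a)" by (simp add: c_def)
      ultimately show ?thesis by simp
    qed
    ultimately show "ennreal (c / \<psi> (1 / a)) \<le> emeasure (potential x) {0..a}"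
      by (meson ennreal_leI order_trans)
  qed
qed

end

context regular_spectrally_positive
begin

text \<open>On each block [a, 2 a) near 0 the two block estimates enclose U(x) between multiples of
  Lebesgue measure divided by \<open>a * \<psi> (1 / a)\<close>. The constants do not depend on a,
  so they pass through the sum over dyadic blocks.\<close>

lemma potential_comparable:
  assumes x: "0 < x"
  obtains D where "0 < D" "\<And>f \<delta>. f \<in> borel_measurable borel \<Longrightarrow> (\<And>u. 0 \<le> f u) \<Longrightarrow> 0 < \<delta> \<Longrightarrow> \<delta> \<le> D \<Longrightarrow>
    (\<integral>\<^sup>+u\<in>{0<..<\<delta>}. ennreal (f u) \<partial>potential x) < \<infinity> \<longleftrightarrow>
    (\<integral>\<^sup>+y\<in>{0<..<\<delta>}. ennreal (f y / (y * \<psi> (1 / y))) \<partial>lborel) < \<infinity>"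
proof -
  obtain C K where C: "1 \<le> C" and K: "p < K" and dbl: "\<And>l. K \<le> l \<Longrightarrow> \<psi> (2 * l) \<le> C * \<psi> l"
    using psi_doubling by auto
  have K0: "0 < K" using K p_nonneg by simp
  obtain c A where c: "0 < c" and A: "0 < A" and low: "\<And>a. 0 < a \<Longrightarrow> a \<le> A \<Longrightarrow> ennreal (c / \<psi> (1 / a)) \<le> emeasure (potential x) {0..a}"
    using potential_near_0[OF x] by blast
  \<comment> \<open>\<open>A\<close> is the range of the bound on [0, a]; \<open>1 / K\<close>
    brings 1/y into the doubling range; \<open>x / 2\<close> keeps 3 a below x on every block, as 2
    a is at most \<open>D\<close>.\<close>
  define D where "D = min A (min (1 / K) (x / 2))"
  have D: "0 < D" using A K0 x by (simp add: D_def)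
  show thesis
  proof (rule that[OF D])
    fix f :: "real \<Rightarrow> real" and \<delta> :: real
    assume f [measurable]: "f \<in> borel_measurable borel" and f0: "\<And>u. 0 \<le> f u" and \<delta>: "0 < \<delta>" "\<delta> \<le> D"
    let ?\<phi> = "\<lambda>y. f y / (y * \<psi> (1 / y))"
    let ?P = "\<lambda>S. \<integral>\<^sup>+u\<in>S. ennreal (f u) \<partial>potential x" and ?L = "\<lambda>S. \<integral>\<^sup>+y\<in>S. ennreal (?\<phi> y) \<partial>lborel"
    let ?I = "\<lambda>k. {\<delta> / 2 ^ Suc k..<\<delta> / 2 ^ k}"
    have block: "?P (?I k) \<le> ennreal (2 * exp 3) * ?L (?I k) \<and> ?L (?I k) \<le> ennreal (2 * C / c) * ?P (?I k)" for k
    proof -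
      define a where "a = \<delta> / 2 ^ Suc k"
      have a0: "0 < a" using \<delta> by (simp add: a_def)
      have a2: "\<delta> / 2 ^ k = 2 * a" by (simp add: a_def)
      have "\<delta> / 2 ^ k \<le> \<delta> / 1" using \<delta> by (intro divide_left_mono) simp_all
      then have a\<delta>: "2 * a \<le> \<delta>" by (simp add: a2)
      have aA: "a \<le> A" and aK: "2 * a \<le> 1 / K" and ax: "2 * a \<le> x / 2"
        using a\<delta> \<delta> a0 by (simp_all add: D_def)
      have inv: "K \<le> 1 / y" if "0 < y" "y \<le> 2 * a" for y
      proof -
        have "y \<le> 1 / K" using that aK by simp
        then show ?thesis using that K0 by (simp add: field_simps)
      qed
      have pa: "p < 1 / a" using inv[of a] a0 K by simp
      have psa: "0 < \<psi> (1 / a)" by (rule psi_pos[OF pa])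
      let ?g = "\<lambda>u. ennreal (f u) * indicator {a..<2 * a} u"
      have gm: "?g \<in> borel_measurable borel" by measurable
      have gs: "?g u = 0" if "u \<notin> {a..2 * a}" for u using that by (cases "u \<in> {a..<2 * a}") auto
      \<comment> \<open>On the block, 1/y lies between 1/(2 a) and 1/a, so monotonicity and a single
        doubling make \<open>y * \<psi> (1 / y)\<close> comparable to its value at a.\<close>
      have y: "0 < y" "0 < \<psi> (1 / y)" "y * \<psi> (1 / y) \<le> 2 * (a * \<psi> (1 / a))" "a * \<psi> (1 / a) \<le> C * (y * \<psi> (1 / y))"
        if "y \<in> {a..<2 * a}" for y
      proof -
        show y0: "0 < y" using that a0 by simp
        have Ky: "K \<le> 1 / y" using inv[OF y0] that by simp
        then show psy: "0 < \<psi> (1 / y)" using K by (intro psi_pos) simp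
        have "1 / y \<le> 1 / a" using that a0 by (intro divide_left_mono) simp_all
        then have "\<psi> (1 / y) \<le> \<psi> (1 / a)" using Ky K by (intro psi_mono) simp_all
        then have "y * \<psi> (1 / y) \<le> (2 * a) * \<psi> (1 / a)" using that a0 psy y0 by (intro mult_mono) simp_all
        then show "y * \<psi> (1 / y) \<le> 2 * (a * \<psi> (1 / a))" by simp
        have "1 / a \<le> 2 * (1 / y)" using that a0 y0 by (simp add: field_simps)
        then have "\<psi> (1 / a) \<le> \<psi> (2 * (1 / y))" using pa by (intro psi_mono) simp_all
        also have "\<dots> \<le> C * \<psi> (1 / y)" by (rule dbl[OF Ky])
        finally have "a * \<psi> (1 / a) \<le> y * (C * \<psi> (1 / y))" using that a0 psa y0 by (intro mult_mono) simp_all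
        then show "a * \<psi> (1 / a) \<le> C * (y * \<psi> (1 / y))" by (simp only: ac_simps)
      qed
      have P: "?P {a..<2 * a} \<le> ennreal (2 * exp 3) * ?L {a..<2 * a}"
      proof -
        have "?P {a..<2 * a} = ennreal (1 / a) * (ennreal a * ?P {a..<2 * a})"
          using a0 by (simp add: mult.assoc[symmetric] ennreal_mult'[symmetric])
        also have "\<dots> \<le> ennreal (1 / a) * (ennreal (exp 3 / \<psi> (1 / a)) * (\<integral>\<^sup>+u. ?g u \<partial>lborel))"
          by (rule mult_left_mono[OF potential_upper_block[OF a0 _ pa gm gs]]) (use ax a0 in simp_all)
        also have "\<dots> = (ennreal (1 / a) * ennreal (exp 3 / \<psi> (1 / a))) * (\<integral>\<^sup>+u. ?g u \<partial>lborel)" by (simp only: mult.assoc)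
        also have "\<dots> = (\<integral>\<^sup>+u. (ennreal (1 / a) * ennreal (exp 3 / \<psi> (1 / a))) * ?g u \<partial>lborel)"
          by (rule nn_integral_cmult[symmetric]) measurable
        also have "\<dots> \<le> (\<integral>\<^sup>+u. ennreal (2 * exp 3) * (ennreal (?\<phi> u) * indicator {a..<2 * a} u) \<partial>lborel)"
        proof (rule nn_integral_mono)
          fix u
          show "(ennreal (1 / a) * ennreal (exp 3 / \<psi> (1 / a))) * ?g u \<le> ennreal (2 * exp 3) * (ennreal (?\<phi> u) * indicator {a..<2 * a} u)"
          proof (cases "u \<in> {a..<2 * a}")
            case True
            note yu = y[OF True]
            have "f u / (a * \<psi> (1 / a)) \<le> 2 * ?\<phi> u"
            proof -
              have "f u / (2 * (a * \<psi> (1 / a))) \<le> f u / (u * \<psi> (1 / u))"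
                using yu f0[of u] a0 psa by (intro divide_left_mono mult_pos_pos) simp_all
              then show ?thesis by simp
            qed
            then have "exp 3 * (f u / (a * \<psi> (1 / a))) \<le> exp 3 * (2 * ?\<phi> u)" by (intro mult_left_mono) simp_all
            then have "1 / a * (exp 3 / \<psi> (1 / a)) * f u \<le> 2 * exp 3 * ?\<phi> u" by (simp add: ac_simps)
            then have "ennreal (1 / a * (exp 3 / \<psi> (1 / a)) * f u) \<le> ennreal (2 * exp 3 * ?\<phi> u)" by (rule ennreal_leI)
            moreover have "ennreal (1 / a * (exp 3 / \<psi> (1 / a)) * f u) = ennreal (1 / a) * ennreal (exp 3 / \<psi> (1 / a)) * ennreal (f u)"
            proof -
              have "0 \<le> 1 / a" "0 \<le> exp 3 / \<psi> (1 / a)" using a0 psa by simp_all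
              then show ?thesis by (simp only: ennreal_mult' mult_nonneg_nonneg)
            qed
            moreover have "ennreal (2 * exp 3 * ?\<phi> u) = ennreal (2 * exp 3) * ennreal (?\<phi> u)"
              by (rule ennreal_mult') simp
            ultimately show ?thesis using True by simp
          qed simp
        qed
        also have "\<dots> = ennreal (2 * exp 3) * ?L {a..<2 * a}" by (rule nn_integral_cmult) measurable
        finally show ?thesis .
      qed
      have Lo: "?L {a..<2 * a} \<le> ennreal (2 * C / c) * ?P {a..<2 * a}"
      proof -
        have "?L {a..<2 * a} \<le> (\<integral>\<^sup>+u. ennreal (C / a) * (ennreal (1 / \<psi> (1 / a)) * ?g u) \<partial>lborel)"
        proof (rule nn_integral_mono)
          fix u
          show "ennreal (?\<phi> u) * indicator {a..<2 * a} u \<le> ennreal (C / a) * (ennreal (1 / \<psi> (1 / a)) * ?g u)"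
          proof (cases "u \<in> {a..<2 * a}")
            case True
            note yu = y[OF True]
            have "f u * C / (C * (u * \<psi> (1 / u))) \<le> f u * C / (a * \<psi> (1 / a))"
              using yu f0[of u] a0 psa C by (intro divide_left_mono mult_pos_pos) simp_all
            moreover have "f u * C / (C * (u * \<psi> (1 / u))) = ?\<phi> u" using C by simp
            ultimately have "?\<phi> u \<le> C / a * (1 / \<psi> (1 / a) * f u)" by (simp add: ac_simps)
            then have "ennreal (?\<phi> u) \<le> ennreal (C / a * (1 / \<psi> (1 / a) * f u))" by (rule ennreal_leI)
            also have "\<dots> = ennreal (C / a) * (ennreal (1 / \<psi> (1 / a)) * ennreal (f u))"
            proof -
              have "0 \<le> C / a" "0 \<le> 1 / \<psi> (1 / a)" using a0 psa C by simp_all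
              then show ?thesis by (simp only: ennreal_mult')
            qed
            finally show ?thesis using True by simp
          qed simp
        qed
        also have "\<dots> = ennreal (C / a) * (ennreal (1 / \<psi> (1 / a)) * (\<integral>\<^sup>+u. ?g u \<partial>lborel))"
        proof -
          have "(\<integral>\<^sup>+u. ennreal (C / a) * (ennreal (1 / \<psi> (1 / a)) * ?g u) \<partial>lborel) = ennreal (C / a) * (\<integral>\<^sup>+u. ennreal (1 / \<psi> (1 / a)) * ?g u \<partial>lborel)"
            by (rule nn_integral_cmult) measurable
          moreover have "(\<integral>\<^sup>+u. ennreal (1 / \<psi> (1 / a)) * ?g u \<partial>lborel) = ennreal (1 / \<psi> (1 / a)) * (\<integral>\<^sup>+u. ?g u \<partial>lborel)"
            by (rule nn_integral_cmult) measurable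
          ultimately show ?thesis by simp
        qed
        also have "\<dots> = ennreal (C / (a * c)) * (ennreal (c / \<psi> (1 / a)) * (\<integral>\<^sup>+u. ?g u \<partial>lborel))"
        proof -
          have "ennreal (C / a) * ennreal (1 / \<psi> (1 / a)) = ennreal (C / (a * c)) * ennreal (c / \<psi> (1 / a))"
            using a0 psa C c by (simp add: ennreal_mult'[symmetric])
          then show ?thesis by (simp only: mult.assoc[symmetric])
        qed
        also have "\<dots> \<le> ennreal (C / (a * c)) * (emeasure (potential x) {0..a} * (\<integral>\<^sup>+u. ?g u \<partial>lborel))"
          by (intro mult_left_mono mult_right_mono low a0 aA) simp_all
        also have "\<dots> \<le> ennreal (C / (a * c)) * (ennreal (2 * a) * (\<integral>\<^sup>+u. ?g u \<partial>potential x))"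
          by (rule mult_left_mono[OF potential_lower_block[OF a0 _ gm gs]]) (use ax a0 x in simp_all)
        also have "\<dots> = ennreal (2 * C / c) * ?P {a..<2 * a}"
          using a0 c C by (simp add: mult.assoc[symmetric] ennreal_mult'[symmetric] mult.commute[of C])
        finally show ?thesis .
      qed
      show ?thesis using P Lo unfolding a2 a_def[symmetric] by simp
    qed
    have sP: "?P {0<..<\<delta>} = (\<Sum>k. ?P (?I k))"
      by (rule nn_integral_dyadic_blocks[OF sets_potential _ \<delta>(1)]) measurable
    have sL: "?L {0<..<\<delta>} = (\<Sum>k. ?L (?I k))"
      by (rule nn_integral_dyadic_blocks[OF sets_lborel _ \<delta>(1)]) measurable
    have "?P {0<..<\<delta>} \<le> ennreal (2 * exp 3) * ?L {0<..<\<delta>}"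
      unfolding sP sL ennreal_suminf_cmult[symmetric] using block by (intro suminf_le) simp_all
    moreover have "?L {0<..<\<delta>} \<le> ennreal (2 * C / c) * ?P {0<..<\<delta>}"
      unfolding sP sL ennreal_suminf_cmult[symmetric] using block by (intro suminf_le) simp_all
    moreover have "ennreal r * v < \<infinity>" if "v < \<infinity>" for r v using that by (simp add: ennreal_mult_less_top)
    ultimately show "?P {0<..<\<delta>} < \<infinity> \<longleftrightarrow> ?L {0<..<\<delta>} < \<infinity>" by (meson le_less_trans)
  qed
qed

end

section \<open>The Feynman-Kac equation\<close>

text \<open>The integral over the path after t, left in the original time scale: in this form it is
  visibly measurable jointly in t and the sample point, as Fubini's theorem demands.\<close>

definition occ_tail :: "(real \<Rightarrow> ennreal) \<Rightarrow> real \<Rightarrow> (real \<Rightarrow> real) \<Rightarrow> ennreal" where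
  "occ_tail k t z = (\<integral>\<^sup>+s. (if 0 \<le> s \<and> t \<le> s \<and> alive z s then k (z s) else 0) \<partial>lborel)"

text \<open>For bounded \<open>k\<close> a dying path has a finite occupation integral
  (\<open>occ_bounded_finite\<close>), so \<open>enn2real\<close> is faithful; an infinite integral
  would be sent to 0 and its exponential to 1.\<close>

definition fk_functional :: "(real \<Rightarrow> real) \<Rightarrow> (real \<Rightarrow> real) \<Rightarrow> ennreal" where
  "fk_functional k z = of_bool (dies z) * ennreal (exp (- enn2real (occ (\<lambda>u. ennreal (k u)) z)))"

lemma path_measurable_fk:
  assumes "0 < h" "k \<in> borel_measurable borel"
  shows "path_measurable h (fk_functional k)"
  unfolding fk_functional_def
proof (rule path_measurable_times[OF path_measurable_dies[OF assms(1)]])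
  have [measurable]: "(\<lambda>u. ennreal (k u)) \<in> borel_measurable borel" using assms(2) by measurable
  show "path_measurable h (\<lambda>z. ennreal (exp (- enn2real (occ (\<lambda>u. ennreal (k u)) z))))"
    by (rule path_measurable_comp[OF path_measurable_occ[OF assms(1)], where F="\<lambda>v. ennreal (exp (- enn2real v))"]) measurable
qed

lemma occ_shift:
  assumes t: "0 \<le> t" and a: "alive z t"
    and m: "(\<lambda>s. if 0 \<le> s \<and> t \<le> s \<and> alive z s then k (z s) else 0) \<in> borel_measurable borel"
  shows "occ k (\<lambda>s. z (t + s)) = occ_tail k t z"
proof -
  have "occ_tail k t z = (\<integral>\<^sup>+s. (if 0 \<le> t + 1 * s \<and> t \<le> t + 1 * s \<and> alive z (t + 1 * s) then k (z (t + 1 * s)) else 0) \<partial>lborel)"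
    unfolding occ_tail_def using nn_integral_real_affine[OF m, of 1 t] by simp
  also have "\<dots> = occ k (\<lambda>s. z (t + s))"
    unfolding occ_def using t a alive_add[of _ t z] by (intro nn_integral_cong) auto
  finally show ?thesis by simp
qed

lemma dies_imp_dead: "dies z \<Longrightarrow> \<exists>n::nat. \<forall>s. alive z s \<longrightarrow> s \<le> real n"
  unfolding dies_def by (meson alive_mono nle_le)

lemma occ_bounded_finite:
  assumes "dies z" "\<And>u. k u \<le> ennreal B"
  shows "occ k z < \<infinity>"
proof -
  obtain n :: nat where n: "\<And>s. alive z s \<Longrightarrow> s \<le> real n" using dies_imp_dead[OF assms(1)] by blast
  have "occ k z \<le> (\<integral>\<^sup>+s. ennreal B * indicator {0..real n} s \<partial>lborel)"
    unfolding occ_def using n assms(2) by (intro nn_integral_mono) (auto simp: indicator_def)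
  also have "\<dots> < \<infinity>" by (simp add: nn_integral_cmult_indicator ennreal_mult_less_top)
  finally show ?thesis .
qed

text \<open>This is \<open>integral_exp_neg_tail\<close> for the function k (z s) during the life of
  z. A bounded weight and a finite life make that function integrable.\<close>

lemma fk_pointwise:
  fixes k :: "real \<Rightarrow> real"
  assumes d: "dies z" and k: "\<And>u. 0 \<le> k u" "\<And>u. k u \<le> B"
    and m [measurable]: "(\<lambda>s. if 0 \<le> s \<and> alive z s then k (z s) else 0) \<in> borel_measurable borel"
  shows "(\<integral>\<^sup>+t. (if 0 \<le> t \<and> alive z t then ennreal (k (z t)) * ennreal (exp (- enn2real (occ_tail (\<lambda>u. ennreal (k u)) t z))) else 0) \<partial>lborel)
    + ennreal (exp (- enn2real (occ (\<lambda>u. ennreal (k u)) z))) = 1"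
proof -
  define g where "g s = (if 0 \<le> s \<and> alive z s then k (z s) else 0)" for s
  have g0: "0 \<le> g s" and gB: "g s \<le> B" for s using k(1)[of "z s"] k(2)[of "z s"] k(1)[of 0] k(2)[of 0] by (auto simp: g_def)
  have [measurable]: "g \<in> borel_measurable borel" using m by (simp only: g_def[abs_def])
  obtain n :: nat where n: "\<And>s. alive z s \<Longrightarrow> s \<le> real n" using dies_imp_dead[OF d] by blast
  have gi: "integrable lborel g"
  proof (rule Bochner_Integration.integrable_bound)
    show "integrable lborel (\<lambda>s. B * indicator {0..real n} s :: real)"
      by (rule integrable_mult_right, rule integrable_real_indicator) simp_all
    have "norm (g s) \<le> norm (B * indicator {0..real n} s)" for s
      using n[of s] k(1)[of "z s"] k(2)[of "z s"] by (auto simp: g_def indicator_def)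
    then show "AE s in lborel. norm (g s) \<le> norm (B * indicator {0..real n} s :: real)" by simp
  qed measurable
  define R where "R t = (\<integral>s. indicator {t<..} s * g s \<partial>lborel)" for t
  note E = integral_exp_neg_tail[OF gi g0 gB, folded R_def]
  have occ: "enn2real (occ (\<lambda>u. ennreal (k u)) z) = (\<integral>s. g s \<partial>lborel)"
  proof -
    have "occ (\<lambda>u. ennreal (k u)) z = (\<integral>\<^sup>+s. ennreal (g s) \<partial>lborel)"
      unfolding occ_def g_def by (intro nn_integral_cong) simp
    then show ?thesis using integral_eq_nn_integral[of g lborel] g0 by simp
  qed
  have tail: "enn2real (occ_tail (\<lambda>u. ennreal (k u)) t z) = R t" for t
  proof -
    have "occ_tail (\<lambda>u. ennreal (k u)) t z = (\<integral>\<^sup>+s. ennreal (indicator {t<..} s * g s) \<partial>lborel)"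
      unfolding occ_tail_def
    proof (rule nn_integral_cong_AE)
      show "AE s in lborel. (if 0 \<le> s \<and> t \<le> s \<and> alive z s then ennreal (k (z s)) else 0) = ennreal (indicator {t<..} s * g s)"
        using AE_lborel_singleton[of t] by eventually_elim (auto simp: g_def indicator_def)
    qed
    then show ?thesis using integral_eq_nn_integral[of "\<lambda>s. indicator {t<..} s * g s" lborel] g0 by (simp add: R_def)
  qed
  have "(\<integral>\<^sup>+t. (if 0 \<le> t \<and> alive z t then ennreal (k (z t)) * ennreal (exp (- R t)) else 0) \<partial>lborel)
     = (\<integral>\<^sup>+t. ennreal (g t * exp (- R t)) \<partial>lborel)"
    by (intro nn_integral_cong) (simp add: g_def k ennreal_mult')
  also have "\<dots> = ennreal (\<integral>t. g t * exp (- R t) \<partial>lborel)"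
    by (rule nn_integral_eq_integral[OF E(1)]) (simp add: g0)
  also have "\<dots> = ennreal (1 - exp (- (\<integral>s. g s \<partial>lborel)))" unfolding E(2) ..
  finally have 1: "(\<integral>\<^sup>+t. (if 0 \<le> t \<and> alive z t then ennreal (k (z t)) * ennreal (exp (- R t)) else 0) \<partial>lborel)
    = ennreal (1 - exp (- (\<integral>s. g s \<partial>lborel)))" .
  have "0 \<le> (\<integral>s. g s \<partial>lborel)" by (rule Bochner_Integration.integral_nonneg) (rule g0)
  then show ?thesis unfolding tail occ 1 by (simp add: ennreal_plus[symmetric] del: ennreal_plus)
qed

context spectrally_positive
begin

lemma occ_integrand_measurable:
  assumes [measurable]: "k \<in> borel_measurable borel" and \<omega>: "\<omega> \<in> space M"
  shows "(\<lambda>s. if 0 \<le> s \<and> t \<le> s \<and> alive (\<lambda>s. y + X s \<omega>) s then k (y + X s \<omega>) else (0 :: 'b :: {topological_space, zero})) \<in> borel_measurable borel"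
    "(\<lambda>s. if 0 \<le> s \<and> alive (\<lambda>s. y + X s \<omega>) s then k (y + X s \<omega>) else (0 :: 'b :: {topological_space, zero})) \<in> borel_measurable borel"
proof -
  have w [measurable]: "(\<lambda>s::real. \<omega>) \<in> measurable borel M" using \<omega> by simp
  show "(\<lambda>s. if 0 \<le> s \<and> t \<le> s \<and> alive (\<lambda>s. y + X s \<omega>) s then k (y + X s \<omega>) else (0 :: 'b)) \<in> borel_measurable borel"
    "(\<lambda>s. if 0 \<le> s \<and> alive (\<lambda>s. y + X s \<omega>) s then k (y + X s \<omega>) else (0 :: 'b)) \<in> borel_measurable borel"
    by measurable
qed

lemma measurable_occ_tail [measurable (raw)]:
  assumes [measurable]: "k \<in> borel_measurable borel" "t \<in> borel_measurable N" "g \<in> measurable N M"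
  shows "(\<lambda>w. occ_tail k (t w) (\<lambda>s. y + X s (g w))) \<in> borel_measurable N"
  unfolding occ_tail_def by measurable

text \<open>Integrating the Markov property over t turns functionals of the future into integrals
  against the potential measure. Time 0, which \<open>markov\<close> excludes, is a null
  set.\<close>

lemma markov_integrated:
  assumes y: "0 \<le> y" and [measurable]: "g \<in> borel_measurable borel"
    and \<Phi>: "\<And>t. 0 < t \<Longrightarrow> path_measurable t \<Phi>"
    and \<Phi>m: "(\<lambda>v. \<integral>\<^sup>+\<omega>'. \<Phi> (\<lambda>s. v + X s \<omega>') \<partial>M) \<in> borel_measurable borel"
  shows "(\<integral>\<^sup>+t. (\<integral>\<^sup>+\<omega>. (if 0 \<le> t \<and> alive (\<lambda>s. y + X s \<omega>) t then g (y + X t \<omega>) * \<Phi> (\<lambda>s. y + X (t + s) \<omega>) else 0) \<partial>M) \<partial>lborel)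
    = (\<integral>\<^sup>+u. g u * (\<integral>\<^sup>+\<omega>'. \<Phi> (\<lambda>s. u + X s \<omega>') \<partial>M) \<partial>potential y)"
proof -
  let ?F = "\<lambda>v. \<integral>\<^sup>+\<omega>'. \<Phi> (\<lambda>s. v + X s \<omega>') \<partial>M"
  note \<Phi>m [measurable]
  have "(\<integral>\<^sup>+t. (\<integral>\<^sup>+\<omega>. (if 0 \<le> t \<and> alive (\<lambda>s. y + X s \<omega>) t then g (y + X t \<omega>) * \<Phi> (\<lambda>s. y + X (t + s) \<omega>) else 0) \<partial>M) \<partial>lborel)
    = (\<integral>\<^sup>+t. (\<integral>\<^sup>+\<omega>. (if 0 \<le> t \<and> alive (\<lambda>s. y + X s \<omega>) t then g (y + X t \<omega>) * ?F (y + X t \<omega>) else 0) \<partial>M) \<partial>lborel)"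
  proof (rule nn_integral_cong_AE)
    show "AE t in lborel. (\<integral>\<^sup>+\<omega>. (if 0 \<le> t \<and> alive (\<lambda>s. y + X s \<omega>) t then g (y + X t \<omega>) * \<Phi> (\<lambda>s. y + X (t + s) \<omega>) else 0) \<partial>M)
      = (\<integral>\<^sup>+\<omega>. (if 0 \<le> t \<and> alive (\<lambda>s. y + X s \<omega>) t then g (y + X t \<omega>) * ?F (y + X t \<omega>) else 0) \<partial>M)"
      using AE_lborel_singleton[of 0]
    proof eventually_elim
      case (elim t)
      show ?case
      proof (cases "0 < t")
        case True
        then show ?thesis using markov[OF True \<Phi>[OF True] \<open>g \<in> borel_measurable borel\<close>, of y] by simp
      next
        case False
        then have "\<not> 0 \<le> t" using elim by simp
        then show ?thesis by simp
      qed
    qed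
  qed
  also have "\<dots> = (\<integral>\<^sup>+u. g u * ?F u \<partial>potential y)"
    by (rule nn_integral_potential(1)[symmetric]) measurable
  finally show ?thesis .
qed

lemma dies_emeasure: "0 \<le> v \<Longrightarrow> (\<integral>\<^sup>+\<omega>. of_bool (dies (\<lambda>s. v + X s \<omega>)) \<partial>M) = ennreal (exp (- p * v))"
proof -
  assume v: "0 \<le> v"
  have "(\<integral>\<^sup>+\<omega>. of_bool (dies (\<lambda>s. v + X s \<omega>)) \<partial>M) = (\<integral>\<^sup>+\<omega>. indicator {\<omega> \<in> space M. dies (\<lambda>s. v + X s \<omega>)} \<omega> \<partial>M)"
    by (intro nn_integral_cong) (simp add: indicator_def)
  also have "\<dots> = emeasure M {\<omega> \<in> space M. dies (\<lambda>s. v + X s \<omega>)}" by (rule nn_integral_indicator) measurable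
  also have "\<dots> = ennreal (exp (- p * v))" by (simp only: emeasure_eq_measure prob_dies[OF v])
  finally show ?thesis .
qed

text \<open>A shift during life does not affect dying, so the Markov property replaces the indicator
  of dying by its probability exp (- p u) from the current position u.\<close>

theorem occ_expectation:
  assumes y: "0 \<le> y" and [measurable]: "g \<in> borel_measurable borel"
  shows "(\<integral>\<^sup>+\<omega>. of_bool (dies (\<lambda>s. y + X s \<omega>)) * occ g (\<lambda>s. y + X s \<omega>) \<partial>M)
    = (\<integral>\<^sup>+u. g u * ennreal (exp (- p * u)) \<partial>potential y)"
proof -
  interpret P: pair_sigma_finite lborel M ..
  let ?z = "\<lambda>\<omega> s. y + X s \<omega>"
  have "(\<integral>\<^sup>+\<omega>. of_bool (dies (?z \<omega>)) * occ g (?z \<omega>) \<partial>M)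
    = (\<integral>\<^sup>+\<omega>. (\<integral>\<^sup>+t. (if 0 \<le> t \<and> alive (?z \<omega>) t then g (?z \<omega> t) * of_bool (dies (?z \<omega>)) else 0) \<partial>lborel) \<partial>M)"
  proof (rule nn_integral_cong)
    fix \<omega> assume \<omega>: "\<omega> \<in> space M"
    show "of_bool (dies (?z \<omega>)) * occ g (?z \<omega>) = (\<integral>\<^sup>+t. (if 0 \<le> t \<and> alive (?z \<omega>) t then g (?z \<omega> t) * of_bool (dies (?z \<omega>)) else 0) \<partial>lborel)"
      unfolding occ_def by (cases "dies (?z \<omega>)") (simp_all cong: if_cong)
  qed
  also have "\<dots> = (\<integral>\<^sup>+t. (\<integral>\<^sup>+\<omega>. (if 0 \<le> t \<and> alive (?z \<omega>) t then g (?z \<omega> t) * of_bool (dies (?z \<omega>)) else 0) \<partial>M) \<partial>lborel)"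
    by (rule P.Fubini') measurable
  also have "\<dots> = (\<integral>\<^sup>+t. (\<integral>\<^sup>+\<omega>. (if 0 \<le> t \<and> alive (?z \<omega>) t then g (?z \<omega> t) * of_bool (dies (\<lambda>s. y + X (t + s) \<omega>)) else 0) \<partial>M) \<partial>lborel)"
    using dies_shift by (intro nn_integral_cong) auto
  also have "\<dots> = (\<integral>\<^sup>+u. g u * (\<integral>\<^sup>+\<omega>'. of_bool (dies (\<lambda>s. u + X s \<omega>')) \<partial>M) \<partial>potential y)"
    by (rule markov_integrated[OF y _ path_measurable_dies]) measurable
  also have "\<dots> = (\<integral>\<^sup>+u. g u * ennreal (exp (- p * u)) \<partial>potential y)"
    using potential_nonneg[OF y]
    by (intro nn_integral_cong_AE) (auto elim!: eventually_mono simp only: dies_emeasure)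
  finally show ?thesis .
qed

definition fk :: "(real \<Rightarrow> real) \<Rightarrow> real \<Rightarrow> ennreal" where
  "fk k y = (\<integral>\<^sup>+\<omega>. fk_functional k (\<lambda>s. y + X s \<omega>) \<partial>M)"

lemma measurable_fk [measurable]:
  assumes [measurable]: "k \<in> borel_measurable borel"
  shows "fk k \<in> borel_measurable borel"
  unfolding fk_def[abs_def] fk_functional_def by measurable

text \<open>Multiply \<open>fk_pointwise\<close> by the indicator of dying and take expectations.
  The total is exp (- p y), and inside the time integral the Markov property turns the functional of
  the path after t into \<open>fk\<close> at the current position.\<close>

theorem feynman_kac:
  assumes y: "0 \<le> y" and m [measurable]: "k \<in> borel_measurable borel" and k: "\<And>u. 0 \<le> k u" "\<And>u. k u \<le> B"
  shows "(\<integral>\<^sup>+u. ennreal (k u) * fk k u \<partial>potential y) + fk k y = ennreal (exp (- p * y))"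
proof -
  interpret P: pair_sigma_finite lborel M ..
  let ?z = "\<lambda>\<omega> s. y + X s \<omega>" and ?k = "\<lambda>u. ennreal (k u)"
  let ?h = "\<lambda>t \<omega>. (if 0 \<le> t \<and> alive (?z \<omega>) t then ?k (?z \<omega> t) * (of_bool (dies (?z \<omega>)) * ennreal (exp (- enn2real (occ_tail ?k t (?z \<omega>))))) else 0)"
  have hm: "(\<lambda>(t, \<omega>). ?h t \<omega>) \<in> borel_measurable (lborel \<Otimes>\<^sub>M M)" by measurable
  have "(\<integral>\<^sup>+u. ?k u * fk k u \<partial>potential y)
    = (\<integral>\<^sup>+t. (\<integral>\<^sup>+\<omega>. (if 0 \<le> t \<and> alive (?z \<omega>) t then ?k (?z \<omega> t) * fk_functional k (\<lambda>s. y + X (t + s) \<omega>) else 0) \<partial>M) \<partial>lborel)"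
    unfolding fk_def
    by (rule markov_integrated[OF y _ path_measurable_fk[OF _ m], symmetric])
       (use measurable_fk[OF m, unfolded fk_def[abs_def]] in measurable)
  also have "\<dots> = (\<integral>\<^sup>+t. (\<integral>\<^sup>+\<omega>. ?h t \<omega> \<partial>M) \<partial>lborel)"
  proof (intro nn_integral_cong)
    fix t \<omega> assume \<omega>: "\<omega> \<in> space M"
    show "(if 0 \<le> t \<and> alive (?z \<omega>) t then ?k (?z \<omega> t) * fk_functional k (\<lambda>s. y + X (t + s) \<omega>) else 0) = ?h t \<omega>"
    proof (cases "0 \<le> t \<and> alive (?z \<omega>) t")
      case True
      then have t: "0 \<le> t" and a: "alive (?z \<omega>) t" by auto
      have "fk_functional k (\<lambda>s. y + X (t + s) \<omega>) = of_bool (dies (?z \<omega>)) * ennreal (exp (- enn2real (occ_tail ?k t (?z \<omega>))))"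
        unfolding fk_functional_def dies_shift[OF t a]
        by (subst occ_shift[OF t a]) (use occ_integrand_measurable(1)[of ?k, OF _ \<omega>] in simp_all)
      then show ?thesis using True by simp
    next
      case False
      then show ?thesis by (simp only: if_False)
    qed
  qed
  also have "\<dots> = (\<integral>\<^sup>+\<omega>. (\<integral>\<^sup>+t. ?h t \<omega> \<partial>lborel) \<partial>M)"
    by (rule P.Fubini'[OF hm, symmetric])
  finally have "(\<integral>\<^sup>+u. ?k u * fk k u \<partial>potential y) + fk k y = (\<integral>\<^sup>+\<omega>. (\<integral>\<^sup>+t. ?h t \<omega> \<partial>lborel) \<partial>M) + (\<integral>\<^sup>+\<omega>. fk_functional k (?z \<omega>) \<partial>M)"
    by (simp only: fk_def)
  also have "\<dots> = (\<integral>\<^sup>+\<omega>. (\<integral>\<^sup>+t. ?h t \<omega> \<partial>lborel) + fk_functional k (?z \<omega>) \<partial>M)"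
    by (rule nn_integral_add[symmetric]) (unfold fk_functional_def, measurable)
  also have "\<dots> = (\<integral>\<^sup>+\<omega>. of_bool (dies (?z \<omega>)) \<partial>M)"
  proof (rule nn_integral_cong)
    fix \<omega> assume \<omega>: "\<omega> \<in> space M"
    show "(\<integral>\<^sup>+t. ?h t \<omega> \<partial>lborel) + fk_functional k (?z \<omega>) = of_bool (dies (?z \<omega>))"
    proof (cases "dies (?z \<omega>)")
      case True
      then have 1: "of_bool (dies (?z \<omega>)) = (1::ennreal)" by simp
      show ?thesis unfolding fk_functional_def 1 mult_1_left
        by (rule fk_pointwise[OF True k occ_integrand_measurable(2)[OF m \<omega>]])
    next
      case False
      have "(\<integral>\<^sup>+t. ?h t \<omega> \<partial>lborel) = (\<integral>\<^sup>+t. 0 \<partial>(lborel :: real measure))"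
        using False by (intro nn_integral_cong) simp
      then show ?thesis using False by (simp add: fk_functional_def)
    qed
  qed
  also have "\<dots> = ennreal (exp (- p * y))" by (rule dies_emeasure[OF y])
  finally show ?thesis .
qed

lemma fk_mono:
  assumes y: "0 \<le> y" "y \<le> x" and m [measurable]: "k \<in> borel_measurable borel" and k: "\<And>u. 0 \<le> k u" "\<And>u. k u \<le> B"
  shows "fk k x \<le> fk k y"
proof -
  let ?e = "\<lambda>y. ennreal (exp (p * y))" and ?I = "\<lambda>y. \<integral>\<^sup>+u. ennreal (k u) * fk k u \<partial>potential y"
  have norm: "?e y * ?I y + ?e y * fk k y = 1" if "0 \<le> y" for y
  proof -
    have "?e y * ?I y + ?e y * fk k y = ?e y * (?I y + fk k y)" by (simp only: distrib_left)
    also have "\<dots> = 1" unfolding feynman_kac[OF that m k] by (simp add: ennreal_mult'[symmetric] mult_exp_exp)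
    finally show ?thesis .
  qed
  have mono: "?e y * ?I y \<le> ?e x * ?I x" by (rule potential_mono_start[OF y]) measurable
  have nx: "?e x * ?I x + ?e x * fk k x = 1" using norm y by simp
  have ny: "?e y * ?I y + ?e y * fk k y = 1" using norm y by simp
  \<comment> \<open>Cancelling a summand in \<open>ennreal\<close> requires it to be finite.\<close>
  have fin: "?e y * ?I y \<noteq> \<top>" using ny by (metis ennreal_add_eq_top ennreal_one_neq_top)
  have "?e y * ?I y + ?e x * fk k x \<le> ?e x * ?I x + ?e x * fk k x" using mono by (rule add_right_mono)
  also have "\<dots> = ?e y * ?I y + ?e y * fk k y" using nx ny by simp
  finally have "?e x * fk k x \<le> ?e y * fk k y" using fin by (simp add: ennreal_add_left_cancel_le)
  \<comment> \<open>Since y \<le> x, replacing exp (p x) by exp (p y) goes in the right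
    direction.\<close>
  moreover have "?e y * fk k x \<le> ?e x * fk k x"
    using y p_nonneg by (intro mult_right_mono ennreal_leI) (simp_all add: mult_left_mono)
  ultimately have "?e y * fk k x \<le> ?e y * fk k y" by (rule order_trans[rotated])
  then have "ennreal (exp (- p * y)) * (?e y * fk k x) \<le> ennreal (exp (- p * y)) * (?e y * fk k y)"
    by (rule mult_left_mono) simp
  then show ?thesis by (simp add: mult.assoc[symmetric] ennreal_mult'[symmetric] mult_exp_exp)
qed

end

section \<open>The exit time and finiteness of occupation integrals\<close>

context spectrally_positive
begin

text \<open>\<open>bad\<close> is the event of being alive from \<open>x\<close> but from no starting point below \<open>x\<close>; its weighted
  occupation time \<open>W\<close> vanishes because the Laplace transform of the potential measure is continuous
  in the starting point.\<close>

lemma exit_time_AE: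
  assumes x: "0 < x"
  shows "AE \<omega> in M. (exit_time (\<lambda>s. x + X s \<omega>) < \<infinity> \<longleftrightarrow> dies (\<lambda>s. x + X s \<omega>)) \<and>
    (AE t in lborel. 0 \<le> t \<longrightarrow> (ereal t < exit_time (\<lambda>s. x + X s \<omega>) \<longleftrightarrow> alive (\<lambda>s. x + X s \<omega>) t))"
proof -
  interpret P: pair_sigma_finite lborel M ..
  define l where "l = p + 1"
  have pl: "p < l" by (simp add: l_def)
  have psl: "0 < \<psi> l" by (rule psi_pos[OF pl])
  \<comment> \<open>A sequence tending to 0; the summand 2 keeps \<open>x - e n\<close> strictly
    positive for every n.\<close>
  define e where "e n = x / real (n + 2)" for n :: nat
  have e: "0 < e n" "e n < x" for n using x by (simp_all add: e_def divide_less_eq)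
  define bad where "bad t \<omega> \<longleftrightarrow> 0 \<le> t \<and> alive (\<lambda>s. x + X s \<omega>) t \<and> (\<forall>n. \<not> alive (\<lambda>s. (x - e n) + X s \<omega>) t)" for t \<omega>
  have bm [measurable]: "Measurable.pred (lborel \<Otimes>\<^sub>M M) (\<lambda>w. bad (fst w) (snd w))"
    "Measurable.pred (M \<Otimes>\<^sub>M lborel) (\<lambda>w. bad (snd w) (fst w))" unfolding bad_def by measurable
  let ?E = "\<lambda>t \<omega>. ennreal (exp (- l * (x + X t \<omega>)))"
  define W where "W = (\<integral>\<^sup>+t. (\<integral>\<^sup>+\<omega>. (if bad t \<omega> then ?E t \<omega> else 0) \<partial>M) \<partial>lborel)"
  \<comment> \<open>The weight is attached to the path from x, so for the start y the transform
    acquires the factor exp (- l (x - y)). \<open>J\<close> is finite and continuous in y, which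
    forces \<open>W\<close> to vanish in the limit.\<close>
  define J where "J y = exp (- l * (x - y)) * ((exp (- p * y) - exp (- l * y)) / \<psi> l)" for y
  have Jnn: "0 \<le> (exp (- p * y) - exp (- l * y)) / \<psi> l" if "0 \<le> y" for y
  proof -
    have "p * y \<le> l * y" using that by (intro mult_right_mono) (simp_all add: l_def)
    then show ?thesis using psl by (intro divide_nonneg_pos) simp_all
  qed
  have pot: "(\<integral>\<^sup>+t. (\<integral>\<^sup>+\<omega>. (if 0 \<le> t \<and> alive (\<lambda>s. y + X s \<omega>) t then ?E t \<omega> else 0) \<partial>M) \<partial>lborel) = ennreal (J y)"
    if y: "0 \<le> y" for y
  proof -
    have s: "?E t \<omega> = ennreal (exp (- l * (x - y))) * ennreal (exp (- l * (y + X t \<omega>)))" for t \<omega>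
      unfolding ennreal_mult'[OF exp_ge_zero, symmetric] mult_exp_exp
      by (rule arg_cong[where f="\<lambda>v. ennreal (exp v)"]) (simp add: algebra_simps)
    have "(\<integral>\<^sup>+t. (\<integral>\<^sup>+\<omega>. (if 0 \<le> t \<and> alive (\<lambda>s. y + X s \<omega>) t then ?E t \<omega> else 0) \<partial>M) \<partial>lborel)
      = (\<integral>\<^sup>+u. ennreal (exp (- l * (x - y))) * ennreal (exp (- l * u)) \<partial>potential y)"
      unfolding s by (rule nn_integral_potential(1)[symmetric]) measurable
    also have "\<dots> = ennreal (exp (- l * (x - y))) * (\<integral>\<^sup>+u. ennreal (exp (- l * u)) \<partial>potential y)"
      by (rule nn_integral_cmult) measurable
    also have "\<dots> = ennreal (J y)"
      unfolding potential_laplace[OF pl y] J_def by (rule ennreal_mult'[symmetric]) simp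
    finally show ?thesis .
  qed
  have mono: "alive (\<lambda>s. x + X s \<omega>) t" if "alive (\<lambda>s. (x - e n) + X s \<omega>) t" for n t \<omega>
    unfolding alive_def
  proof (intro allI impI)
    fix s assume "0 \<le> s \<and> s < t"
    then have "0 \<le> (x - e n) + X s \<omega>" using that unfolding alive_def by blast
    then show "0 \<le> x + X s \<omega>" using e(1)[of n] by simp
  qed
  \<comment> \<open>\<open>bad\<close> and survival from \<open>x - e n\<close> exclude each other,
    and both imply survival from x.\<close>
  have le: "W + ennreal (J (x - e n)) \<le> ennreal (J x)" for n
  proof -
    let ?A = "\<lambda>t \<omega>. if bad t \<omega> then ?E t \<omega> else 0"
    let ?B = "\<lambda>t \<omega>. if 0 \<le> t \<and> alive (\<lambda>s. (x - e n) + X s \<omega>) t then ?E t \<omega> else 0"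
    have "W + ennreal (J (x - e n)) = W + (\<integral>\<^sup>+t. (\<integral>\<^sup>+\<omega>. ?B t \<omega> \<partial>M) \<partial>lborel)"
      using pot[of "x - e n"] e(2)[of n] by simp
    also have "\<dots> = (\<integral>\<^sup>+t. (\<integral>\<^sup>+\<omega>. ?A t \<omega> \<partial>M) + (\<integral>\<^sup>+\<omega>. ?B t \<omega> \<partial>M) \<partial>lborel)"
      unfolding W_def by (rule nn_integral_add[symmetric]) measurable
    also have "\<dots> = (\<integral>\<^sup>+t. (\<integral>\<^sup>+\<omega>. ?A t \<omega> + ?B t \<omega> \<partial>M) \<partial>lborel)"
    proof (rule nn_integral_cong)
      fix t :: real
      have [measurable]: "Measurable.pred M (bad t)" unfolding bad_def[abs_def] by measurable
      show "(\<integral>\<^sup>+\<omega>. ?A t \<omega> \<partial>M) + (\<integral>\<^sup>+\<omega>. ?B t \<omega> \<partial>M) = (\<integral>\<^sup>+\<omega>. ?A t \<omega> + ?B t \<omega> \<partial>M)"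
        by (rule nn_integral_add[symmetric]) measurable
    qed
    also have "\<dots> \<le> (\<integral>\<^sup>+t. (\<integral>\<^sup>+\<omega>. (if 0 \<le> t \<and> alive (\<lambda>s. x + X s \<omega>) t then ?E t \<omega> else 0) \<partial>M) \<partial>lborel)"
      using mono[of n] by (intro nn_integral_mono) (auto simp: bad_def)
    also have "\<dots> = ennreal (J x)" using pot x by simp
    finally show ?thesis .
  qed
  have e0: "e \<longlonglongrightarrow> 0"
  proof -
    have "(\<lambda>n. x * (1 / real (n + 2))) \<longlonglongrightarrow> x * 0"
      using LIMSEQ_ignore_initial_segment[OF lim_inverse_n', of 2] by (intro tendsto_intros) simp
    then show ?thesis by (simp add: e_def[abs_def])
  qed
  have "(\<lambda>n. J (x - e n)) \<longlonglongrightarrow> J (x - 0)"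
    unfolding J_def using psl by (intro tendsto_intros e0) simp_all
  then have "(\<lambda>n. W + ennreal (J (x - e n))) \<longlonglongrightarrow> W + ennreal (J x)"
    by (intro tendsto_add tendsto_const tendsto_ennrealI) simp
  then have "W + ennreal (J x) \<le> ennreal (J x)" by (rule LIMSEQ_le_const2) (use le in blast)
  then have "ennreal (J x) + W \<le> ennreal (J x) + 0" by (simp add: add.commute)
  then have W0: "W = 0" by (subst (asm) ennreal_add_left_cancel_le) simp
  have swap: "W = (\<integral>\<^sup>+\<omega>. (\<integral>\<^sup>+t. (if bad t \<omega> then ?E t \<omega> else 0) \<partial>lborel) \<partial>M)"
    unfolding W_def by (rule P.Fubini'[symmetric]) measurable
  have "(\<lambda>\<omega>. \<integral>\<^sup>+t. (if bad t \<omega> then ?E t \<omega> else 0) \<partial>lborel) \<in> borel_measurable M"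
    by measurable
  from nn_integral_0_iff_AE[OF this] have "AE \<omega> in M. (\<integral>\<^sup>+t. (if bad t \<omega> then ?E t \<omega> else 0) \<partial>lborel) = 0"
    using W0 unfolding swap by simp
  with AE_space show ?thesis
  proof eventually_elim
    case (elim \<omega>)
    let ?z = "\<lambda>s. x + X s \<omega>"
    have [measurable]: "(\<lambda>t::real. \<omega>) \<in> measurable borel M" using elim(1) by simp
    have [measurable]: "Measurable.pred borel (\<lambda>t. bad t \<omega>)" unfolding bad_def by measurable
    have "(\<lambda>t. if bad t \<omega> then ?E t \<omega> else 0) \<in> borel_measurable lborel" by measurable
    from nn_integral_0_iff_AE[OF this] elim(2)
    have "AE t in lborel. (if bad t \<omega> then ?E t \<omega> else 0) = 0" by simp
    then have nb: "AE t in lborel. \<not> bad t \<omega>" by eventually_elim (simp split: if_splits)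
    have z0: "0 < ?z 0" using x by simp
    have sub: "alive ?z t" if "ereal t < exit_time ?z" for t
      by (rule less_exit_time_imp_alive[OF path z0 that])
    have AEt: "AE t in lborel. 0 \<le> t \<longrightarrow> (ereal t < exit_time ?z \<longleftrightarrow> alive ?z t)"
      using nb
    proof eventually_elim
      case (elim t)
      show ?case
      proof (intro impI iffI)
        assume t: "0 \<le> t" and "alive ?z t"
        then obtain n where n: "alive (\<lambda>s. (x - e n) + X s \<omega>) t" using elim by (auto simp: bad_def)
        show "ereal t < exit_time ?z"
        proof (rule bounded_below_imp_less_exit_time[OF path z0 t e(1)])
          fix s assume "0 \<le> s" "s < t"
          then have "0 \<le> (x - e n) + X s \<omega>" using n unfolding alive_def by blast
          then show "e n \<le> x + X s \<omega>" by simp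
        qed
      qed (rule sub)
    qed
    have "exit_time ?z < \<infinity> \<longleftrightarrow> dies ?z"
    proof
      assume d: "dies ?z"
      show "exit_time ?z < \<infinity>"
      proof (rule ccontr)
        assume "\<not> exit_time ?z < \<infinity>"
        then have "exit_time ?z = \<infinity>" by simp
        then have "alive ?z (real n)" for n by (intro sub) simp
        then show False using d by (simp add: dies_def)
      qed
    next
      assume fin: "exit_time ?z < \<infinity>"
      show "dies ?z"
      proof (rule ccontr)
        assume "\<not> dies ?z"
        \<comment> \<open>Survival forever puts almost every nonnegative time before the exit time.
          A finite exit time contradicts this, as the half-line after it has positive
          measure.\<close>
        then have al: "alive ?z t" for t
          unfolding dies_def by (meson alive_mono real_arch_simple)
        obtain r where r: "exit_time ?z \<le> ereal r"
        proof (cases "exit_time ?z")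
          case (real r)
          then show ?thesis using that[of r] by simp
        next
          case PInf
          then show ?thesis using fin by simp
        next
          case MInf
          then show ?thesis using that[of 0] by simp
        qed
        have "AE t in lborel. \<not> max r 0 \<le> t"
          using AEt
        proof eventually_elim
          case (elim t)
          show ?case
          proof
            assume t: "max r 0 \<le> t"
            then have "ereal t < exit_time ?z" using elim al by simp
            also have "\<dots> \<le> ereal r" by (rule r)
            finally show False using t by simp
          qed
        qed
        then have "emeasure lborel {t \<in> space lborel. \<not> \<not> max r 0 \<le> t} = 0"
          by (subst (asm) AE_iff_measurable[OF _ refl]) simp_all
        moreover have "{t \<in> space lborel. \<not> \<not> max r 0 \<le> t} = {max r 0..}" by auto
        moreover have "emeasure lborel {max r 0..} \<ge> emeasure lborel {max r 0..max r 0 + 1}"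
          by (rule emeasure_mono) auto
        ultimately show False by simp
      qed
    qed
    with AEt show ?case by blast
  qed
qed

lemma occ_mono: "(\<And>u. k u \<le> k' u) \<Longrightarrow> occ k z \<le> occ k' z"
  unfolding occ_def by (intro nn_integral_mono) simp

context
  fixes f :: "real \<Rightarrow> real" and x :: real
  assumes f_meas [measurable]: "f \<in> borel_measurable borel"
    and f_nonneg: "\<And>u. 0 \<le> f u" and f_nonpos: "\<And>u. u \<le> 0 \<Longrightarrow> f u = 0"
    and f_bdd: "\<And>\<epsilon>. 0 < \<epsilon> \<Longrightarrow> \<exists>B. \<forall>u\<ge>\<epsilon>. f u \<le> B"
    and x: "0 < x"
begin

text \<open>By \<open>occ_expectation\<close> the left-hand side is the integral of f(u) exp (- (l +
  p) u) against U(x). Above d, \<open>f\<close> is bounded and the Laplace transform of U(x) is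
  finite; below d the exponential lies between two positive constants. Hence neither l nor d
  influences finiteness.\<close>

lemma discounted_occ_finite_iff:
  assumes d: "0 < d" and l: "0 < l"
  shows "(\<integral>\<^sup>+\<omega>. of_bool (dies (\<lambda>s. x + X s \<omega>)) * occ (\<lambda>u. ennreal (f u * exp (- l * u))) (\<lambda>s. x + X s \<omega>) \<partial>M) < \<infinity>
    \<longleftrightarrow> (\<integral>\<^sup>+u\<in>{0<..<d}. ennreal (f u) \<partial>potential x) < \<infinity>"
proof -
  have x0: "0 \<le> x" using x by simp
  define m where "m = l + p"
  have m: "p < m" "0 < m" using l p_nonneg by (simp_all add: m_def)
  have "(\<integral>\<^sup>+\<omega>. of_bool (dies (\<lambda>s. x + X s \<omega>)) * occ (\<lambda>u. ennreal (f u * exp (- l * u))) (\<lambda>s. x + X s \<omega>) \<partial>M)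
    = (\<integral>\<^sup>+u. ennreal (f u * exp (- l * u)) * ennreal (exp (- p * u)) \<partial>potential x)"
    by (rule occ_expectation[OF x0]) measurable
  also have "\<dots> = (\<integral>\<^sup>+u. ennreal (f u * exp (- m * u)) \<partial>potential x)"
  proof (rule nn_integral_cong)
    fix u
    have "f u * exp (- l * u) * exp (- p * u) = f u * exp (- m * u)"
      by (simp add: mult.assoc mult_exp_exp m_def algebra_simps)
    then show "ennreal (f u * exp (- l * u)) * ennreal (exp (- p * u)) = ennreal (f u * exp (- m * u))"
      by (metis ennreal_mult'' exp_ge_zero)
  qed
  finally have eq: "(\<integral>\<^sup>+\<omega>. of_bool (dies (\<lambda>s. x + X s \<omega>)) * occ (\<lambda>u. ennreal (f u * exp (- l * u))) (\<lambda>s. x + X s \<omega>) \<partial>M)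
    = (\<integral>\<^sup>+u. ennreal (f u * exp (- m * u)) \<partial>potential x)" .
  let ?I = "\<integral>\<^sup>+u. ennreal (f u * exp (- m * u)) \<partial>potential x" and ?J = "\<integral>\<^sup>+u\<in>{0<..<d}. ennreal (f u) \<partial>potential x"
  obtain B where B: "\<And>u. d \<le> u \<Longrightarrow> f u \<le> B" using f_bdd[OF d] by blast
  have up: "?I \<le> ?J + ennreal B * (\<integral>\<^sup>+u. ennreal (exp (- m * u)) \<partial>potential x)"
  proof -
    have "?I \<le> (\<integral>\<^sup>+u. ennreal (f u) * indicator {0<..<d} u + ennreal B * ennreal (exp (- m * u)) \<partial>potential x)"
    proof (rule nn_integral_mono)
      fix u
      consider "u \<le> 0" | "0 < u" "u < d" | "d \<le> u" by linarith
      then show "ennreal (f u * exp (- m * u)) \<le> ennreal (f u) * indicator {0<..<d} u + ennreal B * ennreal (exp (- m * u))"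
      proof cases
        case 1
        then show ?thesis by (simp add: f_nonpos)
      next
        case 2
        have "f u * exp (- m * u) \<le> f u" using 2 m f_nonneg[of u] by (intro mult_left_le) simp_all
        then have "ennreal (f u * exp (- m * u)) \<le> ennreal (f u)" by (rule ennreal_leI)
        then show ?thesis using 2 by (simp add: add_increasing2)
      next
        case 3
        have "f u * exp (- m * u) \<le> B * exp (- m * u)" using B[OF 3] by (intro mult_right_mono) simp_all
        then have "ennreal (f u * exp (- m * u)) \<le> ennreal (B * exp (- m * u))" by (rule ennreal_leI)
        also have "\<dots> = ennreal B * ennreal (exp (- m * u))" by (rule ennreal_mult'') simp
        finally show ?thesis by (simp add: add_increasing)
      qed
    qed
    also have "\<dots> = ?J + (\<integral>\<^sup>+u. ennreal B * ennreal (exp (- m * u)) \<partial>potential x)"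
      by (rule nn_integral_add) measurable
    also have "(\<integral>\<^sup>+u. ennreal B * ennreal (exp (- m * u)) \<partial>potential x) = ennreal B * (\<integral>\<^sup>+u. ennreal (exp (- m * u)) \<partial>potential x)"
      by (rule nn_integral_cmult) measurable
    finally show ?thesis by simp
  qed
  have lo: "?J \<le> ennreal (exp (m * d)) * ?I"
  proof -
    have "?J \<le> (\<integral>\<^sup>+u. ennreal (exp (m * d)) * ennreal (f u * exp (- m * u)) \<partial>potential x)"
    proof (rule nn_integral_mono)
      fix u
      show "ennreal (f u) * indicator {0<..<d} u \<le> ennreal (exp (m * d)) * ennreal (f u * exp (- m * u))"
      proof (cases "u \<in> {0<..<d}")
        case True
        have "m * u \<le> m * d" using True m by (intro mult_left_mono) simp_all
        then have "1 \<le> exp (m * d) * exp (- m * u)" unfolding mult_exp_exp by simp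
        then have "f u * 1 \<le> f u * (exp (m * d) * exp (- m * u))" by (rule mult_left_mono) (rule f_nonneg)
        then have "f u \<le> exp (m * d) * (f u * exp (- m * u))" by (simp add: ac_simps)
        then have "ennreal (f u) \<le> ennreal (exp (m * d) * (f u * exp (- m * u)))" by (rule ennreal_leI)
        also have "\<dots> = ennreal (exp (m * d)) * ennreal (f u * exp (- m * u))" by (rule ennreal_mult') simp
        finally show ?thesis using True by simp
      qed simp
    qed
    also have "\<dots> = ennreal (exp (m * d)) * ?I" by (rule nn_integral_cmult) measurable
    finally show ?thesis .
  qed
  have "ennreal B * (\<integral>\<^sup>+u. ennreal (exp (- m * u)) \<partial>potential x) < \<infinity>"
    unfolding potential_laplace[OF m(1) x0] by (simp add: ennreal_mult_less_top)
  then have "?J < \<infinity> \<Longrightarrow> ?I < \<infinity>" using up by (auto intro: le_less_trans)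
  moreover have "?I < \<infinity> \<Longrightarrow> ?J < \<infinity>" using lo by (auto intro: le_less_trans simp: ennreal_mult_less_top)
  ultimately show ?thesis unfolding eq by blast
qed

text \<open>Split \<open>f\<close> at d. The part below d has finite expectation on the event of
  dying, hence is almost surely finite there; the part above d is bounded and integrated over a
  finite life.\<close>

lemma occ_finite_AE:
  assumes d: "0 < d" and J: "(\<integral>\<^sup>+u\<in>{0<..<d}. ennreal (f u) \<partial>potential x) < \<infinity>"
  shows "AE \<omega> in M. dies (\<lambda>s. x + X s \<omega>) \<longrightarrow> occ (\<lambda>u. ennreal (f u)) (\<lambda>s. x + X s \<omega>) < \<infinity>"
proof -
  have x0: "0 \<le> x" using x by simp
  obtain B where B: "\<And>u. d \<le> u \<Longrightarrow> f u \<le> B" using f_bdd[OF d] by blast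
  let ?z = "\<lambda>\<omega> s. x + X s \<omega>" and ?g = "\<lambda>u. ennreal (f u) * indicator {0<..<d} u" and ?h = "\<lambda>u. ennreal (f u) * indicator {d..} u"
  have "(\<integral>\<^sup>+\<omega>. of_bool (dies (?z \<omega>)) * occ ?g (?z \<omega>) \<partial>M) = (\<integral>\<^sup>+u. ?g u * ennreal (exp (- p * u)) \<partial>potential x)"
    by (rule occ_expectation[OF x0]) measurable
  also have "\<dots> \<le> (\<integral>\<^sup>+u. ?g u \<partial>potential x)"
  proof (rule nn_integral_mono)
    fix u
    show "?g u * ennreal (exp (- p * u)) \<le> ?g u"
    proof (cases "u \<in> {0<..<d}")
      case True
      then have "ennreal (exp (- p * u)) \<le> 1" using p_nonneg by simp
      then have "?g u * ennreal (exp (- p * u)) \<le> ?g u * 1" by (rule mult_left_mono) simp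
      then show ?thesis by simp
    qed simp
  qed
  also have "\<dots> < \<infinity>" by (rule J)
  finally have fin: "(\<integral>\<^sup>+\<omega>. of_bool (dies (?z \<omega>)) * occ ?g (?z \<omega>) \<partial>M) \<noteq> \<infinity>" by simp
  have "AE \<omega> in M. of_bool (dies (?z \<omega>)) * occ ?g (?z \<omega>) \<noteq> \<infinity>"
    by (rule nn_integral_PInf_AE[OF _ fin]) measurable
  with AE_space show ?thesis
  proof eventually_elim
    case (elim \<omega>)
    show ?case
    proof
      assume dz: "dies (?z \<omega>)"
      then have g: "occ ?g (?z \<omega>) < \<infinity>" using elim(2) by (simp add: less_top)
      have h: "occ ?h (?z \<omega>) < \<infinity>"
        by (rule occ_bounded_finite[OF dz, of _ B]) (auto simp: indicator_def intro!: ennreal_leI B)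
      have "occ (\<lambda>u. ennreal (f u)) (?z \<omega>) = occ ?g (?z \<omega>) + occ ?h (?z \<omega>)"
      proof -
        have [measurable]: "(\<lambda>s. if 0 \<le> s \<and> alive (?z \<omega>) s then ?g (?z \<omega> s) else 0) \<in> borel_measurable borel"
          "(\<lambda>s. if 0 \<le> s \<and> alive (?z \<omega>) s then ?h (?z \<omega> s) else 0) \<in> borel_measurable borel"
        proof -
          have gm: "?g \<in> borel_measurable borel" and hm: "?h \<in> borel_measurable borel" by measurable
          show "(\<lambda>s. if 0 \<le> s \<and> alive (?z \<omega>) s then ?g (?z \<omega> s) else 0) \<in> borel_measurable borel"
            by (rule occ_integrand_measurable(2)[OF gm elim(1)])
          show "(\<lambda>s. if 0 \<le> s \<and> alive (?z \<omega>) s then ?h (?z \<omega> s) else 0) \<in> borel_measurable borel"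
            by (rule occ_integrand_measurable(2)[OF hm elim(1)])
        qed
        have "occ ?g (?z \<omega>) + occ ?h (?z \<omega>) = (\<integral>\<^sup>+s. (if 0 \<le> s \<and> alive (?z \<omega>) s then ?g (?z \<omega> s) else 0) + (if 0 \<le> s \<and> alive (?z \<omega>) s then ?h (?z \<omega> s) else 0) \<partial>lborel)"
          unfolding occ_def by (rule nn_integral_add[symmetric]) measurable
        also have "\<dots> = occ (\<lambda>u. ennreal (f u)) (?z \<omega>)"
          unfolding occ_def
        proof (rule nn_integral_cong)
          fix s
          have "?g u + ?h u = ennreal (f u)" for u
            using d by (cases "u \<le> 0") (auto simp: indicator_def f_nonpos)
          then show "(if 0 \<le> s \<and> alive (?z \<omega>) s then ?g (?z \<omega> s) else 0) + (if 0 \<le> s \<and> alive (?z \<omega>) s then ?h (?z \<omega> s) else 0)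
            = (if 0 \<le> s \<and> alive (?z \<omega>) s then ennreal (f (?z \<omega> s)) else 0)" by simp
        qed
        finally show ?thesis by simp
      qed
      then show "occ (\<lambda>u. ennreal (f u)) (?z \<omega>) < \<infinity>" using g h by simp
    qed
  qed
qed

lemma potential_finite_if_occ_finite:
  assumes pos: "emeasure M {\<omega> \<in> space M. dies (\<lambda>s. x + X s \<omega>) \<and> occ (\<lambda>u. ennreal (f u)) (\<lambda>s. x + X s \<omega>) < \<infinity>} \<noteq> 0"
  shows "(\<integral>\<^sup>+u\<in>{0<..<x}. ennreal (f u) \<partial>potential x) < \<infinity>"
proof -
  have x0: "0 \<le> x" using x by simp
  let ?z = "\<lambda>\<omega> s. x + X s \<omega>" and ?f = "\<lambda>u. ennreal (f u)"
  \<comment> \<open>Cut off near 0: bounded by the hypothesis on \<open>f\<close>, and increasing to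
    \<open>f\<close> on the positive half-line.\<close>
  define k where "k n u = (if 1 / real (Suc n) \<le> u then f u else 0)" for n u
  have k_meas [measurable]: "k n \<in> borel_measurable borel" for n unfolding k_def[abs_def] by measurable
  have k0: "0 \<le> k n u" for n u by (simp add: k_def f_nonneg)
  have k_le: "k n u \<le> f u" for n u by (simp add: k_def f_nonneg)
  have "\<exists>B. \<forall>u. k n u \<le> B" for n
  proof -
    obtain B where B: "\<And>u. 1 / real (Suc n) \<le> u \<Longrightarrow> f u \<le> B" using f_bdd[of "1 / real (Suc n)"] by auto
    have "0 \<le> B" using B[of "1 / real (Suc n)"] f_nonneg[of "1 / real (Suc n)"] by simp
    then have "k n u \<le> B" for u using B[of u] by (simp add: k_def)
    then show ?thesis by blast
  qed
  then obtain B where kB: "\<And>n u. k n u \<le> B n" by metis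
  \<comment> \<open>A lower bound for \<open>fk (k n) x\<close> for every n, positive by
    \<open>pos\<close>. The restriction to finite occupation integrals is essential, since
    \<open>enn2real\<close> would turn the exponential of an infinite one into 1.\<close>
  define \<eta> where "\<eta> = (\<integral>\<^sup>+\<omega>. of_bool (dies (?z \<omega>) \<and> occ ?f (?z \<omega>) < \<infinity>) * ennreal (exp (- enn2real (occ ?f (?z \<omega>)))) \<partial>M)"
  have \<eta>: "\<eta> \<noteq> 0"
  proof
    assume "\<eta> = 0"
    then have "AE \<omega> in M. of_bool (dies (?z \<omega>) \<and> occ ?f (?z \<omega>) < \<infinity>) * ennreal (exp (- enn2real (occ ?f (?z \<omega>)))) = 0"
      unfolding \<eta>_def by (subst (asm) nn_integral_0_iff_AE) measurable
    then have "AE \<omega> in M. \<not> (dies (?z \<omega>) \<and> occ ?f (?z \<omega>) < \<infinity>)"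
    proof eventually_elim
      case (elim \<omega>)
      have "0 < ennreal (exp (- enn2real (occ ?f (?z \<omega>))))" by simp
      then show ?case using elim by (cases "dies (?z \<omega>) \<and> occ ?f (?z \<omega>) < \<infinity>") simp_all
    qed
    then have "emeasure M {\<omega> \<in> space M. \<not> \<not> (dies (?z \<omega>) \<and> occ ?f (?z \<omega>) < \<infinity>)} = 0"
      by (subst (asm) AE_iff_measurable[OF _ refl]) measurable
    then show False using pos by simp
  qed
  have fk_x: "\<eta> \<le> fk (k n) x" for n
    unfolding \<eta>_def fk_def fk_functional_def
  proof (rule nn_integral_mono)
    fix \<omega>
    show "of_bool (dies (?z \<omega>) \<and> occ ?f (?z \<omega>) < \<infinity>) * ennreal (exp (- enn2real (occ ?f (?z \<omega>))))
      \<le> of_bool (dies (?z \<omega>)) * ennreal (exp (- enn2real (occ (\<lambda>u. ennreal (k n u)) (?z \<omega>))))"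
    proof (cases "dies (?z \<omega>) \<and> occ ?f (?z \<omega>) < \<infinity>")
      case True
      have "occ (\<lambda>u. ennreal (k n u)) (?z \<omega>) \<le> occ ?f (?z \<omega>)"
        by (intro occ_mono ennreal_leI k_le)
      then have "enn2real (occ (\<lambda>u. ennreal (k n u)) (?z \<omega>)) \<le> enn2real (occ ?f (?z \<omega>))"
        using True by (intro enn2real_mono) simp_all
      then show ?thesis using True by (simp add: ennreal_leI)
    qed simp
  qed
  have fk_y: "\<eta> \<le> fk (k n) y" if "0 \<le> y" "y \<le> x" for n y
    using fk_x[of n] fk_mono[OF that k_meas k0 kB] by (rule order_trans)
  let ?J = "\<lambda>n. \<integral>\<^sup>+u\<in>{0<..<x}. ennreal (k n u) \<partial>potential x"
  have le: "\<eta> * ?J n \<le> 1" for n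
  proof -
    have "\<eta> * ?J n = (\<integral>\<^sup>+u. \<eta> * (ennreal (k n u) * indicator {0<..<x} u) \<partial>potential x)"
      by (rule nn_integral_cmult[symmetric]) measurable
    also have "\<dots> \<le> (\<integral>\<^sup>+u. ennreal (k n u) * fk (k n) u \<partial>potential x)"
    proof (rule nn_integral_mono)
      fix u
      show "\<eta> * (ennreal (k n u) * indicator {0<..<x} u) \<le> ennreal (k n u) * fk (k n) u"
      proof (cases "u \<in> {0<..<x}")
        case True
        then have "\<eta> * ennreal (k n u) \<le> fk (k n) u * ennreal (k n u)" by (intro mult_right_mono fk_y) simp_all
        then show ?thesis using True by (simp add: mult.commute)
      qed simp
    qed
    also have "\<dots> \<le> (\<integral>\<^sup>+u. ennreal (k n u) * fk (k n) u \<partial>potential x) + fk (k n) x" by simp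
    also have "\<dots> = ennreal (exp (- p * x))" by (rule feynman_kac[OF x0 k_meas k0 kB])
    also have "\<dots> \<le> 1" using p_nonneg x0 by simp
    finally show ?thesis .
  qed
  have "(\<integral>\<^sup>+u\<in>{0<..<x}. ennreal (f u) \<partial>potential x) = (\<integral>\<^sup>+u. (SUP n. ennreal (k n u) * indicator {0<..<x} u) \<partial>potential x)"
  proof (intro nn_integral_cong antisym)
    fix u
    show "(SUP n. ennreal (k n u) * indicator {0<..<x} u) \<le> ennreal (f u) * indicator {0<..<x} u"
      by (intro SUP_least mult_right_mono ennreal_leI k_le) simp
    show "ennreal (f u) * indicator {0<..<x} u \<le> (SUP n. ennreal (k n u) * indicator {0<..<x} u)"
    proof (cases "u \<in> {0<..<x}")
      case True
      then obtain n where "inverse (real (Suc n)) < u" using reals_Archimedean[of u] by auto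
      then have "k n u = f u" by (simp add: k_def inverse_eq_divide)
      then show ?thesis by (intro SUP_upper2[where i=n]) simp_all
    qed simp
  qed
  also have "\<dots> = (SUP n. ?J n)"
  proof (rule nn_integral_monotone_convergence_SUP)
    show "incseq (\<lambda>n u. ennreal (k n u) * indicator {0<..<x} u)"
    proof (intro incseq_SucI le_funI mult_right_mono ennreal_leI)
      fix n u
      have "1 / real (Suc (Suc n)) \<le> 1 / real (Suc n)" by (simp add: frac_le)
      then show "k n u \<le> k (Suc n) u" by (simp add: k_def f_nonneg)
    qed simp
  qed measurable
  finally have J: "(\<integral>\<^sup>+u\<in>{0<..<x}. ennreal (f u) \<partial>potential x) = (SUP n. ?J n)" .
  have "\<eta> * (SUP n. ?J n) = (SUP n. \<eta> * ?J n)" by (rule SUP_mult_left_ennreal)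
  also have "\<dots> \<le> 1" by (intro SUP_least le)
  finally have b: "\<eta> * (SUP n. ?J n) \<le> 1" .
  have "(SUP n. ?J n) \<noteq> \<infinity>"
  proof
    assume a: "(SUP n. ?J n) = \<infinity>"
    have "\<eta> * \<infinity> = \<infinity>" using \<eta> by (simp add: ennreal_mult_top)
    then show False using b unfolding a by (simp add: top_unique)
  qed
  then show ?thesis unfolding J by (simp only: less_top[symmetric] infinity_ennreal_def not_False_eq_True)
qed

end

end

section \<open>Estimates for the Levy-Khintchine integrand\<close>

definition levy_integrand :: "real \<Rightarrow> real \<Rightarrow> real" where
  "levy_integrand l u = exp (- l * u) - 1 + l * u * indicator {0<..1} u"

lemma laplace_exponent_eq:
  "laplace_exponent b c \<pi> l = b * l + c * l\<^sup>2 + (\<integral>u. levy_integrand l u \<partial>\<pi>)"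
  by (simp add: laplace_exponent_def levy_integrand_def)

lemma levy_measure_sets: "levy_measure \<pi> \<Longrightarrow> sets \<pi> = sets (restrict_space borel {0<..})"
  by (simp add: levy_measure_def)

lemma levy_measure_space: "levy_measure \<pi> \<Longrightarrow> space \<pi> = {0<..}"
  using sets_eq_imp_space_eq[OF levy_measure_sets, of \<pi>] by (simp add: space_restrict_space)

lemma measurable_levy:
  assumes "levy_measure \<pi>" "g \<in> borel_measurable borel"
  shows "g \<in> borel_measurable \<pi>"
  unfolding measurable_cong_sets[OF levy_measure_sets[OF assms(1)] refl]
  by (rule measurable_restrict_space1[OF assms(2)])

lemma measurable_levy_integrand [measurable]: "levy_integrand l \<in> borel_measurable borel"
  unfolding levy_integrand_def[abs_def] by measurable

lemma integrable_levy_bound: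
  assumes \<pi>: "levy_measure \<pi>"
  shows "integrable \<pi> (\<lambda>u. min 1 (u\<^sup>2))"
proof (rule integrableI_bounded)
  show "(\<lambda>u. min 1 (u\<^sup>2)) \<in> borel_measurable \<pi>" by (rule measurable_levy[OF \<pi>]) measurable
  have "(\<integral>\<^sup>+u. ennreal (norm (min 1 (u\<^sup>2))) \<partial>\<pi>) = (\<integral>\<^sup>+u. ennreal (min 1 (u\<^sup>2)) \<partial>\<pi>)"
    by (intro nn_integral_cong) simp
  then show "(\<integral>\<^sup>+u. ennreal (norm (min 1 (u\<^sup>2))) \<partial>\<pi>) < \<infinity>" using \<pi> by (simp add: levy_measure_def)
qed

text \<open>The second bound comes from exp (- v) \<le> 1/(1 + v) \<le> 1 - v + v^2, where
  multiplying out gives 1 \<le> 1 + v^3. In the third, right side minus left side vanishes at 0 and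
  has derivative 2 (1 - exp (- v))^2; it shows that compensated small jumps grow under doubling at
  most like a Gaussian term.\<close>

lemma exp_neg_remainder:
  fixes v :: real
  assumes "0 \<le> v"
  shows "0 \<le> exp (- v) - 1 + v" "exp (- v) - 1 + v \<le> v\<^sup>2"
    "exp (- (2 * v)) - 1 + 2 * v \<le> 4 * (exp (- v) - 1 + v)"
proof -
  show "0 \<le> exp (- v) - 1 + v" using exp_ge_add_one_self[of "- v"] by linarith
  show "exp (- v) - 1 + v \<le> v\<^sup>2"
  proof -
    have "1 + v \<le> exp v" by (rule exp_ge_add_one_self)
    then have "exp (- v) \<le> 1 / (1 + v)" using assms by (simp add: exp_minus divide_simps)
    also have "\<dots> \<le> 1 - v + v\<^sup>2"
    proof -
      have "1 \<le> (1 - v + v\<^sup>2) * (1 + v)"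
      proof -
        have "(1 - v + v\<^sup>2) * (1 + v) = 1 + v ^ 3" by (simp add: algebra_simps power2_eq_square power3_eq_cube)
        then show ?thesis using assms by simp
      qed
      then show ?thesis using assms by (simp add: pos_divide_le_eq)
    qed
    finally show ?thesis by simp
  qed
  show "exp (- (2 * v)) - 1 + 2 * v \<le> 4 * (exp (- v) - 1 + v)"
  proof -
    define q where "q v = 4 * (exp (- v) - 1 + v) - (exp (- (2 * v)) - 1 + 2 * v)" for v :: real
    have "q 0 \<le> q v"
    proof (rule DERIV_nonneg_imp_nondecreasing[OF assms])
      fix x :: real
      have "DERIV q x :> 4 * (- exp (- x) + 1) - (- 2 * exp (- (2 * x)) + 2)"
        unfolding q_def by (auto intro!: derivative_eq_intros)
      moreover have "4 * (- exp (- x) + 1) - (- 2 * exp (- (2 * x)) + 2) = 2 * (1 - exp (- x))\<^sup>2"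
      proof -
        have "exp (- (2 * x)) = (exp (- x))\<^sup>2" by (simp add: power2_eq_square mult_exp_exp)
        then show ?thesis by (simp add: power2_diff)
      qed
      ultimately show "\<exists>y. DERIV q x :> y \<and> 0 \<le> y" by (metis mult_nonneg_nonneg zero_le_numeral zero_le_power2)
    qed
    then show ?thesis by (simp add: q_def)
  qed
qed

text \<open>Jumps up to 1 are compensated and contribute at most (l u)^2; larger ones contribute at
  most 1.\<close>

lemma integrable_levy_integrand:
  assumes \<pi>: "levy_measure \<pi>" and l: "0 \<le> l"
  shows "integrable \<pi> (levy_integrand l)"
proof (rule Bochner_Integration.integrable_bound)
  show "integrable \<pi> (\<lambda>u. (l\<^sup>2 + 1) * min 1 (u\<^sup>2))" using integrable_levy_bound[OF \<pi>] by simp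
  show "levy_integrand l \<in> borel_measurable \<pi>" by (rule measurable_levy[OF \<pi>]) measurable
  have "norm (levy_integrand l u) \<le> norm ((l\<^sup>2 + 1) * min 1 (u\<^sup>2))" if u: "0 < u" for u
  proof (cases "u \<le> 1")
    case True
    have v: "0 \<le> l * u" using l u by simp
    have e: "levy_integrand l u = exp (- (l * u)) - 1 + l * u" using True u by (simp add: levy_integrand_def)
    have "u\<^sup>2 \<le> 1" using True u by (simp add: power_le_one)
    have "norm (levy_integrand l u) \<le> (l * u)\<^sup>2"
      unfolding e using exp_neg_remainder(1,2)[OF v] by simp
    also have "\<dots> \<le> (l\<^sup>2 + 1) * u\<^sup>2" by (simp add: power_mult_distrib algebra_simps)
    also have "\<dots> = norm ((l\<^sup>2 + 1) * min 1 (u\<^sup>2))" using \<open>u\<^sup>2 \<le> 1\<close> by simp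
    finally show ?thesis .
  next
    case False
    have "0 \<le> l * u" using l u by simp
    then have "norm (levy_integrand l u) \<le> 1" using False by (simp add: levy_integrand_def)
    moreover have "min 1 (u\<^sup>2) = 1" using False by (simp add: min_def one_le_power)
    ultimately show ?thesis by (simp add: add_increasing)
  qed
  then show "AE u in \<pi>. norm (levy_integrand l u) \<le> norm ((l\<^sup>2 + 1) * min 1 (u\<^sup>2))"
    by (intro AE_I2) (simp add: levy_measure_space[OF \<pi>])
qed

text \<open>Convexity of the exponential between 0 and - v.\<close>

lemma exp_neg_star_shaped:
  fixes \<theta> v :: real
  assumes "0 \<le> \<theta>" "\<theta> \<le> 1"
  shows "exp (- (\<theta> * v)) - 1 \<le> \<theta> * (exp (- v) - 1)"
proof -
  have "exp ((1 - \<theta>) *\<^sub>R 0 + \<theta> *\<^sub>R (- v)) \<le> (1 - \<theta>) * exp 0 + \<theta> * exp (- v)"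
    by (rule convex_onD[OF exp_convex]) (use assms in auto)
  then show ?thesis by (simp add: algebra_simps)
qed

section \<open>The Laplace exponent and regular versions\<close>

locale levy_exponent =
  fixes b c :: real and \<pi> :: "real measure"
  assumes c: "0 \<le> c" and \<pi>: "levy_measure \<pi>"
begin

abbreviation "\<psi> \<equiv> laplace_exponent b c \<pi>"

text \<open>\<open>\<psi>\<close> is convex and vanishes at 0, so \<open>\<psi> l / l\<close> is
  nondecreasing; this is checked on the linear, quadratic and jump terms separately.\<close>

lemma psi_star_shaped:
  assumes "0 < l" "l \<le> l'"
  shows "\<psi> l \<le> l / l' * \<psi> l'"
proof -
  define \<theta> where "\<theta> = l / l'"
  have l': "0 < l'" using assms by simp
  have th: "0 \<le> \<theta>" "\<theta> \<le> 1" and ll: "l = \<theta> * l'" using assms by (simp_all add: \<theta>_def)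
  have "(\<integral>u. levy_integrand l u \<partial>\<pi>) \<le> (\<integral>u. \<theta> * levy_integrand l' u \<partial>\<pi>)"
  proof (rule integral_mono)
    fix u
    have "exp (- (\<theta> * (l' * u))) - 1 \<le> \<theta> * (exp (- (l' * u)) - 1)" by (rule exp_neg_star_shaped[OF th])
    then show "levy_integrand l u \<le> \<theta> * levy_integrand l' u"
      unfolding levy_integrand_def ll by (simp add: algebra_simps)
  qed (use assms in \<open>auto intro!: integrable_levy_integrand \<pi>\<close>)
  then have i: "(\<integral>u. levy_integrand l u \<partial>\<pi>) \<le> \<theta> * (\<integral>u. levy_integrand l' u \<partial>\<pi>)" by simp
  have "c * l\<^sup>2 \<le> \<theta> * (c * l'\<^sup>2)"
  proof -
    have "\<theta> * \<theta> \<le> \<theta> * 1" using th by (intro mult_left_mono) simp_all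
    then have "(c * l'\<^sup>2) * (\<theta> * \<theta>) \<le> (c * l'\<^sup>2) * \<theta>" using c by (intro mult_left_mono) simp_all
    then show ?thesis unfolding ll by (simp add: power2_eq_square ac_simps)
  qed
  then show ?thesis
    unfolding laplace_exponent_eq \<theta>_def[symmetric] distrib_left
    using i by (simp add: ll)
qed

lemma psi_pos_mono:
  assumes "0 < l" "l \<le> l'" "0 < \<psi> l"
  shows "\<psi> l \<le> \<psi> l'" "0 < \<psi> l'"
proof -
  have 1: "\<psi> l \<le> l / l' * \<psi> l'" by (rule psi_star_shaped[OF assms(1,2)])
  have l: "0 < l / l'" "l / l' \<le> 1" using assms by simp_all
  have "0 < l / l' * \<psi> l'" using 1 assms by linarith
  then show pos: "0 < \<psi> l'" using l by (simp only: zero_less_mult_pos)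
  have "l / l' * \<psi> l' \<le> 1 * \<psi> l'" using l pos by (intro mult_right_mono) simp_all
  then show "\<psi> l \<le> \<psi> l'" using 1 by simp
qed

text \<open>The Gaussian term grows by the factor 4 and the small jumps by at most 4. The drift may
  need an extra \<open>2 * \<bar>b\<bar> * l\<close>, and each jump larger than 1 an extra 3 at
  most, because exp (- l u) - 1 exceeds 4 (exp (- l u) - 1) by no more than 3.\<close>

lemma psi_double:
  assumes l: "0 \<le> l"
  shows "\<psi> (2 * l) \<le> 4 * \<psi> l + 2 * \<bar>b\<bar> * l + 3 * (\<integral>u. min 1 (u\<^sup>2) \<partial>\<pi>)"
proof -
  have i: "(\<integral>u. levy_integrand (2 * l) u \<partial>\<pi>) \<le> (\<integral>u. 4 * levy_integrand l u + 3 * min 1 (u\<^sup>2) \<partial>\<pi>)"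
  proof (rule integral_mono)
    show "integrable \<pi> (levy_integrand (2 * l))" by (rule integrable_levy_integrand[OF \<pi>]) (use l in simp)
    show "integrable \<pi> (\<lambda>u. 4 * levy_integrand l u + 3 * min 1 (u\<^sup>2))"
      using integrable_levy_integrand[OF \<pi> l] integrable_levy_bound[OF \<pi>] by simp
    fix u assume "u \<in> space \<pi>"
    then have u: "0 < u" by (simp add: levy_measure_space[OF \<pi>])
    show "levy_integrand (2 * l) u \<le> 4 * levy_integrand l u + 3 * min 1 (u\<^sup>2)"
    proof (cases "u \<le> 1")
      case True
      have "0 \<le> l * u" using l u by simp
      from exp_neg_remainder(3)[OF this] have "levy_integrand (2 * l) u \<le> 4 * levy_integrand l u"
        using True u by (simp add: levy_integrand_def algebra_simps)
      moreover have "0 \<le> min 1 (u\<^sup>2)" by simp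
      ultimately show ?thesis by linarith
    next
      case False
      have "exp (- (2 * l) * u) \<le> exp (- l * u)" using l u by simp
      moreover have "0 \<le> exp (- l * u)" by simp
      moreover have "min 1 (u\<^sup>2) = 1" using False by (simp add: min_def one_le_power)
      moreover have "levy_integrand (2 * l) u = exp (- (2 * l) * u) - 1" "levy_integrand l u = exp (- l * u) - 1"
        using False by (simp_all add: levy_integrand_def)
      ultimately show ?thesis by linarith
    qed
  qed
  also have "\<dots> = 4 * (\<integral>u. levy_integrand l u \<partial>\<pi>) + 3 * (\<integral>u. min 1 (u\<^sup>2) \<partial>\<pi>)"
    using integrable_levy_integrand[OF \<pi> l] integrable_levy_bound[OF \<pi>] by simp
  finally have 1: "(\<integral>u. levy_integrand (2 * l) u \<partial>\<pi>) \<le> 4 * (\<integral>u. levy_integrand l u \<partial>\<pi>) + 3 * (\<integral>u. min 1 (u\<^sup>2) \<partial>\<pi>)" .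
  have "- b * l \<le> \<bar>b\<bar> * l" using l by (intro mult_right_mono) simp_all
  then show ?thesis using 1 unfolding laplace_exponent_eq by (simp add: power_mult_distrib algebra_simps)
qed

lemma psi_measurable: "\<psi> \<in> borel_measurable borel"
proof -
  have sf: "sigma_finite_measure \<pi>" using \<pi> by (simp add: levy_measure_def)
  have s: "sets (borel \<Otimes>\<^sub>M \<pi>) = sets (borel \<Otimes>\<^sub>M restrict_space borel {0<..})"
    by (intro sets_pair_measure_cong refl levy_measure_sets \<pi>)
  have "(\<lambda>w. levy_integrand (fst w) (snd w)) \<in> borel_measurable (borel \<Otimes>\<^sub>M (restrict_space borel {0<..} :: real measure))"
  proof -
    have [measurable]: "(\<lambda>u. u) \<in> borel_measurable (restrict_space borel {0<..} :: real measure)"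
      by (rule measurable_restrict_space1) measurable
    have [measurable]: "(\<lambda>u. indicator {0<..1} u :: real) \<in> borel_measurable (restrict_space borel {0<..} :: real measure)"
      by (rule measurable_restrict_space1) measurable
    have [measurable]: "snd \<in> borel_measurable (borel \<Otimes>\<^sub>M (restrict_space borel {0<..} :: real measure))"
      by (rule measurable_compose[OF measurable_snd]) measurable
    show ?thesis unfolding levy_integrand_def by measurable
  qed
  then have "(\<lambda>(l, u). levy_integrand l u) \<in> borel_measurable (borel \<Otimes>\<^sub>M \<pi>)"
    unfolding measurable_cong_sets[OF s refl] by (simp add: split_beta')
  then have "(\<lambda>l. \<integral>u. levy_integrand l u \<partial>\<pi>) \<in> borel_measurable borel"
    by (rule sigma_finite_measure.borel_measurable_lebesgue_integral[OF sf])
  then show ?thesis unfolding laplace_exponent_eq[abs_def] by measurable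
qed

context
  assumes ex: "\<exists>l>0. 0 < \<psi> l"
begin

abbreviation "p \<equiv> Phi0 b c \<pi>"

lemma Phi0_nonneg: "0 \<le> p"
  unfolding Phi0_def by (rule cInf_greatest) (use ex in auto)

lemma psi_pos: assumes "p < l" shows "0 < \<psi> l"
proof -
  have "\<exists>l0\<in>{l. 0 < l \<and> 0 < \<psi> l}. l0 < l"
    using assms unfolding Phi0_def by (intro cInf_lessD) (use ex in auto)
  then obtain l0 where "0 < l0" "0 < \<psi> l0" "l0 < l" by auto
  then show ?thesis using psi_pos_mono(2)[of l0 l] by simp
qed

lemma psi_nonpos: assumes "0 < l" "l < p" shows "\<psi> l \<le> 0"
proof (rule ccontr)
  assume "\<not> \<psi> l \<le> 0"
  then have "p \<le> l" unfolding Phi0_def using assms by (intro cInf_lower bdd_belowI[of _ 0]) auto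
  then show False using assms by simp
qed

lemma psi_mono: assumes "p < l" "l \<le> l'" shows "\<psi> l \<le> \<psi> l'"
  using psi_pos_mono(1)[of l l'] psi_pos[OF assms(1)] Phi0_nonneg assms by simp

text \<open>Above K = p + 1 star-shapedness gives at least linear growth,
  \<open>s * l \<le> \<psi> l\<close> with positive s, so the linear and constant errors in
  \<open>psi_double\<close> are absorbed into multiples of \<open>\<psi> l\<close>.\<close>

lemma psi_doubling: "\<exists>C\<ge>1. \<exists>K>p. \<forall>l\<ge>K. \<psi> (2 * l) \<le> C * \<psi> l"
proof -
  define K where "K = p + 1"
  have K: "p < K" "0 < K" using Phi0_nonneg by (simp_all add: K_def)
  define s where "s = \<psi> K / K"
  have s: "0 < s" unfolding s_def by (intro divide_pos_pos psi_pos K)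
  define T where "T = (\<integral>u. min 1 (u\<^sup>2) \<partial>\<pi>)"
  have T: "0 \<le> T" unfolding T_def by (rule Bochner_Integration.integral_nonneg) simp
  define C where "C = 4 + 2 * \<bar>b\<bar> / s + 3 * T / (s * K)"
  have C1: "1 \<le> C" using s T K by (simp add: C_def add_increasing2)
  have "\<psi> (2 * l) \<le> C * \<psi> l" if l: "K \<le> l" for l
  proof -
    have l0: "0 < l" using l K by simp
    have "\<psi> K \<le> K / l * \<psi> l" by (rule psi_star_shaped[OF K(2) l])
    then have sl: "s * l \<le> \<psi> l" using K l0 by (simp add: s_def field_simps)
    have "s * K \<le> s * l" using l s by (intro mult_left_mono) simp_all
    then have sK: "s * K \<le> \<psi> l" using sl by simp
    have "l \<le> \<psi> l / s" using sl s by (simp add: le_divide_eq mult.commute)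
    then have 1: "2 * \<bar>b\<bar> * l \<le> 2 * \<bar>b\<bar> * (\<psi> l / s)" by (intro mult_left_mono) simp_all
    have "1 \<le> \<psi> l / (s * K)" using sK s K by (simp add: le_divide_eq)
    then have 2: "3 * T * 1 \<le> 3 * T * (\<psi> l / (s * K))" using T by (intro mult_left_mono) simp_all
    have "\<psi> (2 * l) \<le> 4 * \<psi> l + 2 * \<bar>b\<bar> * l + 3 * T" unfolding T_def by (rule psi_double) (use l0 in simp)
    also have "\<dots> \<le> 4 * \<psi> l + 2 * \<bar>b\<bar> * (\<psi> l / s) + 3 * T * (\<psi> l / (s * K))" using 1 2 by simp
    also have "\<dots> = C * \<psi> l" by (simp add: C_def algebra_simps)
    finally show ?thesis .
  qed
  then show ?thesis using C1 K(1) by blast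
qed

end

end

text \<open>Independence is a property of the joint law, which does not see null sets; countability
  of the index set allows the exceptional sets to be united.\<close>

lemma (in prob_space) indep_vars_cong_AE:
  assumes "countable I" "\<And>i. i \<in> I \<Longrightarrow> AE \<omega> in M. X i \<omega> = Y i \<omega>" "\<And>i. i \<in> I \<Longrightarrow> random_variable (N i) (Y i)"
    and ind: "indep_vars N X I"
  shows "indep_vars N Y I"
proof (cases "I = {}")
  case False
  have rX: "random_variable (N i) (X i)" if "i \<in> I" for i using ind that by (simp add: indep_vars_def)
  have ae: "AE \<omega> in M. \<forall>i\<in>I. X i \<omega> = Y i \<omega>" using assms(1,2) by (subst AE_ball_countable) auto
  have "distr M (PiM I N) (\<lambda>\<omega>. \<lambda>i\<in>I. X i \<omega>) = PiM I (\<lambda>i. distr M (N i) (X i))"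
    using ind rX False by (subst (asm) indep_vars_iff_distr_eq_PiM') auto
  moreover have "distr M (PiM I N) (\<lambda>\<omega>. \<lambda>i\<in>I. X i \<omega>) = distr M (PiM I N) (\<lambda>\<omega>. \<lambda>i\<in>I. Y i \<omega>)"
  proof (rule distr_cong_AE)
    show "AE \<omega> in M. (\<lambda>i\<in>I. X i \<omega>) = (\<lambda>i\<in>I. Y i \<omega>)" using ae by eventually_elim (auto simp: restrict_def)
    show "(\<lambda>\<omega>. \<lambda>i\<in>I. X i \<omega>) \<in> measurable M (PiM I N)" by (rule measurable_restrict) (rule rX)
    show "(\<lambda>\<omega>. \<lambda>i\<in>I. Y i \<omega>) \<in> measurable M (PiM I N)" by (rule measurable_restrict) (rule assms(3))
  qed simp_all
  moreover have "distr M (N i) (X i) = distr M (N i) (Y i)" if "i \<in> I" for i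
    by (rule distr_cong_AE) (use assms that rX in auto)
  then have "PiM I (\<lambda>i. distr M (N i) (X i)) = PiM I (\<lambda>i. distr M (N i) (Y i))" by (intro PiM_cong) auto
  ultimately show ?thesis
    using False assms(3) by (subst indep_vars_iff_distr_eq_PiM') auto
qed (simp add: indep_vars_def indep_sets_def)

lemma grid_mono_imp_mono_on:
  assumes z: "rc_path z" and inc: "\<And>n i. z (grid_time 1 n i) \<le> z (grid_time 1 n (Suc i))"
  shows "mono_on {0..} z"
proof (rule mono_onI)
  fix s t :: real assume "s \<in> {0..}" "t \<in> {0..}" and st: "s \<le> t"
  then have s: "0 \<le> s" and t: "0 \<le> t" by auto
  have up_le: "next_index 1 n s \<le> next_index 1 n t" for n
    unfolding next_index_def using st by (intro Suc_le_mono[THEN iffD2] nat_mono floor_mono divide_right_mono) simp_all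
  have "z (grid_time 1 n i) \<le> z (grid_time 1 n j)" if "i \<le> j" for n i j
    using that by (rule lift_Suc_mono_le[where f="\<lambda>i. z (grid_time 1 n i)", OF inc])
  then show "z s \<le> z t"
    using rc_path_next_tendsto[OF z _ s, of 1] rc_path_next_tendsto[OF z _ t, of 1] up_le
    by (intro LIMSEQ_le[of "\<lambda>n. z (grid_time 1 n (next_index 1 n s))" _ "\<lambda>n. z (grid_time 1 n (next_index 1 n t))"]) auto
qed

context spectrally_positive_levy_process
begin

text \<open>Setting the process to 0 off a measurable set of full measure, and up to time 0, turns
  almost sure path properties into properties of every path, as the constant path 0 has them
  too.\<close>

lemma ex_regular_version:
  obtains X \<Omega> where "\<Omega> \<in> events" "AE \<omega> in M. \<omega> \<in> \<Omega>"
    "\<And>\<omega> t. \<omega> \<in> \<Omega> \<Longrightarrow> 0 \<le> t \<Longrightarrow> Z t \<omega> = x + X t \<omega>"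
    "\<And>t. X t \<in> borel_measurable M" "\<And>t \<omega>. t \<le> 0 \<Longrightarrow> X t \<omega> = 0" "\<And>\<omega>. sp_path (\<lambda>t. X t \<omega>)"
proof -
  have "AE \<omega> in M. Z 0 \<omega> = x \<and> ((\<forall>t\<ge>0. ((\<lambda>s. Z s \<omega>) \<longlongrightarrow> Z t \<omega>) (at_right t)) \<and>
      (\<forall>t>0. \<exists>l. ((\<lambda>s. Z s \<omega>) \<longlongrightarrow> l) (at_left t))) \<and>
      (\<forall>t>0. \<forall>l. ((\<lambda>s. Z s \<omega>) \<longlongrightarrow> l) (at_left t) \<longrightarrow> l \<le> Z t \<omega>)" (is "AE \<omega> in M. ?P \<omega>")
    using start cadlag no_negative_jumps unfolding no_negative_jumps_def by eventually_elim blast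
  then obtain N where N: "{\<omega> \<in> space M. \<not> ?P \<omega>} \<subseteq> N" "emeasure M N = 0" "N \<in> events"
    by (rule AE_E)
  define \<Omega> where "\<Omega> = space M - N"
  have \<Omega>: "\<Omega> \<in> events" using N by (simp add: \<Omega>_def)
  have P: "?P \<omega>" if "\<omega> \<in> \<Omega>" for \<omega> using that N(1) unfolding \<Omega>_def by blast
  have nul: "N \<in> null_sets M" using N by (simp add: null_sets_def)
  have ae: "AE \<omega> in M. \<omega> \<in> \<Omega>"
    using AE_not_in[OF nul] AE_space by eventually_elim (simp add: \<Omega>_def)
  define X where "X t \<omega> = (if \<omega> \<in> \<Omega> \<and> 0 < t then Z t \<omega> - x else 0)" for t \<omega>
  have eq: "Z t \<omega> = x + X t \<omega>" if "\<omega> \<in> \<Omega>" "0 \<le> t" for \<omega> t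
    using P[OF that(1)] that by (cases "t = 0") (simp_all add: X_def)
  have np: "X t \<omega> = 0" if "t \<le> 0" for t \<omega>
  proof -
    have "\<not> 0 < t" using that by simp
    then show ?thesis by (simp add: X_def)
  qed
  have meas: "X t \<in> borel_measurable M" for t
  proof (cases "0 < t")
    case True
    have [measurable]: "Z t \<in> borel_measurable M" "\<Omega> \<in> events" using random_variable_Z[of t] True \<Omega> by auto
    have "(\<lambda>\<omega>. if \<omega> \<in> \<Omega> then Z t \<omega> - x else 0) \<in> borel_measurable M" by measurable
    then show ?thesis using True by (simp add: X_def[abs_def])
  next
    case False
    then show ?thesis by (simp add: X_def[abs_def])
  qed
  have path: "sp_path (\<lambda>t. X t \<omega>)" for \<omega>
  proof (cases "\<omega> \<in> \<Omega>")
    case False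
    then have X0: "(\<lambda>t. X t \<omega>) = (\<lambda>_. 0)" by (simp add: X_def)
    show ?thesis unfolding X0 sp_path_def rc_path_def by auto
  next
    case True
    note Pw = P[OF True]
    have Xt: "X t \<omega> = Z t \<omega> - x" if "0 \<le> t" for t using eq[OF True that] by simp
    show ?thesis
      unfolding sp_path_def rc_path_def
    proof (intro conjI allI impI)
      fix t :: real assume t: "0 \<le> t"
      then have "((\<lambda>s. Z s \<omega> - x) \<longlongrightarrow> Z t \<omega> - x) (at_right t)" using Pw by (intro tendsto_intros) blast
      moreover have "\<forall>\<^sub>F s in at_right t. Z s \<omega> - x = X s \<omega>"
        using eventually_at_right_less[of t] by eventually_elim (use t in \<open>simp add: Xt\<close>)
      ultimately show "((\<lambda>t. X t \<omega>) \<longlongrightarrow> X t \<omega>) (at_right t)"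
        unfolding Xt[OF t] by (rule Lim_transform_eventually)
    next
      fix t :: real assume t: "0 < t"
      then obtain l where l: "((\<lambda>s. Z s \<omega>) \<longlongrightarrow> l) (at_left t)" using Pw by blast
      then have "l \<le> Z t \<omega>" using Pw t by blast
      moreover have "((\<lambda>s. Z s \<omega> - x) \<longlongrightarrow> l - x) (at_left t)" using l by (intro tendsto_intros)
      moreover have "\<forall>\<^sub>F s in at_left t. Z s \<omega> - x = X s \<omega>"
        using eventually_at_left_real[OF t] by eventually_elim (simp add: Xt)
      ultimately have "l - x \<le> X t \<omega>" "((\<lambda>t. X t \<omega>) \<longlongrightarrow> l - x) (at_left t)"
        using t by (simp_all add: Xt Lim_transform_eventually)
      then show "\<exists>l\<le>X t \<omega>. ((\<lambda>t. X t \<omega>) \<longlongrightarrow> l) (at_left t)" by blast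
    qed
  qed
  show thesis
    by (rule that[OF \<Omega> ae eq meas np path])
qed

context
  fixes X :: "real \<Rightarrow> 'a \<Rightarrow> real" and \<Omega> :: "'a set"
  assumes \<Omega>: "AE \<omega> in M. \<omega> \<in> \<Omega>" and ver: "\<And>\<omega> t. \<omega> \<in> \<Omega> \<Longrightarrow> 0 \<le> t \<Longrightarrow> Z t \<omega> = x + X t \<omega>"
    and X_meas [measurable]: "\<And>t. X t \<in> borel_measurable M"
    and X_np: "\<And>t \<omega>. t \<le> 0 \<Longrightarrow> X t \<omega> = 0" and X_sp: "\<And>\<omega>. sp_path (\<lambda>t. X t \<omega>)"
begin

lemma version_AE: "0 \<le> t \<Longrightarrow> AE \<omega> in M. Z t \<omega> = x + X t \<omega>"
  using \<Omega> by eventually_elim (rule ver)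

lemma version_increment_AE: "0 \<le> s \<Longrightarrow> 0 \<le> t \<Longrightarrow> AE \<omega> in M. Z t \<omega> - Z s \<omega> = X t \<omega> - X s \<omega>"
  using \<Omega> by eventually_elim (simp add: ver)

text \<open>Independence of an infinite family is a statement about its finite subfamilies, so it
  follows from the independence of finitely many increments.\<close>

lemma version_indep:
  assumes h: "0 < h"
  shows "indep_vars (\<lambda>_. borel) (\<lambda>i \<omega>. X (real (Suc i) * h) \<omega> - X (real i * h) \<omega>) (UNIV :: nat set)"
proof -
  have fin: "indep_vars (\<lambda>_. borel) (\<lambda>i \<omega>. X (real (Suc i) * h) \<omega> - X (real i * h) \<omega>) {..<n}" for n :: nat
  proof (rule indep_vars_cong_AE)
    show "indep_vars (\<lambda>_. borel) (\<lambda>i \<omega>. Z (real (Suc i) * h) \<omega> - Z (real i * h) \<omega>) {..<n}"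
      by (rule independent_increments[of "\<lambda>i. real i * h"]) (use h in \<open>auto intro!: monoI mult_right_mono\<close>)
    show "AE \<omega> in M. Z (real (Suc i) * h) \<omega> - Z (real i * h) \<omega> = X (real (Suc i) * h) \<omega> - X (real i * h) \<omega>" for i
      by (rule version_increment_AE) (use h in simp_all)
  qed simp_all
  let ?G = "\<lambda>i. {(\<lambda>\<omega>. X (real (Suc i) * h) \<omega> - X (real i * h) \<omega>) -` A \<inter> space M | A. A \<in> sets borel}"
  have "indep_sets ?G (UNIV :: nat set)"
    unfolding indep_sets_finite_index_sets[of ?G UNIV]
  proof (intro allI impI)
    fix J :: "nat set" assume "finite J"
    then obtain n where "J \<subseteq> {..<n}" using finite_nat_iff_bounded by blast
    then show "indep_sets ?G J" using fin[of n] unfolding indep_vars_def2 by (blast intro: indep_sets_mono_index)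
  qed
  then show ?thesis unfolding indep_vars_def2 by simp
qed

lemma version_stationary:
  assumes h: "0 < h"
  shows "distr M borel (\<lambda>\<omega>. X (real (Suc i) * h) \<omega> - X (real i * h) \<omega>) = distr M borel (X h)"
proof -
  have Zm: "Z t \<in> borel_measurable M" if "0 \<le> t" for t using random_variable_Z[OF that] .
  have "distr M borel (\<lambda>\<omega>. X (real (Suc i) * h) \<omega> - X (real i * h) \<omega>) = distr M borel (\<lambda>\<omega>. Z (real (Suc i) * h) \<omega> - Z (real i * h) \<omega>)"
    by (rule distr_cong_AE[symmetric]) (use h version_increment_AE[of "real i * h" "real (Suc i) * h"] in \<open>auto intro!: borel_measurable_diff Zm\<close>)
  also have "\<dots> = distr M borel (\<lambda>\<omega>. Z (real i * h + h) \<omega> - Z (real i * h) \<omega>)" by (simp add: algebra_simps)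
  also have "\<dots> = distr M borel (\<lambda>\<omega>. Z h \<omega> - Z 0 \<omega>)" by (rule stationary_increments) (use h in simp_all)
  also have "\<dots> = distr M borel (X h)"
    by (rule distr_cong_AE) (use h version_increment_AE[of 0 h] X_np[of 0] in \<open>auto intro!: borel_measurable_diff Zm\<close>)
  finally show ?thesis .
qed

lemma version_laplace:
  assumes l: "0 \<le> l" and t: "0 \<le> t"
  shows "has_bochner_integral M (\<lambda>\<omega>. exp (- l * X t \<omega>)) (exp (laplace_exponent b c \<pi> l * t))"
proof -
  have "has_bochner_integral M (\<lambda>\<omega>. exp (l * x) * exp (- l * Z t \<omega>)) (exp (l * x) * exp (- l * x + laplace_exponent b c \<pi> l * t))"
    by (rule has_bochner_integral_mult_right) (rule laplace_transform[OF l t])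
  also have "exp (l * x) * exp (- l * x + laplace_exponent b c \<pi> l * t) = exp (laplace_exponent b c \<pi> l * t)"
    by (simp add: mult_exp_exp)
  finally have 1: "has_bochner_integral M (\<lambda>\<omega>. exp (l * x) * exp (- l * Z t \<omega>)) (exp (laplace_exponent b c \<pi> l * t))" .
  have "AE \<omega> in M. exp (l * x) * exp (- l * Z t \<omega>) = exp (- l * X t \<omega>)"
    using version_AE[OF t] by eventually_elim (simp add: mult_exp_exp algebra_simps)
  moreover have "(\<lambda>\<omega>. exp (l * x) * exp (- l * Z t \<omega>)) \<in> borel_measurable M" using 1 by (rule borel_measurable_has_bochner_integral)
  ultimately show ?thesis using 1
    by (subst has_bochner_integral_cong_AE[of _ _ "\<lambda>\<omega>. exp (l * x) * exp (- l * Z t \<omega>)"]) (auto elim!: eventually_mono)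
qed

text \<open>By the exponential Chebyshev inequality X h \<le> - \<epsilon> has probability at most
  \<open>exp (- l * \<epsilon>) * exp (\<psi> l * h)\<close>, which tends to 0 with l when
  \<open>\<psi>\<close> is nowhere positive. Increments along the dyadic grid are then almost surely
  nonnegative, and right continuity does the rest. Hence, unless Z is a subordinator, the set whose
  infimum is \<open>Phi0\<close> is nonempty.\<close>

lemma psi_nonpos_imp_nondecreasing:
  assumes np: "\<And>l. 0 < l \<Longrightarrow> laplace_exponent b c \<pi> l \<le> 0"
  shows "nondecreasing_paths M Z"
proof -
  have pos: "AE \<omega> in M. 0 \<le> X h \<omega>" if h: "0 < h" for h
  proof -
    have "AE \<omega> in M. \<not> X h \<omega> \<le> - \<epsilon>" if \<epsilon>: "0 < \<epsilon>" for \<epsilon>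
    proof -
      let ?A = "{\<omega> \<in> space M. X h \<omega> \<le> - \<epsilon>}"
      have le: "prob ?A \<le> exp (- \<epsilon>) ^ n" for n
      proof (cases "n = 0")
        case False
        define l where "l = real n"
        have l: "0 < l" using False by (simp add: l_def)
        note b = version_laplace[OF less_imp_le[OF l] less_imp_le[OF h]]
        have "prob ?A = (\<integral>\<omega>. indicator ?A \<omega> \<partial>M)" by simp
        also have "\<dots> \<le> (\<integral>\<omega>. exp (- l * \<epsilon>) * exp (- l * X h \<omega>) \<partial>M)"
        proof (rule integral_mono)
          show "integrable M (indicator ?A :: 'a \<Rightarrow> real)" by (rule integrable_real_indicator) (simp_all add: less_top[symmetric])
          show "integrable M (\<lambda>\<omega>. exp (- l * \<epsilon>) * exp (- l * X h \<omega>))"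
            by (intro integrable_mult_right integrable.intros[OF b])
          fix \<omega>
          have "1 \<le> exp (- l * \<epsilon>) * exp (- l * X h \<omega>)" if "X h \<omega> \<le> - \<epsilon>"
          proof -
            have "l * X h \<omega> \<le> l * (- \<epsilon>)" using that l by (intro mult_left_mono) simp_all
            then show ?thesis unfolding mult_exp_exp by simp
          qed
          then show "indicator ?A \<omega> \<le> exp (- l * \<epsilon>) * exp (- l * X h \<omega>)" by (simp add: indicator_def)
        qed
        also have "\<dots> = exp (- l * \<epsilon>) * exp (laplace_exponent b c \<pi> l * h)"
          using has_bochner_integral_integral_eq[OF b] by simp
        also have "\<dots> \<le> exp (- l * \<epsilon>) * 1"
          using np[OF l] h by (intro mult_left_mono) (simp_all add: mult_nonpos_nonneg)
        also have "\<dots> = exp (- \<epsilon>) ^ n" by (simp add: l_def exp_of_nat_mult[symmetric])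
        finally show ?thesis .
      qed simp
      have "(\<lambda>n. exp (- \<epsilon>) ^ n) \<longlonglongrightarrow> 0" using \<epsilon> by (intro LIMSEQ_realpow_zero) simp_all
      then have "prob ?A \<le> 0" by (rule LIMSEQ_le_const) (use le in blast)
      then have "prob ?A = 0" by (simp add: measure_le_0_iff)
      then show ?thesis by (subst (asm) prob_eq_0) auto
    qed
    then have "AE \<omega> in M. \<forall>n. \<not> X h \<omega> \<le> - (1 / real (Suc n))" by (subst AE_all_countable) simp
    then show ?thesis
    proof eventually_elim
      case (elim \<omega>)
      show ?case
      proof (rule ccontr)
        assume "\<not> 0 \<le> X h \<omega>"
        then obtain n where "inverse (real (Suc n)) < - X h \<omega>" using reals_Archimedean[of "- X h \<omega>"] by auto
        then have "X h \<omega> \<le> - (1 / real (Suc n))" by (simp add: inverse_eq_divide)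
        then show False using elim by blast
      qed
    qed
  qed
  have incr: "AE \<omega> in M. 0 \<le> X (real (Suc i) * h) \<omega> - X (real i * h) \<omega>" if h: "0 < h" for i h
  proof -
    have "AE v in distr M borel (X h). 0 \<le> v" using pos[OF h] by (subst AE_distr_iff) simp_all
    then have "AE v in distr M borel (\<lambda>\<omega>. X (real (Suc i) * h) \<omega> - X (real i * h) \<omega>). 0 \<le> v"
      unfolding version_stationary[OF h] .
    then show ?thesis by (subst (asm) AE_distr_iff) simp_all
  qed
  have "AE \<omega> in M. \<forall>n i. X (grid_time 1 n i) \<omega> \<le> X (grid_time 1 n (Suc i)) \<omega>"
    unfolding AE_all_countable
  proof (intro allI)
    fix n i :: nat
    have "AE \<omega> in M. 0 \<le> X (real (Suc i) * (1 / 2 ^ n)) \<omega> - X (real i * (1 / 2 ^ n)) \<omega>" by (rule incr) simp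
    then show "AE \<omega> in M. X (grid_time 1 n i) \<omega> \<le> X (grid_time 1 n (Suc i)) \<omega>"
      by eventually_elim (simp only: grid_time_def diff_ge_0_iff_ge)
  qed
  with \<Omega> show ?thesis
    unfolding nondecreasing_paths_def
  proof eventually_elim
    case (elim \<omega>)
    have "mono_on {0..} (\<lambda>t. X t \<omega>)"
      by (rule grid_mono_imp_mono_on[OF sp_path_imp_rc[OF X_sp]]) (use elim in blast)
    then show ?case using elim(1) by (auto simp: mono_on_def ver)
  qed
qed

lemma version_regular:
  assumes "\<not> nondecreasing_paths M Z"
  shows "regular_spectrally_positive M X (laplace_exponent b c \<pi>) (Phi0 b c \<pi>)"
proof -
  interpret L: levy_exponent b c \<pi> by unfold_locales (rule c_nonneg, rule levy_measure)
  have ex: "\<exists>l>0. 0 < laplace_exponent b c \<pi> l"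
    using psi_nonpos_imp_nondecreasing assms not_le by blast
  show ?thesis
  proof
    show "\<exists>C\<ge>1. \<exists>K>Phi0 b c \<pi>. \<forall>l\<ge>K. laplace_exponent b c \<pi> (2 * l) \<le> C * laplace_exponent b c \<pi> l"
      by (rule L.psi_doubling[OF ex])
  qed (fact X_meas X_np X_sp version_indep version_stationary version_laplace L.Phi0_nonneg[OF ex]
      L.psi_pos[OF ex] L.psi_nonpos[OF ex] L.psi_mono[OF ex] L.psi_measurable)+
qed

end

end

text \<open>Finiteness of the exit time is only known to agree almost surely with the measurable
  event of dying; the completion measures it and assigns the same probability.\<close>

lemma completion_AE_eq:
  assumes ae: "AE \<omega> in M. P \<omega> \<longleftrightarrow> Q \<omega>" and Q: "{\<omega> \<in> space M. Q \<omega>} \<in> sets M"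
  shows "{\<omega> \<in> space M. P \<omega>} \<in> sets (completion M)"
    "emeasure (completion M) {\<omega> \<in> space M. P \<omega>} = emeasure M {\<omega> \<in> space M. Q \<omega>}"
proof -
  have ae': "AE \<omega> in completion M. \<omega> \<in> {\<omega> \<in> space M. Q \<omega>} \<longleftrightarrow> \<omega> \<in> {\<omega> \<in> space M. P \<omega>}"
    by (rule AE_completion) (use ae in eventually_elim, auto)
  show s: "{\<omega> \<in> space M. P \<omega>} \<in> sets (completion M)"
    by (rule completion.in_sets_AE[OF ae']) (use Q in auto)
  have "emeasure (completion M) {\<omega> \<in> space M. Q \<omega>} = emeasure (completion M) {\<omega> \<in> space M. P \<omega>}"
    by (rule emeasure_eq_AE[OF ae']) (use Q s in auto)
  then show "emeasure (completion M) {\<omega> \<in> space M. P \<omega>} = emeasure M {\<omega> \<in> space M. Q \<omega>}" using Q by simp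
qed

text \<open>\<open>alive\<close> excludes only negative values. The value 0 before the exit time is
  excluded by the definition of \<open>exit_time\<close> at positive times and by hypothesis at time
  0, so the values of \<open>g\<close> outside the positive half-line do not enter.\<close>

lemma integral_functional_eq_occ:
  assumes z: "sp_path z" and z0: "0 < z 0"
    and ae: "AE t in lborel. 0 \<le> t \<longrightarrow> (ereal t < exit_time z \<longleftrightarrow> alive z t)"
  shows "integral_functional g z (exit_time z) = occ (\<lambda>u. ennreal (if 0 < u then g u else 0)) z"
  unfolding integral_functional_def occ_def
proof (rule nn_integral_cong_AE)
  show "AE s in lborel. ennreal (g (z s)) * indicator {s. 0 \<le> s \<and> ereal s < exit_time z} s =
      (if 0 \<le> s \<and> alive z s then ennreal (if 0 < z s then g (z s) else 0) else 0)"
    using ae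
  proof eventually_elim
    case (elim s)
    show ?case
    proof (cases "0 \<le> s \<and> alive z s")
      case True
      then have lt: "ereal s < exit_time z" using elim by blast
      have "0 < z s"
      proof (cases "s = 0")
        case False
        then have s: "0 < s" using True by simp
        have "z s \<noteq> 0"
        proof
          assume "z s = 0"
          then have "exit_time z \<le> ereal s" using s unfolding exit_time_def by (intro Inf_lower) auto
          then show False using lt by simp
        qed
        then show ?thesis using alive_nonneg[OF z _ s] True by simp
      qed (use z0 in simp)
      then show ?thesis using True lt by simp
    next
      case False
      then have "\<not> (0 \<le> s \<and> ereal s < exit_time z)" using elim by blast
      then have "indicator {s. 0 \<le> s \<and> ereal s < exit_time z} s = (0 :: ennreal)" by simp
      then show ?thesis using False by (simp only: if_False mult_zero_right)
    qed
  qed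
qed

section \<open>The four equivalences\<close>

theorem theorem2p1:
  fixes M :: "'a measure" and Z :: "real \<Rightarrow> 'a \<Rightarrow> real"
    and x b c :: real and \<pi> :: "real measure" and f :: "real \<Rightarrow> real"
  defines "\<zeta> \<equiv> \<lambda>\<omega>. exit_time (\<lambda>t. Z t \<omega>)"
  defines "A \<equiv> \<lambda>g \<omega>. integral_functional g (\<lambda>t. Z t \<omega>) (\<zeta> \<omega>)"
  assumes "x > 0"
    and "spectrally_positive_levy_process M Z x b c \<pi>"
    and "\<not> nondecreasing_paths M Z"
    and "f \<in> borel_measurable (restrict_space borel {0<..})"
    and "\<And>y. y > 0 \<Longrightarrow> f y > 0"
    and "\<And>\<epsilon>. \<epsilon> > 0 \<Longrightarrow> bdd_above (f ` {\<epsilon>..})"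
  defines "i \<equiv> \<P>(\<omega> in completion M. A f \<omega> < \<infinity> \<bar> \<zeta> \<omega> < \<infinity>) > 0"
    and "ii \<equiv> \<P>(\<omega> in completion M. A f \<omega> < \<infinity> \<bar> \<zeta> \<omega> < \<infinity>) = 1"
    and "iii \<equiv> \<lambda>l. (\<integral>\<^sup>+\<omega>. A (\<lambda>y. f y * exp (- l * y)) \<omega> \<partial>conditioned_on_exit M Z) < \<infinity>"
    and "iv \<equiv> \<exists>K > Phi0 b c \<pi>.
           (\<integral>\<^sup>+l\<in>{K<..}. ennreal (f (1 / l) / (l * laplace_exponent b c \<pi> l)) \<partial>lborel) < \<infinity>"
  shows "(i \<longleftrightarrow> ii) \<and> (ii \<longleftrightarrow> (\<exists>l>0. iii l)) \<and> ((\<exists>l>0. iii l) \<longleftrightarrow> (\<forall>l>0. iii l)) \<and>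
         ((\<forall>l>0. iii l) \<longleftrightarrow> iv)"
proof -
  note x = \<open>x > 0\<close>
  interpret S: spectrally_positive_levy_process M Z x b c \<pi> by fact
  obtain \<Omega> X where \<Omega>: "\<Omega> \<in> S.events" "AE \<omega> in M. \<omega> \<in> \<Omega>"
    and ver: "\<And>\<omega> t. \<omega> \<in> \<Omega> \<Longrightarrow> 0 \<le> t \<Longrightarrow> Z t \<omega> = x + X t \<omega>"
    and X: "\<And>t. X t \<in> borel_measurable M" "\<And>t \<omega>. t \<le> 0 \<Longrightarrow> X t \<omega> = 0" "\<And>\<omega>. sp_path (\<lambda>t. X t \<omega>)"
    by (rule S.ex_regular_version) (rule that)
  define p where "p = Phi0 b c \<pi>"
  define \<psi> where "\<psi> = laplace_exponent b c \<pi>"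
  interpret R: regular_spectrally_positive M X \<psi> p
    unfolding p_def \<psi>_def by (rule S.version_regular[OF \<Omega>(2) ver X \<open>\<not> nondecreasing_paths M Z\<close>])
  let ?z = "\<lambda>\<omega> s. x + X s \<omega>"
  have x0: "0 \<le> x" using x by simp
  \<comment> \<open>\<open>f\<close> is controlled on the positive half-line only; extension by 0
    gives a nonnegative Borel function on the line, as the lemmas on the potential measure
    require.\<close>
  define ft where "ft u = (if 0 < u then f u else 0)" for u
  have ft_meas: "ft \<in> borel_measurable borel"
  proof -
    have "(\<lambda>u. indicator {0<..} u *\<^sub>R f u) \<in> borel_measurable borel"
      using \<open>f \<in> borel_measurable (restrict_space borel {0<..})\<close>
      by (subst (asm) borel_measurable_restrict_space_iff) simp_all
    moreover have "(\<lambda>u. indicator {0<..} u *\<^sub>R f u) = ft" by (auto simp: ft_def fun_eq_iff)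
    ultimately show ?thesis by simp
  qed
  note ft_meas [measurable]
  have ft0: "0 \<le> ft u" for u using \<open>\<And>y. y > 0 \<Longrightarrow> f y > 0\<close>[of u] by (auto simp: ft_def intro: less_imp_le)
  have ft_np: "ft u = 0" if "u \<le> 0" for u using that by (simp add: ft_def)
  have ft_bdd: "\<exists>B. \<forall>u\<ge>\<epsilon>. ft u \<le> B" if \<epsilon>: "0 < \<epsilon>" for \<epsilon>
  proof -
    obtain B where "\<And>v. v \<in> f ` {\<epsilon>..} \<Longrightarrow> v \<le> B" using \<open>\<And>\<epsilon>. \<epsilon> > 0 \<Longrightarrow> bdd_above (f ` {\<epsilon>..})\<close>[OF \<epsilon>] by (auto simp: bdd_above_def)
    then have "ft u \<le> B" if "\<epsilon> \<le> u" for u using that \<epsilon> by (simp add: ft_def)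
    then show ?thesis by blast
  qed
  let ?J = "\<lambda>d. \<integral>\<^sup>+u\<in>{0<..<d}. ennreal (ft u) \<partial>R.potential x"
  let ?O = "\<lambda>\<omega>. occ (\<lambda>u. ennreal (ft u)) (?z \<omega>)"

  \<comment> \<open>The quantifier over g stands inside, so a single null set serves
    \<open>f\<close> and all its discounted versions.\<close>
  have key: "AE \<omega> in M. (\<zeta> \<omega> < \<infinity> \<longleftrightarrow> dies (?z \<omega>)) \<and> (\<forall>g. A g \<omega> = occ (\<lambda>u. ennreal (if 0 < u then g u else 0)) (?z \<omega>))"
    using \<Omega>(2) R.exit_time_AE[OF x]
  proof eventually_elim
    case (elim \<omega>)
    have "{t. 0 < t \<and> Z t \<omega> = 0} = {t. 0 < t \<and> ?z \<omega> t = 0}" using ver[OF elim(1)] by auto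
    then have ex: "\<zeta> \<omega> = exit_time (?z \<omega>)" unfolding \<zeta>_def exit_time_def by simp
    have "A g \<omega> = integral_functional g (?z \<omega>) (exit_time (?z \<omega>))" for g
      unfolding A_def ex integral_functional_def
      by (intro nn_integral_cong) (simp add: indicator_def ver[OF elim(1)])
    moreover have "integral_functional g (?z \<omega>) (exit_time (?z \<omega>)) = occ (\<lambda>u. ennreal (if 0 < u then g u else 0)) (?z \<omega>)" for g
      by (rule integral_functional_eq_occ[OF R.path]) (use elim(2) x in simp_all)
    ultimately show ?case using elim(2) ex by simp
  qed
  have dead: "{\<omega> \<in> space M. dies (?z \<omega>)} \<in> sets M" by measurable
  have fin: "{\<omega> \<in> space M. ?O \<omega> < \<infinity> \<and> dies (?z \<omega>)} \<in> sets M" by measurable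
  have ae1: "AE \<omega> in M. \<zeta> \<omega> < \<infinity> \<longleftrightarrow> dies (?z \<omega>)" using key by eventually_elim blast
  have ae2: "AE \<omega> in M. A f \<omega> < \<infinity> \<and> \<zeta> \<omega> < \<infinity> \<longleftrightarrow> ?O \<omega> < \<infinity> \<and> dies (?z \<omega>)"
    using key by eventually_elim (simp add: ft_def)
  define P where "P = S.prob {\<omega> \<in> space M. ?O \<omega> < \<infinity> \<and> dies (?z \<omega>)}"
  have D: "S.prob {\<omega> \<in> space M. dies (?z \<omega>)} = exp (- p * x)" by (rule R.prob_dies[OF x0])
  have cond: "\<P>(\<omega> in completion M. A f \<omega> < \<infinity> \<bar> \<zeta> \<omega> < \<infinity>) = P / exp (- p * x)"
  proof -
    have "measure (completion M) {\<omega> \<in> space M. A f \<omega> < \<infinity> \<and> \<zeta> \<omega> < \<infinity>} = P"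
      unfolding P_def measure_def completion_AE_eq(2)[OF ae2 fin] ..
    moreover have "measure (completion M) {\<omega> \<in> space M. \<zeta> \<omega> < \<infinity>} = exp (- p * x)"
      unfolding D[symmetric] measure_def completion_AE_eq(2)[OF ae1 dead] ..
    ultimately show ?thesis by (simp add: cond_prob_def)
  qed
  have i_J: "?J x < \<infinity>" if i
  proof (rule R.potential_finite_if_occ_finite[OF ft_meas ft0 ft_np ft_bdd x])
    have "0 < P" using that unfolding i_def cond by (simp add: zero_less_divide_iff)
    then have "emeasure M {\<omega> \<in> space M. ?O \<omega> < \<infinity> \<and> dies (?z \<omega>)} \<noteq> 0"
      unfolding P_def S.emeasure_eq_measure by simp
    then show "emeasure M {\<omega> \<in> space M. dies (?z \<omega>) \<and> ?O \<omega> < \<infinity>} \<noteq> 0" by (simp only: conj_commute not_False_eq_True)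
  qed
  have J_ii: ii if "0 < d" "?J d < \<infinity>" for d
  proof -
    have "AE \<omega> in M. dies (?z \<omega>) \<longrightarrow> ?O \<omega> < \<infinity>"
      by (rule R.occ_finite_AE[OF ft_meas ft0 ft_np ft_bdd x that])
    then have "P = S.prob {\<omega> \<in> space M. dies (?z \<omega>)}"
      unfolding P_def by (intro measure_eq_AE fin dead) (auto elim!: eventually_mono)
    then show ?thesis unfolding ii_def cond D by simp
  qed
  have ii_i: "ii \<Longrightarrow> i" by (simp add: i_def ii_def)
  \<comment> \<open>Both l and d are free here, so finiteness for one choice decides it for every
    other.\<close>
  have iii_J: "iii l \<longleftrightarrow> ?J d < \<infinity>" if l: "0 < l" and d: "0 < d" for l d
  proof -
    let ?g = "\<lambda>u. ennreal (ft u * exp (- l * u))"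
    let ?Q = "{\<omega> \<in> space M. \<zeta> \<omega> < \<infinity>}"
    have Q: "?Q \<in> sets (completion M)" by (rule completion_AE_eq(1)[OF ae1 dead])
    have EQ: "emeasure (completion M) ?Q = ennreal (exp (- p * x))"
      unfolding completion_AE_eq(2)[OF ae1 dead] S.emeasure_eq_measure D ..
    have ceq: "conditioned_on_exit M Z = uniform_measure (completion M) ?Q"
      by (simp add: conditioned_on_exit_def \<zeta>_def)
    have occ_m: "(\<lambda>\<omega>. occ ?g (?z \<omega>)) \<in> borel_measurable (completion M)"
      by (rule measurable_completion) measurable
    have "(\<integral>\<^sup>+\<omega>. A (\<lambda>y. f y * exp (- l * y)) \<omega> \<partial>conditioned_on_exit M Z)
      = (\<integral>\<^sup>+\<omega>. occ ?g (?z \<omega>) \<partial>uniform_measure (completion M) ?Q)"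
      unfolding ceq
    proof (rule nn_integral_cong_AE, rule AE_uniform_measureI[OF Q])
      show "AE \<omega> in completion M. \<omega> \<in> ?Q \<longrightarrow> A (\<lambda>y. f y * exp (- l * y)) \<omega> = occ ?g (?z \<omega>)"
      proof (rule AE_completion, use key in eventually_elim)
        fix \<omega> assume k: "(\<zeta> \<omega> < \<infinity> \<longleftrightarrow> dies (?z \<omega>)) \<and> (\<forall>g. A g \<omega> = occ (\<lambda>u. ennreal (if 0 < u then g u else 0)) (?z \<omega>))"
        have "A (\<lambda>y. f y * exp (- l * y)) \<omega> = occ (\<lambda>u. ennreal (if 0 < u then f u * exp (- l * u) else 0)) (?z \<omega>)"
          using k by blast
        also have "(\<lambda>u. ennreal (if 0 < u then f u * exp (- l * u) else 0)) = ?g" by (auto simp: ft_def)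
        finally show "\<omega> \<in> ?Q \<longrightarrow> A (\<lambda>y. f y * exp (- l * y)) \<omega> = occ ?g (?z \<omega>)" by blast
      qed
    qed
    also have "\<dots> = (\<integral>\<^sup>+\<omega>. occ ?g (?z \<omega>) * indicator ?Q \<omega> \<partial>M) / ennreal (exp (- p * x))"
      unfolding nn_integral_uniform_measure[OF occ_m Q] EQ nn_integral_completion ..
    also have "(\<integral>\<^sup>+\<omega>. occ ?g (?z \<omega>) * indicator ?Q \<omega> \<partial>M) = (\<integral>\<^sup>+\<omega>. of_bool (dies (?z \<omega>)) * occ ?g (?z \<omega>) \<partial>M)"
      using ae1 AE_space by (intro nn_integral_cong_AE, eventually_elim) (simp add: indicator_def)
    finally have "iii l \<longleftrightarrow> (\<integral>\<^sup>+\<omega>. of_bool (dies (?z \<omega>)) * occ ?g (?z \<omega>) \<partial>M) / ennreal (exp (- p * x)) < \<infinity>"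
      unfolding iii_def by simp
    also have "\<dots> \<longleftrightarrow> (\<integral>\<^sup>+\<omega>. of_bool (dies (?z \<omega>)) * occ ?g (?z \<omega>) \<partial>M) < \<infinity>"
      by (simp add: less_top[symmetric] ennreal_divide_eq_top_iff)
    also have "\<dots> \<longleftrightarrow> ?J d < \<infinity>"
      by (rule R.discounted_occ_finite_iff[OF ft_meas ft0 ft_np ft_bdd x d l])
    finally show ?thesis .
  qed
  let ?comp = "\<lambda>d0. \<forall>\<delta>. 0 < \<delta> \<longrightarrow> \<delta> \<le> d0 \<longrightarrow>
      (?J \<delta> < \<infinity> \<longleftrightarrow> (\<integral>\<^sup>+y\<in>{0<..<\<delta>}. ennreal (ft y / (y * \<psi> (1 / y))) \<partial>lborel) < \<infinity>)"
  have "\<exists>d0>0. ?comp d0"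
  proof (rule R.potential_comparable[OF x])
    fix D :: real
    assume "0 < D" and c: "\<And>f \<delta>. f \<in> borel_measurable borel \<Longrightarrow> (\<And>u. 0 \<le> f u) \<Longrightarrow> 0 < \<delta> \<Longrightarrow> \<delta> \<le> D \<Longrightarrow>
      (\<integral>\<^sup>+u\<in>{0<..<\<delta>}. ennreal (f u) \<partial>R.potential x) < \<infinity> \<longleftrightarrow>
      (\<integral>\<^sup>+y\<in>{0<..<\<delta>}. ennreal (f y / (y * \<psi> (1 / y))) \<partial>lborel) < \<infinity>"
    then show ?thesis using c[OF ft_meas ft0] by (intro exI[of _ D] conjI allI impI)
  qed
  then obtain d0 where d0: "0 < d0" and comp: "?comp d0" by (elim exE conjE)
  note comp = comp[rule_format]
  \<comment> \<open>With y = 1/l the weight \<open>1 / (y * \<psi> (1 / y))\<close> becomes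
    \<open>l / \<psi> l\<close>; the factor 1/l^2 from the substitution leaves
    \<open>1 / (l * \<psi> l)\<close>.\<close>
  have subst: "(\<integral>\<^sup>+l\<in>{K<..}. ennreal (f (1 / l) / (l * \<psi> l)) \<partial>lborel) =
      (\<integral>\<^sup>+y\<in>{0<..<1/K}. ennreal (ft y / (y * \<psi> (1 / y))) \<partial>lborel)" if K: "0 < K" for K
  proof -
    have "(\<integral>\<^sup>+l\<in>{K<..}. ennreal (f (1 / l) / (l * \<psi> l)) \<partial>lborel) =
      (\<integral>\<^sup>+l\<in>{K<..}. ennreal (ft (1 / l) / (1 / l * \<psi> (1 / (1 / l))) / l\<^sup>2) \<partial>lborel)"
    proof (rule nn_integral_cong)
      fix l
      show "ennreal (f (1 / l) / (l * \<psi> l)) * indicator {K<..} l = ennreal (ft (1 / l) / (1 / l * \<psi> (1 / (1 / l))) / l\<^sup>2) * indicator {K<..} l"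
      proof (cases "K < l")
        case True
        then have l: "0 < l" using K by simp
        then have "f (1 / l) / (l * \<psi> l) = ft (1 / l) / (1 / l * \<psi> (1 / (1 / l))) / l\<^sup>2"
          by (simp add: ft_def power2_eq_square)
        then show ?thesis by simp
      qed simp
    qed
    also have "\<dots> = (\<integral>\<^sup>+y\<in>{0<..<1/K}. ennreal (ft y / (y * \<psi> (1 / y))) \<partial>lborel)"
      by (rule nn_integral_inverse_substitution[OF _ K]) measurable
    finally show ?thesis .
  qed
  have iv_J: iv if J: "\<And>d. 0 < d \<Longrightarrow> ?J d < \<infinity>"
  proof -
    \<comment> \<open>With d at most 1/(p + 1), the bound K = 1/d is strictly above p, as (iv)
      requires.\<close>
    define d where "d = min d0 (1 / (p + 1))"
    have d: "0 < d" "d \<le> d0" "d \<le> 1 / (p + 1)" using d0 R.p_nonneg by (simp_all add: d_def)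
    have "p + 1 \<le> 1 / d" using d R.p_nonneg by (simp add: field_simps)
    then have K: "p < 1 / d" "0 < 1 / d" using R.p_nonneg d by simp_all
    have "(\<integral>\<^sup>+l\<in>{1/d<..}. ennreal (f (1 / l) / (l * \<psi> l)) \<partial>lborel) < \<infinity>"
      unfolding subst[OF K(2)] using comp[OF d(1,2)] J[OF d(1)] by simp
    then show ?thesis unfolding iv_def using K(1) by (auto simp: p_def \<psi>_def)
  qed
  have J_iv: "\<exists>d>0. ?J d < \<infinity>" if iv_holds: iv
  proof -
    obtain K where K: "p < K" and lt: "(\<integral>\<^sup>+l\<in>{K<..}. ennreal (f (1 / l) / (l * \<psi> l)) \<partial>lborel) < \<infinity>"
      using iv_holds unfolding iv_def p_def \<psi>_def by blast
    have K0: "0 < K" using K R.p_nonneg by simp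
    define d where "d = min d0 (1 / K)"
    have d: "0 < d" "d \<le> d0" "d \<le> 1 / K" using d0 K0 by (simp_all add: d_def)
    have "(\<integral>\<^sup>+y\<in>{0<..<d}. ennreal (ft y / (y * \<psi> (1 / y))) \<partial>lborel) \<le> (\<integral>\<^sup>+y\<in>{0<..<1/K}. ennreal (ft y / (y * \<psi> (1 / y))) \<partial>lborel)"
      using d by (intro nn_integral_mono mult_left_mono) (auto simp: indicator_def)
    also have "\<dots> < \<infinity>" using lt unfolding subst[OF K0] .
    finally show ?thesis using comp[OF d(1,2)] d(1) by blast
  qed
  have Jx: "?J x < \<infinity> \<longleftrightarrow> i" "ii \<longleftrightarrow> i" using i_J J_ii[OF x] ii_i by blast+
  \<comment> \<open>Both sides are compared with (iii) at l = 1, which does not involve d.\<close>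
  have JJ: "?J d < \<infinity> \<longleftrightarrow> ?J x < \<infinity>" if "0 < d" for d
    using iii_J[OF zero_less_one that] iii_J[OF zero_less_one x] by blast
  have all: "iii l \<longleftrightarrow> i" if "0 < l" for l using iii_J[OF that x] Jx by blast
  have "iv \<longleftrightarrow> i" using iv_J J_iv JJ Jx by blast
  moreover have "(\<exists>l>0. iii l) \<longleftrightarrow> i" using all zero_less_one by blast
  moreover have "(\<forall>l>0. iii l) \<longleftrightarrow> i" using all zero_less_one by blast
  ultimately show ?thesis using Jx(2) by blast
qed

end
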